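(* Let $\ell$ be a positive integer and let $\beta \in [0,1)$, both fixed. Then for all sufficiently large $T$, \[ \max_{t \in [T^\beta,T]} \operatorname{Re} \zeta^{(\ell)}\left(\frac{1}{2}+\mathrm{i}t\right) \ge \exp\left(\left(\sqrt{1-\beta}+o(1)\right)\sqrt{\frac{\log T\, \log\log\log T}{\log\log T}} \right), \] where $o(1)$ denotes a quantity tending to $0$ as $T\to\infty$ (with $\ell$ and $\beta$ fixed).
   Context: $\zeta(s)$ denotes the Riemann zeta function (with its meromorphic continuation to $\mathbb{C}$), $\zeta^{(\ell)}$ denotes its $\ell$-th derivative with respect to the complex variable $s$, $\operatorname{Re}$ denotes the real part, and $\log$ is the natural logarithm. *)

theory Defs
  imports "HOL-Complex_Analysis.Complex_Analysis"
begin

lemma zeta_summable: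
  assumes "1 < Re s"
  shows "summable (\<lambda>n. norm (1 / of_nat (Suc n) powr s :: complex))"
proof -
  have "norm (1 / of_nat (Suc n) powr s :: complex) = real (Suc n) powr (- Re s)" for n
    using norm_powr_real_powr[of "of_nat (Suc n)" s]
    by (simp add: norm_divide norm_inverse powr_minus divide_inverse del: of_nat_Suc)
  moreover have "summable (\<lambda>n. real (Suc n) powr (- Re s))"
    using assms by (subst summable_Suc_iff) (simp add: summable_real_powr_iff)
  ultimately show ?thesis by presburger
qed

lemma open_halfplane: "open {s. a < Re s}" and convex_halfplane: "convex {s. a < Re s}"
  by (simp_all add: open_halfspace_Re_gt convex_halfspace_Re_gt)

lemma cball_in_halfplane:
  assumes "a < Re s"
  obtains d where "d > 0" "a < Re s - d" "cball s d \<subseteq> {z. a < Re z}"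
    "\<And>z. z \<in> cball s d \<Longrightarrow> Re s - d \<le> Re z"
proof -
  define d where "d = (Re s - a) / 2"
  have ge: "Re s - d \<le> Re z" if "z \<in> cball s d" for z
    using that abs_Re_le_cmod[of "s - z"] by (auto simp: dist_norm)
  have "d > 0" "a < Re s - d" using assms by (auto simp: d_def field_simps)
  then show ?thesis using ge by (intro that[of d]) force+
qed

lemma holomorphic_suminf_powr:
  fixes f :: "nat \<Rightarrow> complex \<Rightarrow> complex"
  assumes hol: "\<And>n. f n holomorphic_on {s. 1 - a < Re s}"
    and c: "continuous_on UNIV c"
    and bd: "\<And>n s. 1 - a < Re s \<Longrightarrow> norm (f n s) \<le> c s * real (Suc n) powr (- a - Re s)"
  shows "(\<lambda>s. \<Sum>n. f n s) holomorphic_on {s. 1 - a < Re s}"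
    and "1 - a < Re s \<Longrightarrow> summable (\<lambda>n. f n s)"
proof -
  have sm: "summable (\<lambda>n. C * real (Suc n) powr x)" if "x < -1" for x C
    using that by (intro summable_mult, subst summable_Suc_iff) (simp add: summable_real_powr_iff)
  show "summable (\<lambda>n. f n s)" if "1 - a < Re s" for s
    using bd[OF that] that by (intro summable_comparison_test'[OF sm]) auto
  show "(\<lambda>s. \<Sum>n. f n s) holomorphic_on {s. 1 - a < Re s}"
  proof (rule holomorphic_uniform_sequence[OF open_halfplane, where f = "\<lambda>N s. \<Sum>n<N. f n s"])
    show "(\<lambda>s. \<Sum>n<N. f n s) holomorphic_on {s. 1 - a < Re s}" for N
      by (intro holomorphic_intros hol)
    fix s assume "s \<in> {s. 1 - a < Re s}"
    then obtain d where d: "d > 0" "1 - a < Re s - d" "cball s d \<subseteq> {z. 1 - a < Re z}"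
      "\<And>z. z \<in> cball s d \<Longrightarrow> Re s - d \<le> Re z"
      using cball_in_halfplane[of "1 - a" s] by auto
    have "compact (c ` cball s d)"
      by (intro compact_continuous_image continuous_on_subset[OF c]) auto
    then obtain C where C: "\<And>z. z \<in> cball s d \<Longrightarrow> c z \<le> C"
      by (meson bounded_imp_bdd_above compact_imp_bounded bdd_above.E imageI)
    have "uniform_limit (cball s d) (\<lambda>N s. \<Sum>n<N. f n s) (\<lambda>s. \<Sum>n. f n s) sequentially"
    proof (rule Weierstrass_m_test)
      fix n z assume z: "z \<in> cball s d"
      have "0 \<le> norm (f n z)" by simp
      also have "norm (f n z) \<le> c z * real (Suc n) powr (- a - Re z)" using bd z d(3) by auto
      finally have "0 \<le> c z" by (simp add: zero_le_mult_iff)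
      have "norm (f n z) \<le> c z * real (Suc n) powr (- a - Re z)" using bd z d(3) by auto
      also have "\<dots> \<le> C * real (Suc n) powr (- a - (Re s - d))"
        using C[OF z] \<open>0 \<le> c z\<close> d(4)[OF z] by (intro mult_mono powr_mono) auto
      finally show "norm (f n z) \<le> C * real (Suc n) powr (- a - (Re s - d))" .
    qed (rule sm, use d in simp)
    with d show "\<exists>d>0. cball s d \<subseteq> {s. 1 - a < Re s} \<and>
        uniform_limit (cball s d) (\<lambda>N s. \<Sum>n<N. f n s) (\<lambda>s. \<Sum>n. f n s) sequentially"
      by blast
  qed
qed

lemma taylor_powr_bound:
  fixes s :: complex and n K :: nat
  assumes "- real K \<le> Re s"
  shows "norm (of_nat (Suc (Suc n)) powr (1 - s) - (\<Sum>k\<le>K. ((1 - s) gchoose k) * of_nat (Suc n) powr (1 - s - of_nat k)))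
     \<le> norm (\<Prod>j=0..<Suc K. 1 - s - of_nat j) * real (Suc n) powr (- real K - Re s)"
proof -
  define w z :: complex where "w = of_nat (Suc n)" and "z = of_nat (Suc (Suc n))"
  define S where "S = closed_segment w z"
  define f where "f = (\<lambda>i x. (\<Prod>j=0..<i. 1 - s - of_nat j) * x powr (1 - s - of_nat i))"
  define B where "B = norm (\<Prod>j=0..<Suc K. 1 - s - of_nat j) * real (Suc n) powr (- real K - Re s)"
  have S: "\<exists>r. x = of_real r \<and> real (Suc n) \<le> r" if "x \<in> S" for x
  proof -
    obtain u where u: "0 \<le> u" "u \<le> 1" "x = (1 - u) *\<^sub>R w + u *\<^sub>R z"
      using \<open>x \<in> S\<close> by (auto simp: S_def closed_segment_def)
    then have "x = of_real (real (Suc n) + u)"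
      by (simp add: w_def z_def scaleR_conv_of_real algebra_simps)
    then show ?thesis using u by (intro exI[of _ "real (Suc n) + u"]) auto
  qed
  have "cmod (f 0 z - (\<Sum>i\<le>K. f i w * (z - w) ^ i / fact i)) \<le> B * cmod (z - w) ^ Suc K / fact K"
  proof (rule complex_Taylor)
    show "convex S" "w \<in> S" "z \<in> S" by (auto simp: S_def)
  next
    fix i x assume "x \<in> S"
    then obtain r where r: "x = of_real r" "real (Suc n) \<le> r" using S by blast
    then have "x \<notin> \<real>\<^sub>\<le>\<^sub>0" by (auto simp: complex_nonpos_Reals_iff)
    then show "(f i has_field_derivative f (Suc i) x) (at x within S)"
      unfolding f_def by (auto intro!: derivative_eq_intros simp: algebra_simps)
  next
    fix x assume "x \<in> S"
    then obtain r where r: "x = of_real r" "real (Suc n) \<le> r" using S by blast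
    then have "norm (x powr (1 - s - of_nat (Suc K))) = r powr (- real K - Re s)"
      by (subst norm_powr_real_powr) (auto intro!: arg_cong[where f = "\<lambda>x. r powr x"])
    also have "\<dots> \<le> real (Suc n) powr (- real K - Re s)"
      using r assms by (intro powr_mono2') auto
    finally show "cmod (f (Suc K) x) \<le> B"
      unfolding f_def B_def norm_mult by (intro mult_left_mono) auto
  qed
  moreover have "z - w = 1" by (simp add: z_def w_def)
  moreover have "f i w / fact i = ((1 - s) gchoose i) * w powr (1 - s - of_nat i)" for i
    by (simp add: f_def gbinomial_prod_rev)
  moreover have "B / fact K \<le> B"
  proof -
    have "0 \<le> B" by (simp add: B_def)
    then have "B * 1 \<le> B * fact K" by (intro mult_left_mono) auto
    then show ?thesis by (simp add: field_simps)
  qed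
  ultimately show ?thesis
    by (simp add: f_def B_def z_def w_def)
qed


(* Summing the Taylor expansion of (n+2)^(1-s) around n+1 over all n telescopes and expresses
   (s - 1) zeta(s) through the values (s + j - 1) zeta(s + j), j >= 1, which is what allows one
   to continue (s - 1) zeta(s) to the left by one unit at a time. *)
lemma zeta_recursion:
  fixes s :: complex and K :: nat
  defines "t \<equiv> \<lambda>s::complex. \<Sum>n. 1 / of_nat (Suc n) powr s"
    and "R \<equiv> \<lambda>n s::complex. of_nat (Suc (Suc n)) powr (1 - s)
            - (\<Sum>k\<le>Suc K. ((1 - s) gchoose k) * of_nat (Suc n) powr (1 - s - of_nat k))"
  assumes s: "1 < Re s" and R: "summable (\<lambda>n. R n s)"
  shows "(s - 1) * t s = 1 - (\<Sum>j=1..K. ((1 - s) gchoose j) / of_nat (Suc j) * ((s + of_nat j - 1) * t (s + of_nat j)))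
            + (\<Sum>n. R n s)"
proof -
  define g where "g = (\<lambda>n. of_nat (Suc n) powr (1 - s) :: complex)"
  have "(\<lambda>n. real (Suc n) powr (1 - Re s)) \<longlonglongrightarrow> 0"
    using s by (intro tendsto_neg_powr filterlim_compose[OF filterlim_real_sequentially filterlim_Suc]) auto
  also have "(\<lambda>n. real (Suc n) powr (1 - Re s)) = (\<lambda>n. norm (g n))"
    unfolding g_def by (subst norm_powr_real_powr) auto
  finally have "g \<longlonglongrightarrow> 0" by (rule tendsto_norm_zero_cancel)
  then have tele: "(\<lambda>n. g (Suc n) - g n) sums (0 - g 0)" by (rule telescope_sums)
  have tsums: "(\<lambda>n. 1 / of_nat (Suc n) powr z) sums t z" if "1 < Re z" for z :: complex
    unfolding t_def by (intro summable_sums summable_norm_cancel[OF zeta_summable] that)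
  have "(\<lambda>n. (\<Sum>k=1..Suc K. ((1 - s) gchoose k) * (1 / of_nat (Suc n) powr (s + of_nat (k - 1)))) + R n s)
          sums ((\<Sum>k=1..Suc K. ((1 - s) gchoose k) * t (s + of_nat (k - 1))) + (\<Sum>n. R n s))"
    using s R by (intro sums_add sums_sum sums_mult tsums summable_sums) auto
  moreover have "(\<Sum>k=1..Suc K. ((1 - s) gchoose k) * (1 / of_nat (Suc n) powr (s + of_nat (k - 1)))) + R n s
      = g (Suc n) - g n" for n
  proof -
    have "{..Suc K} = insert 0 {1..Suc K}" by auto
    then have "(\<Sum>k\<le>Suc K. ((1 - s) gchoose k) * of_nat (Suc n) powr (1 - s - of_nat k)) =
        g n + (\<Sum>k=1..Suc K. ((1 - s) gchoose k) * of_nat (Suc n) powr (1 - s - of_nat k))"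
      by (simp add: g_def)
    also have "(\<Sum>k=1..Suc K. ((1 - s) gchoose k) * of_nat (Suc n) powr (1 - s - of_nat k))
      = (\<Sum>k=1..Suc K. ((1 - s) gchoose k) * (1 / of_nat (Suc n) powr (s + of_nat (k - 1))))"
    proof (rule sum.cong)
      fix k assume "k \<in> {1..Suc K}"
      then have "1 - s - of_nat k = - (s + of_nat (k - 1))" by (simp add: of_nat_diff)
      then show "((1 - s) gchoose k) * of_nat (Suc n) powr (1 - s - of_nat k)
        = ((1 - s) gchoose k) * (1 / of_nat (Suc n) powr (s + of_nat (k - 1)))"
        by (metis powr_minus_divide)
    qed simp
    finally show ?thesis by (simp add: R_def g_def)
  qed
  ultimately have 1: "(\<Sum>k=1..Suc K. ((1 - s) gchoose k) * t (s + of_nat (k - 1))) + (\<Sum>n. R n s) = 0 - g 0"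
    using tele sums_unique2 by simp
  have 2: "(\<Sum>k=1..Suc K. ((1 - s) gchoose k) * t (s + of_nat (k - 1)))
      = (1 - s) * t s + (\<Sum>j=1..K. ((1 - s) gchoose Suc j) * t (s + of_nat j))"
  proof -
    have "(\<Sum>k=1..Suc K. ((1 - s) gchoose k) * t (s + of_nat (k - 1)))
      = (\<Sum>j=0..K. ((1 - s) gchoose Suc j) * t (s + of_nat j))"
      using sum.shift_bounds_cl_Suc_ivl[of "\<lambda>k. ((1 - s) gchoose k) * t (s + of_nat (k - 1))" 0 K] by simp
    also have "\<dots> = (1 - s) * t s + (\<Sum>j=1..K. ((1 - s) gchoose Suc j) * t (s + of_nat j))"
      by (subst sum.atLeast_Suc_atMost) auto
    finally show ?thesis .
  qed
  have 3: "((1 - s) gchoose Suc j) * t (s + of_nat j)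
      = - (((1 - s) gchoose j) / of_nat (Suc j) * ((s + of_nat j - 1) * t (s + of_nat j)))" for j
  proof -
    have "((1 - s) gchoose Suc j) = ((1 - s) gchoose j) * (1 - s - of_nat j) / of_nat (Suc j)"
      using gbinomial_mult_1[of "1 - s" j] by (simp add: field_simps del: of_nat_Suc)
    also have "\<dots> = - (((1 - s) gchoose j) / of_nat (Suc j) * (s + of_nat j - 1))"
      by (simp add: divide_inverse algebra_simps)
    finally show ?thesis by (simp only:) (simp add: mult_ac)
  qed
  have 4: "g 0 = 1" by (simp add: g_def)
  have "(s - 1) * a = 1 - b + c" if "(1 - s) * a + - b + c = 0 - 1" for a b c
    using that by algebra
  then show ?thesis
    using 1 unfolding 2 3 4 sum_negf .
qed

lemma zeta_halfplane:
  "\<exists>Z. Z holomorphic_on {s. 1 - real m < Re s} \<and>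
       (\<forall>s. 1 < Re s \<longrightarrow> Z s = (s - 1) * (\<Sum>n. 1 / of_nat (Suc n) powr s))"
proof (induction m)
  case 0
  have "(\<lambda>s. \<Sum>n. 1 / of_nat (Suc n) powr s) holomorphic_on {s. 1 - 0 < Re s}"
  proof (rule holomorphic_suminf_powr(1)[where c = "\<lambda>_. 1"])
    show "norm (1 / of_nat (Suc n) powr s :: complex) \<le> 1 * real (Suc n) powr (- 0 - Re s)" for n s
      using norm_powr_real_powr[of "of_nat (Suc n)" s]
      by (simp add: norm_divide norm_inverse powr_minus divide_inverse del: of_nat_Suc)
  qed (auto intro!: holomorphic_intros simp del: of_nat_Suc)
  then show ?case
    by (intro exI[of _ "\<lambda>s. (s - 1) * (\<Sum>n. 1 / of_nat (Suc n) powr s)"] conjI holomorphic_intros) auto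
next
  case (Suc m)
  then obtain Z where Z: "Z holomorphic_on {s. 1 - real m < Re s}"
    "\<And>s. 1 < Re s \<Longrightarrow> Z s = (s - 1) * (\<Sum>n. 1 / of_nat (Suc n) powr s)" by blast
  define R :: "nat \<Rightarrow> complex \<Rightarrow> complex" where "R = (\<lambda>n s. of_nat (Suc (Suc n)) powr (1 - s)
            - (\<Sum>k\<le>Suc m. ((1 - s) gchoose k) * of_nat (Suc n) powr (1 - s - of_nat k)))"
  define c where "c = (\<lambda>s::complex. norm (\<Prod>j=0..<Suc (Suc m). 1 - s - of_nat j))"
  have bd: "norm (R n s) \<le> c s * real (Suc n) powr (- real (Suc m) - Re s)"
    if "1 - real (Suc m) < Re s" for n s
    unfolding R_def c_def by (rule taylor_powr_bound) (use that in simp)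
  have gb: "(\<lambda>s. (1 - s :: complex) gchoose k) holomorphic_on A" for k A
    unfolding gbinomial_prod_rev by (intro holomorphic_intros) auto
  have hol: "R n holomorphic_on A" for n A
    unfolding R_def by (intro holomorphic_intros gb) (auto simp: simp del: of_nat_Suc)
  have cont: "continuous_on UNIV c" unfolding c_def by (intro continuous_intros)
  note RR = holomorphic_suminf_powr[of R, OF hol cont bd]
  define Y where "Y = (\<lambda>s. 1 - (\<Sum>j=1..m. ((1 - s) gchoose j) / of_nat (Suc j) * Z (s + of_nat j)) + (\<Sum>n. R n s))"
  have "(Z \<circ> (\<lambda>s. s + of_nat j)) holomorphic_on {s. 1 - real (Suc m) < Re s}" if "j \<in> {1..m}" for j
    by (rule holomorphic_on_compose_gen[OF _ Z(1)]) (use that in \<open>auto intro!: holomorphic_intros\<close>)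
  then have "Y holomorphic_on {s. 1 - real (Suc m) < Re s}"
    unfolding Y_def by (intro holomorphic_intros gb RR(1)) (auto simp: o_def simp del: of_nat_Suc)
  moreover have "Y s = (s - 1) * (\<Sum>n. 1 / of_nat (Suc n) powr s)" if "1 < Re s" for s
  proof -
    have "summable (\<lambda>n. R n s)" by (rule RR(2)) (use that in auto)
    from zeta_recursion[OF that, of m] this show ?thesis
      unfolding Y_def R_def using that by (simp add: Z(2) del: of_nat_Suc)
  qed
  ultimately show ?case by blast
qed

lemma zeta_entire:
  "\<exists>Z. Z holomorphic_on UNIV \<and> (\<forall>s. 1 < Re s \<longrightarrow> Z s = (s - 1) * (\<Sum>n. 1 / of_nat (Suc n) powr s))"
proof -
  have "\<exists>Z. \<forall>m. Z m holomorphic_on {s. 1 - real m < Re s} \<and>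
          (\<forall>s. 1 < Re s \<longrightarrow> Z m s = (s - 1) * (\<Sum>n. 1 / of_nat (Suc n) powr s))"
    by (intro choice allI zeta_halfplane)
  then obtain Z where Z: "\<And>m. Z m holomorphic_on {s. 1 - real m < Re s}"
    "\<And>m s. 1 < Re s \<Longrightarrow> Z m s = (s - 1) * (\<Sum>n. 1 / of_nat (Suc n) powr s)"
    by (elim exE) blast
  define M where "M = (\<lambda>s. nat (\<lceil>2 - Re s\<rceil>))"
  have M: "1 - real (M s) < Re s" for s unfolding M_def by linarith
  have eq: "Z m s = Z k s" if "1 - real m < Re s" "1 - real k < Re s" for m k s
  proof (rule analytic_continuation_open[where f = "Z m" and g = "Z k" and s = "{s. 1 < Re s}"
        and s' = "{s. 1 - min (real m) (real k) < Re s}"])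
    have "(2 :: complex) \<in> {s. 1 < Re s}" by simp
    then show "{s. 1 < Re s} \<noteq> {}" by blast
    show "Z m holomorphic_on {s. 1 - min (real m) (real k) < Re s}"
      and "Z k holomorphic_on {s. 1 - min (real m) (real k) < Re s}"
      by (auto intro!: holomorphic_on_subset[OF Z(1)])
    show "connected {s. 1 - min (real m) (real k) < Re s}"
      by (rule convex_connected[OF convex_halfplane])
    show "{s. 1 < Re s} \<subseteq> {s. 1 - min (real m) (real k) < Re s}" by auto
    show "s \<in> {s. 1 - min (real m) (real k) < Re s}" using that by auto
    show "Z m z = Z k z" if "z \<in> {s. 1 < Re s}" for z using Z(2) that by simp
  qed (rule open_halfplane)+
  have "(\<lambda>s. Z (M s) s) holomorphic_on (\<Union>m. {s. 1 - real m < Re s})"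
  proof (rule holomorphic_on_UN_open)
    fix m
    show "(\<lambda>s. Z (M s) s) holomorphic_on {s. 1 - real m < Re s}"
    proof (rule holomorphic_transform[OF Z(1)[of m]])
      show "Z m s = Z (M s) s" if "s \<in> {s. 1 - real m < Re s}" for s
        by (rule eq[OF _ M]) (use that in simp)
    qed
  qed (rule open_halfplane)
  moreover have "(\<Union>m. {s. 1 - real m < Re s}) = UNIV" using M by blast
  ultimately show ?thesis using Z(2) by (intro exI[of _ "\<lambda>s. Z (M s) s"]) auto
qed

lemma nicely_meromorphic_unique:
  assumes f: "f nicely_meromorphic_on UNIV" and g: "g nicely_meromorphic_on UNIV"
    and eq: "\<And>s. 1 < Re s \<Longrightarrow> f s = g s"
  shows "f = g"
proof
  fix z
  have mero: "(\<lambda>s. f s - g s) meromorphic_on UNIV"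
    using f g unfolding nicely_meromorphic_on_def by (intro meromorphic_on_diff) blast+
  have "\<forall>\<^sub>F s in at (2 :: complex). s \<in> {s. 1 < Re s}"
    by (intro eventually_at_in_open' open_halfplane) auto
  then have "\<forall>\<^sub>F s in at 2. f s - g s = 0" by eventually_elim (use eq in auto)
  then have "\<forall>\<^sub>F s in at z. f s - g s = 0"
  proof -
    have "\<not> (\<forall>\<^sub>F s in at 2. f s - g s \<noteq> 0)"
    proof
      assume "\<forall>\<^sub>F s in at 2. f s - g s \<noteq> 0"
      with \<open>\<forall>\<^sub>F s in at 2. f s - g s = 0\<close> have "\<forall>\<^sub>F s in at (2 :: complex). False"
        by eventually_elim blast
      then show False by simp
    qed
    then show ?thesis
      using meromorphic_imp_constant_or_avoid[OF mero open_UNIV connected_UNIV, of 0]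
      by (auto simp: eventually_cosparse_open_eq)
  qed
  then have ev: "\<forall>\<^sub>F s in at z. f s = g s" by eventually_elim simp
  then have pole: "is_pole f z \<longleftrightarrow> is_pole g z" by (intro is_pole_cong) auto
  have "f \<midarrow>z\<rightarrow> l \<longleftrightarrow> g \<midarrow>z\<rightarrow> l" for l using ev by (rule tendsto_cong)
  then show "f z = g z"
    using f g pole unfolding nicely_meromorphic_on_def
    by (metis LIM_unique UNIV_I not_tendsto_and_filterlim_at_infinity is_pole_def at_neq_bot)
qed

(* The meromorphic continuation of the Dirichlet series to the whole plane; its existence and
   uniqueness are zeta_ex1 below. "Nicely" meromorphic only fixes the value 0 at the pole. *)
definition zeta :: "complex \<Rightarrow> complex" where
  "zeta = (THE f. f nicely_meromorphic_on UNIV \<and>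
             (\<forall>s. 1 < Re s \<longrightarrow> f s = (\<Sum>n. 1 / of_nat (Suc n) powr s)))"

lemma zeta_ex1:
  "\<exists>!f. f nicely_meromorphic_on UNIV \<and>
        (\<forall>s. 1 < Re s \<longrightarrow> f s = (\<Sum>n. 1 / of_nat (Suc n) powr s))"
proof -
  obtain Z where Z: "Z holomorphic_on UNIV"
    "\<And>s. 1 < Re s \<Longrightarrow> Z s = (s - 1) * (\<Sum>n. 1 / of_nat (Suc n) powr s)"
    using zeta_entire by blast
  define f where "f = (\<lambda>s. Z s / (s - 1))"
  have "Z analytic_on UNIV" using Z(1) by (simp add: analytic_on_open)
  then have "f meromorphic_on UNIV"
    unfolding f_def by (intro meromorphic_intros analytic_on_imp_meromorphic_on)
  then have "remove_sings f nicely_meromorphic_on UNIV" by (rule remove_sings_nicely_meromorphic)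
  moreover have "remove_sings f s = (\<Sum>n. 1 / of_nat (Suc n) powr s)" if s: "1 < Re s" for s
  proof -
    have "f analytic_on {s}"
      unfolding f_def using s
      by (intro analytic_intros analytic_on_subset[OF \<open>Z analytic_on UNIV\<close>]) auto
    then have "remove_sings f s = f s" by (rule remove_sings_at_analytic)
    then show ?thesis using Z(2) s by (auto simp: f_def)
  qed
  ultimately show ?thesis
    by (intro ex1I[of _ "remove_sings f"]) (auto intro!: nicely_meromorphic_unique)
qed

lemma zeta_nicely_meromorphic: "zeta nicely_meromorphic_on UNIV"
  and zeta_eq_suminf: "1 < Re s \<Longrightarrow> zeta s = (\<Sum>n. 1 / of_nat (Suc n) powr s)"
  using theI'[OF zeta_ex1] unfolding zeta_def[symmetric] by auto

end

theory Submission
  imports Defs "HOL-Probability.Characteristic_Functions" "HOL-Real_Asymp.Real_Asymp"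
    "HOL-Number_Theory.Prime_Powers"
begin

text \<open>
  The proof is a resonance argument, in three parts.

  Smoothing. Put \<open>\<sigma> = (-1)^l\<close>. Averaging \<open>Re zeta^(l)(1/2 + i(t + u))\<close> over \<open>u\<close> against a weight
  \<open>H \<ge> 0\<close> turns it into an almost periodic function \<open>D(t) = \<Sum> a(k) cos(t ln k)\<close> with
  \<open>a(k) = (-ln k)^l k^(-1/2) H^(ln k)\<close>, where \<open>H^\<close> is the Fourier transform, up to an error that is
  small once \<open>t\<close> is away from the pole (\<open>smoothed_zeta_identity\<close>). The method needs \<open>a(k) \<ge> 0\<close>, so for
  odd \<open>l\<close> the transform of the nonnegative weight must be negative at every \<open>ln k\<close>. The weight
  \<open>H(u) = exp(-u\<^sup>2/2v) (\<Sum>j\<le>J. 1 + \<sigma> cos(ju))\<close> does this: for \<open>\<sigma> = -1\<close> the only positive part of its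
  transform is a bump at 0, which is already dominated at \<open>ln 2\<close>, and \<open>k = 1\<close> does not matter because
  \<open>(ln 1)^l = 0\<close>. This is why the real part becomes large and positive for both parities of \<open>l\<close>. An
  upper bound \<open>S\<close> for \<open>Re zeta^(l)\<close> on \<open>[T^\<beta>, T]\<close> now bounds \<open>D\<close> there, up to powers of \<open>ln T\<close>
  (\<open>smoothed_sum_le_sup\<close>).

  Resonance. Integrate \<open>D(t) |R(t)|\<^sup>2 exp(-t\<^sup>2/2\<tau>\<^sup>2)\<close> with \<open>\<tau>\<close> slightly smaller than \<open>T\<close> and \<open>R\<close> a
  trigonometric polynomial with nonnegative coefficients built from a function \<open>f\<close> on a finite set
  \<open>M\<close> of integers. All terms of the expansion are nonnegative, and those with \<open>m = k n\<close> give a lower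
  bound by the sum of \<open>a(m/n) f(n) f(m)\<close> over the pairs with \<open>n dvd m\<close>; hence \<open>D\<close> is somewhere as large
  as a constant times this sum divided by \<open>\<Sum> f(m)\<^sup>2\<close> (\<open>resonance\<close>). The range \<open>|t| \<le> T^\<beta>\<close>, where nothing is known about
  \<open>D\<close>, contributes at most \<open>T^\<beta> |M|\<close> up to small powers of \<open>T\<close>, against a main term of size about \<open>T\<close>.
  So \<open>|M|\<close> may be as large as a power \<open>T^lam\<close> with any \<open>lam < 1 - \<beta>\<close>, and this is the source of the factor
  \<open>sqrt (1 - \<beta>)\<close>.

  The resonator. With \<open>L = ln T\<close>, split the primes into blocks between \<open>exp(A k) L\<close> and
  \<open>exp(A (k+1)) L\<close>. Let \<open>M\<close> consist of the products with exactly \<open>w(k)\<close> primes from the \<open>k\<close>-th block for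
  all \<open>k\<close>, together with those with exactly \<open>w(k) - s(k)\<close> primes, and let \<open>f(m)\<close> be proportional to
  \<open>m^(-1/2)\<close> on both parts. The sum over pairs then factors over the blocks
  (\<open>layered_resonator\<close>), and a block contributes about \<open>exp(sqrt(w(k) E))\<close>, where \<open>E\<close> is the sum of \<open>1/p\<close>
  over the block (\<open>block_gain\<close>), about \<open>A / ln L\<close> by Mertens' theorem (\<open>mertens_interval\<close>). On the other
  hand \<open>ln |M|\<close> is about \<open>\<Sum> w(k) A k\<close>. Taking \<open>w(k)\<close> proportional to \<open>L / (k\<^sup>2 ln ln L)\<close>, with
  \<open>k\<close> between \<open>(ln ln L)\<^sup>2\<close> and \<open>ln L / (ln ln L)\<^sup>2\<close>, both \<open>ln |M|\<close> and the logarithm of the gain become multiples of the sum of \<open>1/k\<close>,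
  which is about \<open>ln ln L\<close>: the first is \<open>lam L\<close> and the second is
  \<open>sqrt (lam L ln ln L / ln L)\<close> (\<open>resonator_exists\<close>).
\<close>

abbreviation zeta_crit :: "nat \<Rightarrow> real \<Rightarrow> complex" where
  "zeta_crit l t \<equiv> (deriv ^^ l) zeta (Complex (1/2) t)"

abbreviation gauss :: "real \<Rightarrow> real \<Rightarrow> real" where
  "gauss v u \<equiv> exp (- u\<^sup>2 / (2 * v))"

abbreviation dvd_pair_sum :: "nat set \<Rightarrow> (nat \<Rightarrow> real) \<Rightarrow> (nat \<Rightarrow> real) \<Rightarrow> real" where
  "dvd_pair_sum M a f \<equiv> (\<Sum>(n,m)\<in>{(n,m). n \<in> M \<and> m \<in> M \<and> n dvd m}. a (m div n) * f n * f m)"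

lemma power_le_fact_exp:
  assumes "x \<ge> 0"
  shows "x ^ n \<le> fact n * exp (x::real)"
proof -
  have "x ^ n / fact n \<le> exp x"
    using sum_le_suminf[OF summable_exp_generic[of x], of "{n}"] assms
    by (simp add: exp_def divide_inverse mult_ac)
  then show ?thesis by (simp add: field_simps)
qed

section \<open>Derivatives of zeta near the critical line\<close>

text \<open>
  The characteristic function of the standard normal distribution, rescaled by \<open>sqrt v\<close>.
\<close>
lemma gauss_ft:
  assumes v: "v > 0"
  shows "has_bochner_integral lborel (\<lambda>u. gauss v u *\<^sub>R cis (x * u)) (complex_of_real (sqrt (2*pi * v) * exp (- v * x\<^sup>2 / 2)))"
proof -
  have int: "integrable lborel (\<lambda>u. std_normal_density u *\<^sub>R iexp (y * u))" for y
    by (rule Bochner_Integration.integrable_bound[where f=std_normal_density]) auto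
  have "has_bochner_integral lborel (\<lambda>u. std_normal_density u *\<^sub>R iexp (y * u)) (complex_of_real (exp (- y\<^sup>2 / 2)))" for y
  proof -
    have "complex_of_real (exp (- y\<^sup>2 / 2)) = char std_normal_distribution y"
      by (simp add: char_std_normal_distribution)
    also have "\<dots> = (LBINT u. std_normal_density u *\<^sub>R iexp (y * u))"
      unfolding char_def by (subst integral_density) auto
    finally show ?thesis using int[of y] by (simp add: has_bochner_integral_iff)
  qed
  from this[of "x * sqrt v"]
  have "has_bochner_integral lborel (\<lambda>u. std_normal_density (0 + (1/sqrt v) * u) *\<^sub>R iexp ((x * sqrt v) * (0 + (1/sqrt v) * u)))
     (complex_of_real (exp (- (x * sqrt v)\<^sup>2 / 2)) /\<^sub>R \<bar>1/sqrt v\<bar>)"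
    using v by (subst (asm) lborel_has_bochner_integral_real_affine_iff[of "1/sqrt v" _ _ 0]) auto
  from has_bochner_integral_scaleR_right[OF this, of "sqrt (2*pi)"]
  have "has_bochner_integral lborel (\<lambda>u. sqrt (2*pi) *\<^sub>R std_normal_density (0 + (1/sqrt v) * u) *\<^sub>R iexp ((x * sqrt v) * (0 + (1/sqrt v) * u)))
     (sqrt (2*pi) *\<^sub>R (complex_of_real (exp (- (x * sqrt v)\<^sup>2 / 2)) /\<^sub>R \<bar>1/sqrt v\<bar>))" by blast
  also have "(\<lambda>u. sqrt (2*pi) *\<^sub>R std_normal_density (0 + (1/sqrt v) * u) *\<^sub>R iexp ((x * sqrt v) * (0 + (1/sqrt v) * u)))
     = (\<lambda>u. gauss v u *\<^sub>R cis (x * u))"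
    using v by (auto simp: std_normal_density_def fun_eq_iff cis_conv_exp power_divide field_simps)
  also have "(sqrt (2*pi) *\<^sub>R (complex_of_real (exp (- (x * sqrt v)\<^sup>2 / 2)) /\<^sub>R \<bar>1/sqrt v\<bar>)) 
     = (complex_of_real (sqrt (2*pi * v) * exp (- v * x\<^sup>2 / 2)))"
    using v by (simp add: scaleR_conv_of_real real_sqrt_mult power_mult_distrib mult_ac)
  finally show ?thesis .
qed

lemma gauss_integral:
  assumes v: "v > 0"
  shows "has_bochner_integral lborel (\<lambda>u. gauss v u) (sqrt (2*pi * v))"
  using has_bochner_integral_Re[OF gauss_ft[OF v, of 0]] by simp

lemma gauss_cos:
  assumes v: "v > 0"
  shows "has_bochner_integral lborel (\<lambda>u. gauss v u * cos (x*u)) (sqrt (2*pi * v) * exp (- v * x\<^sup>2 / 2))"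
  using has_bochner_integral_Re[OF gauss_ft[OF v, of x]] by simp

lemma higher_deriv_inverse_shift:
  "s \<noteq> (1::complex) \<Longrightarrow> (deriv ^^ l) (\<lambda>s. 1/(s-1)) s = (-1)^l * fact l / (s-1)^(Suc l)"
proof (induction l arbitrary: s)
  case (Suc l)
  have "(deriv ^^ Suc l) (\<lambda>s. 1/(s-1)) s = deriv (\<lambda>s. (-1)^l * fact l / (s-1)^(Suc l)) s"
    using Suc by (auto intro!: deriv_cong_ev eventually_mono[OF t1_space_nhds[OF Suc.prems]])
  also have "\<dots> = (-1)^Suc l * fact (Suc l) / (s-1)^(Suc (Suc l))"
  proof (rule DERIV_imp_deriv)
    have w: "s - 1 \<noteq> 0" using Suc.prems by simp
    have "((\<lambda>s. (-1)^l * fact l / (s-1)^(Suc l)) has_field_derivative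
        (0 * (s-1)^Suc l - (-1)^l * fact l * (of_nat (Suc l) * (s-1)^l)) / ((s-1)^Suc l * (s-1)^Suc l)) (at s)"
      using w by (intro DERIV_divide DERIV_const DERIV_cong[OF DERIV_power[where n="Suc l" and f="\<lambda>s. s - 1" and D=1]])
        (auto intro!: derivative_eq_intros simp del: of_nat_Suc)
    also have "(0 * (s-1)^Suc l - (-1)^l * fact l * (of_nat (Suc l) * (s-1)^l)) / ((s-1)^Suc l * (s-1)^Suc l)
       = (-1)^Suc l * fact (Suc l) / (s-1)^(Suc (Suc l))"
      using w by (simp add: divide_simps del: of_nat_Suc)
    finally show "((\<lambda>s. (-1)^l * fact l / (s-1)^(Suc l)) has_field_derivative (-1)^Suc l * fact (Suc l) / (s-1)^(Suc (Suc l))) (at s)" .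
  qed
  finally show ?case .
qed auto

text \<open>
  Summing the first-order Taylor expansion of \<open>n^(1-s)\<close> over all \<open>n\<close> expresses \<open>(s - 1) zeta(s) - 1\<close> as
  a series that converges for \<open>Re s > 0\<close> and carries a factor \<open>s (s - 1)\<close>. Dividing by \<open>s - 1\<close> removes the
  pole and leaves a function of at most linear growth.
\<close>
lemma zeta_pole_decomp:
  obtains G where "G holomorphic_on UNIV" "\<And>s. s \<noteq> 1 \<Longrightarrow> zeta s = 1 / (s-1) + G s"
    "\<exists>C>0. \<forall>s. Re s \<ge> 1/4 \<longrightarrow> norm (G s) \<le> C * (1 + norm s)"
proof -
  obtain Z where Z: "Z holomorphic_on UNIV"
    "\<And>s. 1 < Re s \<Longrightarrow> Z s = (s - 1) * (\<Sum>n. 1 / of_nat (Suc n) powr s)"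
    using zeta_entire by blast
  have zetaZ: "zeta s = Z s / (s - 1)" if "s \<noteq> 1" for s
  proof -
    define f where "f = (\<lambda>s. Z s / (s - 1))"
    have ZA: "Z analytic_on UNIV" using Z(1) by (simp add: analytic_on_open)
    then have "f meromorphic_on UNIV"
      unfolding f_def by (intro meromorphic_intros analytic_on_imp_meromorphic_on)
    then have 1: "remove_sings f nicely_meromorphic_on UNIV" by (rule remove_sings_nicely_meromorphic)
    have 2: "remove_sings f s = f s" if "s \<noteq> 1" for s
      by (rule remove_sings_at_analytic) (auto simp: f_def that intro!: analytic_intros analytic_on_subset[OF ZA])
    have "zeta = remove_sings f"
    proof (rule nicely_meromorphic_unique[OF zeta_nicely_meromorphic 1])
      fix s :: complex assume s: "1 < Re s"
      then have "s \<noteq> 1" by auto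
      then have "remove_sings f s = Z s / (s - 1)" using 2[of s] unfolding f_def by simp
      then show "zeta s = remove_sings f s" using s \<open>s \<noteq> 1\<close> by (simp add: zeta_eq_suminf Z(2))
    qed
    with 2 that show ?thesis by (simp add: f_def)
  qed
  define R :: "nat \<Rightarrow> complex \<Rightarrow> complex" where "R = (\<lambda>n s. of_nat (Suc (Suc n)) powr (1 - s)
            - (\<Sum>k\<le>Suc 0. ((1 - s) gchoose k) * of_nat (Suc n) powr (1 - s - of_nat k)))"
  define c where "c = (\<lambda>s::complex. norm (\<Prod>j=0..<Suc (Suc 0). 1 - s - of_nat j))"
  have c: "c s = norm (s-1) * norm s" for s unfolding c_def
    by (simp add: norm_mult norm_minus_commute)
  have bd: "norm (R n s) \<le> c s * real (Suc n) powr (- 1 - Re s)"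
    if "1 - 1 < Re s" for n s
    using taylor_powr_bound[of 1 s n] that unfolding R_def c_def by simp
  have gb: "(\<lambda>s. (1 - s :: complex) gchoose k) holomorphic_on A" for k A
    unfolding gbinomial_prod_rev by (intro holomorphic_intros) auto
  have hol: "R n holomorphic_on A" for n A
    unfolding R_def by (intro holomorphic_intros gb) (auto simp: simp del: of_nat_Suc)
  have cont: "continuous_on UNIV c" unfolding c_def by (intro continuous_intros)
  note RR = holomorphic_suminf_powr[of R 1, OF hol cont bd]
  have ZR: "Z s = 1 + (\<Sum>n. R n s)" if "0 < Re s" for s
  proof (rule analytic_continuation_open[where f = Z and s = "{s. 1 < Re s}"
        and s' = "{s. 1 - 1 < Re s}" and g = "\<lambda>s. 1 + (\<Sum>n. R n s)"])
    have "(2 :: complex) \<in> {s. 1 < Re s}" by simp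
    then show "{s::complex. 1 < Re s} \<noteq> {}" by blast
    show "Z s = 1 + (\<Sum>n. R n s)" if "s \<in> {s. 1 < Re s}" for s
    proof -
      have "summable (\<lambda>n. R n s)" using that by (intro RR(2)) auto
      then show ?thesis using that zeta_recursion[of s 0] by (simp add: Z(2) R_def)
    qed
  qed (use that RR(1) in \<open>auto intro!: open_halfplane convex_connected[OF convex_halfplane] holomorphic_intros intro: holomorphic_on_subset[OF Z(1)]\<close>)
  define K where "K = (\<Sum>n. real (Suc n) powr (-5/4))"
  have sK: "summable (\<lambda>n. real (Suc n) powr (-5/4))"
    by (subst summable_Suc_iff) (simp add: summable_real_powr_iff)
  have Zb: "norm (Z s - 1) \<le> norm (s-1) * norm s * K" if "Re s \<ge> 1/4" for s
  proof -
    have b: "norm (R n s) \<le> c s * real (Suc n) powr (-5/4)" for n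
    proof -
      have "norm (R n s) \<le> c s * real (Suc n) powr (- 1 - Re s)" using bd that by simp
      also have "\<dots> \<le> c s * real (Suc n) powr (-5/4)"
        using that by (intro mult_left_mono powr_mono) (auto simp: c)
      finally show ?thesis .
    qed
    have "norm (\<Sum>n. R n s) \<le> (\<Sum>n. c s * real (Suc n) powr (-5/4))"
      by (rule norm_suminf_le[OF b summable_mult[OF sK]])
    also have "\<dots> = c s * K" unfolding K_def by (rule suminf_mult[OF sK])
    finally show ?thesis using ZR[of s] that by (simp add: c)
  qed
  have Z1: "Z 1 = 1" using Zb[of 1] by simp
  define G where "G = (\<lambda>z. if z = 1 then deriv Z 1 else (Z z - Z 1) / (z - 1))"
  have "G holomorphic_on UNIV" unfolding G_def by (rule pole_lemma[OF Z(1)]) simp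
  moreover have "zeta s = 1 / (s-1) + G s" if "s \<noteq> 1" for s
    using that by (simp add: zetaZ G_def Z1 add_divide_distrib[symmetric])
  moreover have "\<forall>s. Re s \<ge> 1/4 \<longrightarrow> norm (G s) \<le> (max 1 (max (norm (G 1)) K)) * (1 + norm s)"
  proof (intro allI impI)
    fix s assume s: "Re s \<ge> 1/4"
    show "norm (G s) \<le> (max 1 (max (norm (G 1)) K)) * (1 + norm s)"
    proof (cases "s = 1")
      case False
      have "norm (G s) = norm (Z s - 1) / norm (s - 1)" using False by (simp add: G_def Z1 norm_divide)
      also have "\<dots> \<le> norm s * K" using Zb[OF s] False by (simp add: field_simps)
      also have "\<dots> \<le> (max 1 (max (norm (G 1)) K)) * (1 + norm s)"
        by (subst mult.commute) (rule mult_mono, auto)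
      finally show ?thesis .
    next
      case True
      have "norm (G 1) * 1 \<le> (max 1 (max (norm (G 1)) K)) * (1 + norm s)" by (rule mult_mono) auto
      with True show ?thesis by simp
    qed
  qed
  ultimately show ?thesis by (intro that[of G]) (auto intro!: exI[of _ "max 1 (max (norm (G 1)) K)"])
qed

text \<open>
  Cauchy's estimate on circles of radius 1/4 passes the linear growth of \<open>zeta(s) - 1/(s - 1)\<close> on to its
  derivatives.
\<close>
lemma zeta_deriv_decomp:
  obtains g C where "g holomorphic_on UNIV" "C > 0"
    "\<And>s. s \<noteq> 1 \<Longrightarrow> (deriv ^^ l) zeta s = (-1)^l * fact l / (s-1)^(Suc l) + g s"
    "\<And>s. Re s \<ge> 1/2 \<Longrightarrow> norm (g s) \<le> C * (1 + norm s)"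
proof -
  obtain G C where G: "G holomorphic_on UNIV" "\<And>s. s \<noteq> 1 \<Longrightarrow> zeta s = 1 / (s-1) + G s"
    "C > 0" "\<And>s. Re s \<ge> 1/4 \<Longrightarrow> norm (G s) \<le> C * (1 + norm s)"
    using zeta_pole_decomp by metis
  show ?thesis
  proof (rule that[of "(deriv ^^ l) G" "fact l * (2*C) * 4^l"])
    show "(deriv ^^ l) G holomorphic_on UNIV" by (rule holomorphic_higher_deriv[OF G(1)]) simp
    show "fact l * (2*C) * 4^l > 0" using G by simp
    show "(deriv ^^ l) zeta s = (-1)^l * fact l / (s-1)^(Suc l) + (deriv ^^ l) G s" if "s \<noteq> 1" for s
    proof -
      have "(deriv ^^ l) zeta s = (deriv ^^ l) (\<lambda>s. 1 / (s-1) + G s) s"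
        by (rule higher_deriv_cong_ev) (use that G(2) in \<open>auto intro!: eventually_mono[OF t1_space_nhds[OF that]]\<close>)
      also have "\<dots> = (deriv ^^ l) (\<lambda>s. 1 / (s-1)) s + (deriv ^^ l) G s"
        by (rule higher_deriv_add[where S="-{1}"]) (use that in \<open>auto intro!: holomorphic_intros holomorphic_on_subset[OF G(1)]\<close>)
      finally show ?thesis using higher_deriv_inverse_shift[OF that] by simp
    qed
    show "norm ((deriv ^^ l) G s) \<le> fact l * (2*C) * 4^l * (1 + norm s)" if "Re s \<ge> 1/2" for s
    proof -
      have "norm ((deriv ^^ l) G s) \<le> fact l * (2*C*(1 + norm s)) / (1/4)^l"
      proof (rule Cauchy_inequality)
        fix x assume x: "norm (s - x) = 1/4"
        have "Re x \<ge> 1/4" using x that abs_Re_le_cmod[of "s-x"] by auto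
        then have "norm (G x) \<le> C * (1 + norm x)" by (rule G)
        also have "norm x \<le> norm s + 1/4" using x norm_triangle_ineq3[of s x] by linarith
        also have "C * (1 + (norm s + 1/4)) \<le> C * (2 * (1 + norm s))" using G(3) by (intro mult_left_mono) auto
        finally show "norm (G x) \<le> 2*C*(1 + norm s)" using G(3) by (simp add: mult_ac)
      qed (use G(1) in \<open>auto intro!: holomorphic_on_imp_continuous_on intro: holomorphic_on_subset\<close>)
      then show ?thesis by (simp add: power_divide algebra_simps)
    qed
  qed
qed

section \<open>Shifting a line of integration\<close>

text \<open>
  The integral over the boundary of the rectangle with vertical sides at \<open>a\<close> and \<open>b\<close> and horizontal
  sides at height \<open>\<plusminus>Y\<close> vanishes, and the majorant \<open>K\<close> makes the horizontal sides tend to 0.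
\<close>
lemma contour_shift:
  fixes h :: "complex \<Rightarrow> complex"
  assumes hol: "h holomorphic_on UNIV" and ab: "a \<le> b"
    and bd: "\<And>x y. a \<le> x \<Longrightarrow> x \<le> b \<Longrightarrow> norm (h (Complex x y)) \<le> K y"
    and K: "integrable lborel K" "(K \<longlongrightarrow> 0) at_top" "((\<lambda>y. K (- y)) \<longlongrightarrow> 0) at_top"
  shows "(LBINT y. h (Complex a y)) = (LBINT y. h (Complex b y))"
proof -
  have cont: "continuous_on UNIV h" using hol by (rule holomorphic_on_imp_continuous_on)
  have contx: "continuous_on UNIV (\<lambda>y. h (Complex x y))" for x
    by (intro continuous_on_compose2[OF cont]) (auto intro!: continuous_intros simp: Complex_eq)
  have int: "integrable lborel (\<lambda>y. h (Complex x y))" if "a \<le> x" "x \<le> b" for x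
    by (rule Bochner_Integration.integrable_bound[OF K(1)])
      (use bd[OF that] contx[of x] in \<open>auto intro!: AE_I2 borel_measurable_continuous_onI intro: order_trans[OF _ abs_ge_self]\<close>)
  define V where "V = (\<lambda>x Y. integral {-Y..Y} (\<lambda>y. h (Complex x y)))"
  have lim: "((\<lambda>Y. V x Y) \<longlongrightarrow> (LBINT y. h (Complex x y))) at_top" if "a \<le> x" "x \<le> b" for x
  proof -
    have "V x Y = (LBINT y:{-Y..Y}. h (Complex x y))" for Y
      unfolding V_def
      by (rule set_borel_integral_eq_integral(2)[symmetric])
         (use int[OF that] in \<open>auto simp: set_integrable_def intro!: integrable_mult_indicator\<close>)
    moreover have "((\<lambda>Y. LBINT y:{-Y..Y}. h (Complex x y)) \<longlongrightarrow> (LBINT y. h (Complex x y))) at_top"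
      unfolding set_lebesgue_integral_def
    proof (rule integral_dominated_convergence_at_top[where w="\<lambda>y. norm (h (Complex x y))"])
      show "AE y in lborel. ((\<lambda>Y. indicat_real {- Y..Y} y *\<^sub>R h (Complex x y)) \<longlongrightarrow> h (Complex x y)) at_top"
      proof (rule AE_I2, rule tendsto_eventually)
        fix y :: real
        show "\<forall>\<^sub>F Y in at_top. indicat_real {- Y..Y} y *\<^sub>R h (Complex x y) = h (Complex x y)"
          using eventually_ge_at_top[of "\<bar>y\<bar>"] by eventually_elim (auto simp: indicator_def)
      qed
    qed (use int[OF that] contx[of x] in \<open>auto simp: indicator_def intro!: borel_measurable_continuous_onI\<close>)
    ultimately show ?thesis by simp
  qed
  have key: "norm (V b Y - V a Y) \<le> (b - a) * (K (-Y) + K Y)" if Y: "Y > 0" for Y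
  proof -
    define R where "R = rectpath (Complex a (-Y)) (Complex b Y)"
    have 0: "(h has_contour_integral 0) R"
      unfolding R_def by (rule Cauchy_theorem_convex_simple[OF hol]) (auto simp: pathfinish_rectpath pathstart_rectpath)
    have cio: "h contour_integrable_on (linepath p q)" for p q
      by (rule contour_integrable_continuous_linepath) (rule continuous_on_subset[OF cont], simp)
    let ?p = "Complex a (-Y)" and ?q = "Complex b (-Y)" and ?r = "Complex b Y" and ?s = "Complex a Y"
    have "contour_integral R h = contour_integral (linepath ?p ?q) h + (contour_integral (linepath ?q ?r) h
        + (contour_integral (linepath ?r ?s) h + contour_integral (linepath ?s ?p) h))"
      unfolding R_def rectpath_def Let_def
      by (simp add: cio contour_integrable_joinI)
    moreover have "contour_integral R h = 0" using 0 by (rule contour_integral_unique)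
    moreover have v: "contour_integral (linepath (Complex x (-Y)) (Complex x Y)) h = \<i> * V x Y" for x
    proof -
      have "(h has_contour_integral (contour_integral (linepath (Complex x (-Y)) (Complex x Y)) h)) (linepath (Complex x (-Y)) (Complex x Y))"
        using cio by (simp add: has_contour_integral_integral)
      then have "((\<lambda>y. h (Complex x y)) has_integral (-\<i> * contour_integral (linepath (Complex x (-Y)) (Complex x Y)) h)) {-Y..Y}"
        using Y by (subst (asm) has_contour_integral_linepath_same_Re_iff[of _ x _ "-Y" Y]) auto
      then show ?thesis unfolding V_def by (simp add: integral_unique flip: mult.assoc)
    qed
    moreover have "contour_integral (linepath ?s ?p) h = - (\<i> * V a Y)"
    proof -
      have "contour_integral (linepath ?p ?s) h = - contour_integral (linepath ?s ?p) h"
        by (rule contour_integral_reverse_linepath) (rule continuous_on_subset[OF cont], simp)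
      then show ?thesis using v[of a] by simp
    qed
    ultimately have eq: "\<i> * (V b Y - V a Y) = - contour_integral (linepath ?p ?q) h - contour_integral (linepath ?r ?s) h"
      by (simp add: algebra_simps)
    have b1: "norm (contour_integral (linepath ?p ?q) h) \<le> K (-Y) * norm (?q - ?p)"
    proof (rule contour_integral_bound_linepath[OF cio])
      have "0 \<le> norm (h ?p)" by simp also have "\<dots> \<le> K (-Y)" using bd ab by simp finally show "0 \<le> K (-Y)" .
      fix z assume "z \<in> closed_segment ?p ?q"
      then have "z = Complex (Re z) (-Y)" "a \<le> Re z" "Re z \<le> b" using ab 
        by (auto simp: closed_segment_same_Im closed_segment_eq_real_ivl complex_eq_iff split: if_splits)
      then show "norm (h z) \<le> K (-Y)" using bd by metis
    qed
    have b2: "norm (contour_integral (linepath ?r ?s) h) \<le> K Y * norm (?s - ?r)"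
    proof (rule contour_integral_bound_linepath[OF cio])
      have "0 \<le> norm (h ?s)" by simp also have "\<dots> \<le> K Y" using bd ab by simp finally show "0 \<le> K Y" .
      fix z assume "z \<in> closed_segment ?r ?s"
      then have "z = Complex (Re z) Y" "a \<le> Re z" "Re z \<le> b" using ab 
        by (auto simp: closed_segment_same_Im closed_segment_eq_real_ivl complex_eq_iff split: if_splits)
      then show "norm (h z) \<le> K Y" using bd by metis
    qed
    have n: "norm (?q - ?p) = b - a" "norm (?s - ?r) = b - a" using ab by (auto simp: cmod_def)
    have "norm (V b Y - V a Y) = norm (\<i> * (V b Y - V a Y))" by (simp add: norm_mult)
    also have "\<dots> \<le> norm (contour_integral (linepath ?p ?q) h) + norm (contour_integral (linepath ?r ?s) h)"
      unfolding eq by norm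
    also have "\<dots> \<le> (b - a) * (K (-Y) + K Y)" using b1 b2 n by (simp add: algebra_simps)
    finally show ?thesis .
  qed
  have "((\<lambda>Y. (b - a) * (K (-Y) + K Y)) \<longlongrightarrow> (b - a) * (0 + 0)) at_top"
    by (intro tendsto_intros K)
  then have "((\<lambda>Y. (b - a) * (K (-Y) + K Y)) \<longlongrightarrow> 0) at_top" by simp
  then have "((\<lambda>Y. V b Y - V a Y) \<longlongrightarrow> 0) at_top"
    by (rule Lim_null_comparison[rotated])
       (use key in \<open>auto intro!: eventually_mono[OF eventually_gt_at_top[of 0]]\<close>)
  moreover have "((\<lambda>Y. V b Y - V a Y) \<longlongrightarrow> (LBINT y. h (Complex b y)) - (LBINT y. h (Complex a y))) at_top"
    by (intro tendsto_diff lim) (use ab in auto)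
  ultimately show ?thesis
    using tendsto_unique[OF trivial_limit_at_top_linorder] by fastforce
qed

section \<open>Gaussian averages of derivatives of zeta\<close>

lemma nat_powr_exp: "(of_nat (Suc n) :: complex) powr z = exp (of_real (ln (real (Suc n))) * z)"
  by (simp add: powr_def Ln_of_nat mult.commute del: of_nat_Suc)

lemma higher_deriv_powr_neg:
  "(deriv ^^ l) (\<lambda>s. of_nat (Suc n) powr (-s)) s = (- of_real (ln (real (Suc n))))^l * (of_nat (Suc n) :: complex) powr (-s)"
proof (induction l arbitrary: s)
  case (Suc l)
  have "(deriv ^^ Suc l) (\<lambda>s. (of_nat (Suc n) :: complex) powr (-s)) s = deriv (\<lambda>s. (- of_real (ln (real (Suc n))))^l * (of_nat (Suc n) :: complex) powr (-s)) s"
    by (simp only: funpow.simps o_apply Suc[abs_def])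
  also have "\<dots> = (- of_real (ln (real (Suc n))))^Suc l * (of_nat (Suc n) :: complex) powr (-s)"
    unfolding nat_powr_exp by (rule DERIV_imp_deriv) (auto intro!: derivative_eq_intros)
  finally show ?case .
qed auto

text \<open>
  The partial sums of the Dirichlet series converge uniformly on a half-plane, so their derivatives of
  all orders converge to those of the limit.
\<close>
lemma higher_deriv_zeta_sums:
  assumes "Re s > 1"
  shows "(\<lambda>n. (- of_real (ln (real (Suc n))))^l * (of_nat (Suc n) :: complex) powr (-s)) sums (deriv ^^ l) zeta s"
proof -
  define b where "b = (1 + Re s) / 2"
  have b: "1 < b" "b < Re s" using assms by (auto simp: b_def)
  define A where "A = {s. b < Re s}"
  define f where "f = (\<lambda>N s. \<Sum>n<N. (of_nat (Suc n) :: complex) powr (-s))"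
  have hol1: "(\<lambda>s. (of_nat (Suc n) :: complex) powr (-s)) holomorphic_on A" for n
    by (intro holomorphic_intros) (auto simp del: of_nat_Suc)
  have "((\<lambda>N. (deriv ^^ l) (f N) s) \<longlongrightarrow> (deriv ^^ l) zeta s) sequentially"
  proof (rule higher_deriv_complex_uniform_limit)
    show "uniform_limit A f zeta sequentially"
    proof -
      have "uniform_limit A f (\<lambda>s. \<Sum>n. (of_nat (Suc n) :: complex) powr (-s)) sequentially"
        unfolding f_def
      proof (rule Weierstrass_m_test)
        show "norm ((of_nat (Suc n) :: complex) powr (-z)) \<le> real (Suc n) powr (-b)" if "z \<in> A" for n z
        proof -
          have "norm ((of_nat (Suc n) :: complex) powr (-z)) = real (Suc n) powr (- Re z)"
            using norm_powr_real_powr[of "of_nat (Suc n)" "-z"] by simp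
          also have "\<dots> \<le> real (Suc n) powr (-b)" using that by (intro powr_mono) (auto simp: A_def)
          finally show ?thesis .
        qed
        show "summable (\<lambda>n. real (Suc n) powr (-b))"
          using b by (subst summable_Suc_iff) (simp add: summable_real_powr_iff)
      qed
      then show ?thesis
        by (rule uniform_limit_cong'[THEN iffD1, rotated -1])
           (use b in \<open>auto simp: A_def zeta_eq_suminf powr_minus divide_inverse\<close>)
    qed
    show "\<forall>\<^sub>F n in sequentially. f n holomorphic_on A"
      unfolding f_def by (intro always_eventually allI holomorphic_on_sum hol1)
    show "open A" unfolding A_def by (rule open_halfplane)
    show "s \<in> A" using b by (auto simp: A_def)
  qed simp
  also have "(\<lambda>N. (deriv ^^ l) (f N) s) = (\<lambda>N. \<Sum>n<N. (- of_real (ln (real (Suc n))))^l * (of_nat (Suc n) :: complex) powr (-s))"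
  proof
    fix N
    show "(deriv ^^ l) (f N) s = (\<Sum>n<N. (- of_real (ln (real (Suc n))))^l * (of_nat (Suc n) :: complex) powr (-s))"
    proof (induction N)
      case 0 then show ?case by (simp add: f_def)
    next
      case (Suc N)
      have "(deriv ^^ l) (f (Suc N)) s = (deriv ^^ l) (\<lambda>s. f N s + (of_nat (Suc N) :: complex) powr (-s)) s"
        by (simp add: f_def)
      also have "\<dots> = (deriv ^^ l) (f N) s + (deriv ^^ l) (\<lambda>s. (of_nat (Suc N) :: complex) powr (-s)) s"
        unfolding f_def by (rule higher_deriv_add[where S=UNIV]) (auto intro!: holomorphic_intros simp del: of_nat_Suc)
      finally show ?case by (simp only: Suc higher_deriv_powr_neg sum.lessThan_Suc)
    qed
  qed
  finally show ?thesis by (simp add: sums_def)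
qed

text \<open>
  With \<open>x = |u|/sqrt v\<close> the polynomial factor is at most \<open>v^m (1 + x)^m \<le> v^m m! e^(1+x)\<close>, and half of the
  Gaussian absorbs the exponential because \<open>1 + x \<le> 2 + x\<^sup>2/4\<close>.
\<close>
lemma poly_gauss_bound:
  fixes u v :: real
  assumes "v \<ge> 1"
  shows "(1 + \<bar>u\<bar>) ^ m * gauss v u \<le> (fact m * exp 2) * v ^ m * gauss (2 * v) u"
proof -
  define x where "x = \<bar>u\<bar> / sqrt v"
  have sv1: "1 \<le> sqrt v" using assms by simp
  have sv2: "sqrt v \<le> v" using mult_left_mono[OF sv1, of "sqrt v"] assms by simp
  have x0: "x \<ge> 0" using assms by (simp add: x_def)
  have "1 + \<bar>u\<bar> = 1 + sqrt v * x" using assms by (simp add: x_def)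
  also have "\<dots> \<le> v * (1 + x)" using sv2 x0 by (simp add: distrib_left mult_right_mono add_mono assms)
  finally have "(1 + \<bar>u\<bar>) ^ m \<le> (v * (1 + x)) ^ m" by (rule power_mono) auto
  also have "\<dots> = v ^ m * (1 + x) ^ m" by (simp add: power_mult_distrib)
  also have "(1 + x) ^ m \<le> fact m * exp (1 + x)" using x0 by (intro power_le_fact_exp) auto
  also have "exp (1 + x) \<le> exp (2 + u\<^sup>2 / (4 * v))"
  proof -
    have "u\<^sup>2 / (4 * v) = x\<^sup>2 / 4" using assms by (simp add: x_def power_divide)
    moreover have "0 \<le> (x - 2)\<^sup>2" by simp
    ultimately show ?thesis by (simp add: power2_eq_square algebra_simps)
  qed
  finally have "(1 + \<bar>u\<bar>) ^ m * gauss v u \<le> v ^ m * (fact m * exp (2 + u\<^sup>2 / (4 * v))) * gauss v u"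
    using assms by (simp add: mult_left_mono mult_right_mono)
  also have "\<dots> = (fact m * exp 2) * v ^ m * (exp (u\<^sup>2 / (4 * v)) * gauss v u)"
    by (simp add: exp_add mult_ac)
  also have "exp (u\<^sup>2 / (4 * v)) * gauss v u = gauss (2 * v) u"
    using assms by (simp flip: exp_add add: field_simps)
  finally show ?thesis .
qed

lemma poly_gauss_integral:
  assumes "v \<ge> 1"
  shows "integrable lborel (\<lambda>u::real. (1 + \<bar>u\<bar>) ^ m * gauss v u)"
    and "(LBINT u. (1 + \<bar>u\<bar>) ^ m * gauss v u) \<le> (fact m * exp 2 * 4) * v ^ (m + 1)"
proof -
  have g: "has_bochner_integral lborel (\<lambda>u. gauss (2 * v) u) (sqrt (2*pi*(2 * v)))"
    by (rule gauss_integral) (use assms in auto)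
  have gi: "integrable lborel (\<lambda>u. (fact m * exp 2) * v ^ m * gauss (2 * v) u)"
    using g by (auto simp: has_bochner_integral_iff)
  show i: "integrable lborel (\<lambda>u::real. (1 + \<bar>u\<bar>) ^ m * gauss v u)"
    by (rule Bochner_Integration.integrable_bound[OF gi]) (use poly_gauss_bound[OF assms, of _ m] assms in \<open>auto simp: abs_mult\<close>)
  have "(LBINT u. (1 + \<bar>u\<bar>) ^ m * gauss v u) \<le> (LBINT u. (fact m * exp 2) * v ^ m * gauss (2 * v) u)"
    by (rule integral_mono[OF i gi poly_gauss_bound[OF assms]])
  also have "\<dots> = (fact m * exp 2) * v ^ m * sqrt (2*pi*(2 * v))"
    using g by (simp add: has_bochner_integral_iff)
  also have "sqrt (2*pi*(2 * v)) \<le> 4 * v"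
  proof (rule real_le_lsqrt)
    have "2*pi*(2 * v) \<le> 16 * v" using pi_less_4 assms by simp
    also have "\<dots> \<le> 16 * (v * v)" using assms by simp
    finally show "2*pi*(2 * v) \<le> (4 * v)\<^sup>2" by (simp add: power2_eq_square)
  qed (use assms in auto)
  finally show "(LBINT u. (1 + \<bar>u\<bar>) ^ m * gauss v u) \<le> (fact m * exp 2 * 4) * v ^ (m + 1)"
    using assms by (simp add: mult_left_mono mult_ac)
qed

lemma norm_gauss_kernel:
  assumes "v > 0"
  shows "norm (exp ((Complex x u)\<^sup>2 / of_real (2 * v) + of_real p * Complex x u)) = exp ((x\<^sup>2 - u\<^sup>2) / (2 * v) + p * x)"
proof -
  have "(Complex x u)\<^sup>2 / of_real (2 * v) = Complex ((x\<^sup>2 - u\<^sup>2) / (2 * v)) (2 * x * u / (2 * v))"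
    by (simp add: complex_eq_iff power2_eq_square Re_divide_of_real Im_divide_of_real del: of_real_mult)
  then show ?thesis by (simp add: norm_exp_eq_Re)
qed

text \<open>
  The kernel \<open>exp(z\<^sup>2/2v + p z)\<close> continues \<open>exp(-u\<^sup>2/2v) e^(ipu)\<close> from \<open>z = iu\<close> to an entire function; this
  bound controls it on the strip that the contour crosses.
\<close>
lemma norm_gauss_kernel_le:
  assumes "v \<ge> 1" "0 \<le> x" "x \<le> 3/2"
  shows "norm (exp ((Complex x u)\<^sup>2 / of_real (2 * v) + of_real p * Complex x u)) \<le> exp (9/8 + 3/2 * \<bar>p\<bar>) * gauss v u"
proof -
  have "x\<^sup>2 \<le> (3/2)\<^sup>2" using assms by (intro power_mono) auto
  then have "x\<^sup>2 / (2 * v) \<le> (9/4) / (2 * 1)" using assms by (intro frac_le) (auto simp: power2_eq_square)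
  moreover have "p * x \<le> \<bar>p\<bar> * (3/2)" using assms by (intro mult_mono order_trans[OF abs_ge_self[of p]] mult_right_mono[THEN order_trans, of p "\<bar>p\<bar>"] mult_left_mono) auto
  ultimately have "(x\<^sup>2 - u\<^sup>2) / (2 * v) + p * x \<le> 9/8 + 3/2 * \<bar>p\<bar> + - u\<^sup>2 / (2 * v)"
    by (simp add: diff_divide_distrib)
  then show ?thesis using assms by (subst norm_gauss_kernel) (auto simp flip: exp_add)
qed

text \<open>
  The value does not depend on \<open>x\<close>, the real part of the line of integration. Completing the square
  reduces every line to the imaginary axis.
\<close>
lemma gauss_kernel_integral:
  assumes v: "v > 0"
  shows "has_bochner_integral lborel (\<lambda>u. exp ((Complex x u)\<^sup>2 / of_real (2 * v) + of_real q * Complex x u))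
          (complex_of_real (sqrt (2*pi * v) * exp (- v * q\<^sup>2 / 2)))"
proof -
  define A where "A = x\<^sup>2 / (2 * v) + q * x"
  define y where "y = x / v + q"
  have eq: "exp ((Complex x u)\<^sup>2 / of_real (2 * v) + of_real q * Complex x u) = of_real (exp A) * (gauss v u *\<^sub>R cis (y * u))" for u
  proof -
    have "(Complex x u)\<^sup>2 / of_real (2 * v) + of_real q * Complex x u = of_real A + of_real (- u\<^sup>2 / (2 * v)) + \<i> * of_real (y * u)"
      using v by (simp add: A_def y_def complex_eq_iff power2_eq_square Re_divide_of_real Im_divide_of_real field_simps del: of_real_mult)
    then show ?thesis by (simp only: exp_add exp_of_real cis_conv_exp scaleR_conv_of_real mult.assoc)
  qed
  have "exp A * (sqrt (2*pi * v) * exp (- v * y\<^sup>2 / 2)) = sqrt (2*pi * v) * (exp (A + - v * y\<^sup>2 / 2))"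
    by (simp flip: exp_add)
  also have "A + - v * y\<^sup>2 / 2 = - v * q\<^sup>2 / 2"
    using v by (simp add: A_def y_def power2_eq_square field_simps)
  finally have E: "exp A * (sqrt (2*pi * v) * exp (- v * y\<^sup>2 / 2)) = sqrt (2*pi * v) * exp (- v * q\<^sup>2 / 2)" .
  show ?thesis
    using has_bochner_integral_mult_right[OF gauss_ft[OF v, of y], of "of_real (exp A)"]
    by (simp only: eq of_real_mult[symmetric] E)
qed

text \<open>
  If the Dirichlet series converged on the critical line, integrating it against a modulated Gaussian
  would give the Fourier transform at \<open>ln k\<close> of that Gaussian as a weight for the \<open>k\<close>-th term. Moving the
  line of integration into the region of convergence justifies this formula; the weights make the series
  at real part 1/2 converge, and the error comes from the pole alone. Its factor \<open>exp(3|p|/2)\<close> is harmless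
  because the frequencies \<open>p\<close> will be a small multiple of \<open>ln T\<close>, whereas \<open>t\<close> is at least a fixed power
  of \<open>T\<close>.
\<close>
lemma zeta_gauss_transform:
  obtains C where "C > 0"
    "\<And>v p t. v \<ge> 1 \<Longrightarrow> integrable lborel (\<lambda>u. zeta_crit l (t + u) * (gauss v u *\<^sub>R cis (p * u)))"
    "\<And>v p t. v \<ge> 1 \<Longrightarrow> summable (\<lambda>n. norm ((- of_real (ln (real (Suc n))))^l * (of_nat (Suc n) :: complex) powr (- Complex (1/2) t) 
            * of_real (sqrt (2*pi * v) * exp (- v * (p - ln (real (Suc n)))\<^sup>2 / 2))))"
    "\<And>v p t. v \<ge> 1 \<Longrightarrow> norm ((LBINT u. zeta_crit l (t + u) * (gauss v u *\<^sub>R cis (p * u)))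
       - (\<Sum>n. (- of_real (ln (real (Suc n))))^l * (of_nat (Suc n) :: complex) powr (- Complex (1/2) t) 
            * of_real (sqrt (2*pi * v) * exp (- v * (p - ln (real (Suc n)))\<^sup>2 / 2))))
        \<le> C * v ^ 2 * exp (3/2 * \<bar>p\<bar>) / (1 + \<bar>t\<bar>)"
proof -
  obtain g Cg where g: "g holomorphic_on UNIV" "Cg > 0"
    "\<And>s. s \<noteq> 1 \<Longrightarrow> (deriv ^^ l) zeta s = (-1)^l * fact l / (s-1)^(Suc l) + g s"
    "\<And>s. Re s \<ge> 1/2 \<Longrightarrow> norm (g s) \<le> Cg * (1 + norm s)"
    using zeta_deriv_decomp by metis
  define P :: "complex \<Rightarrow> complex" where "P = (\<lambda>s. (-1)^l * fact l / (s-1)^(Suc l))"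
  define C0 :: real where "C0 = fact l * 2 ^ l * 3"
  define C where "C = 2 * (C0 * exp (9/8) * (exp 2 * 4))"
  have contg: "continuous_on UNIV g" using g(1) by (rule holomorphic_on_imp_continuous_on)
  have C0: "C0 > 0" by (simp add: C0_def)
  have main: "integrable lborel (\<lambda>u. zeta_crit l (t + u) * (gauss v u *\<^sub>R cis (p * u)))
     \<and> summable (\<lambda>n. norm ((- of_real (ln (real (Suc n))))^l * (of_nat (Suc n) :: complex) powr (- Complex (1/2) t) 
            * of_real (sqrt (2*pi * v) * exp (- v * (p - ln (real (Suc n)))\<^sup>2 / 2))))
     \<and> norm ((LBINT u. zeta_crit l (t + u) * (gauss v u *\<^sub>R cis (p * u)))
       - (\<Sum>n. (- of_real (ln (real (Suc n))))^l * (of_nat (Suc n) :: complex) powr (- Complex (1/2) t) 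
            * of_real (sqrt (2*pi * v) * exp (- v * (p - ln (real (Suc n)))\<^sup>2 / 2))))
        \<le> C * v ^ 2 * exp (3/2 * \<bar>p\<bar>) / (1 + \<bar>t\<bar>)" if v: "v \<ge> 1" for v p t :: real
  proof -
    define S0 where "S0 = Complex (1/2) t"
    define W :: "complex \<Rightarrow> complex" where "W = (\<lambda>z. exp (z\<^sup>2 / of_real (2 * v) + of_real p * z))"
    define E where "E = exp (9/8 + 3/2 * \<bar>p\<bar>)"
    have E: "E > 0" by (simp add: E_def)
    have Wle: "norm (W (Complex x u)) \<le> E * gauss v u" if "0 \<le> x" "x \<le> 3/2" for x u
      unfolding W_def E_def by (rule norm_gauss_kernel_le[OF v that])
    have W0: "W (Complex 0 u) = gauss v u *\<^sub>R cis (p * u)" for u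
    proof -
      have "(Complex 0 u)\<^sup>2 / of_real (2 * v) + of_real p * Complex 0 u = of_real (- u\<^sup>2 / (2 * v)) + \<i> * of_real (p * u)"
        using v by (simp add: complex_eq_iff power2_eq_square Re_divide_of_real Im_divide_of_real field_simps del: of_real_mult)
      then have "W (Complex 0 u) = exp (of_real (- u\<^sup>2 / (2 * v)) + \<i> * of_real (p * u))" by (simp only: W_def)
      then show ?thesis by (simp only: exp_add exp_of_real cis_conv_exp scaleR_conv_of_real)
    qed
    have contC: "continuous_on UNIV (\<lambda>u. Complex x u)" for x
      by (auto intro!: continuous_intros simp: Complex_eq)
    have contW: "continuous_on UNIV (\<lambda>u. W (Complex x u))" for x
      unfolding W_def using v by (intro continuous_intros contC) auto
    note pgi = poly_gauss_integral[OF v, of 1]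
    have ne1: "S0 + Complex x u \<noteq> 1" if "x = 0 \<or> x = 3/2" for x u
      using that by (auto simp: S0_def complex_eq_iff)
    have Pb: "norm (P (S0 + Complex x u)) \<le> C0 * (1 + \<bar>u\<bar>) / (1 + \<bar>t\<bar>)" if x: "x = 0 \<or> x = 3/2" for x u
    proof -
      define w where "w = S0 + Complex x u - 1"
      have w1: "norm w \<ge> 1/2" using x abs_Re_le_cmod[of w] by (auto simp: w_def S0_def)
      have w0: "norm w > 0" using w1 by linarith
      then have w0: "norm w ^ l > 0" "norm w > 0" "w \<noteq> 0" by auto
      have w2: "norm w \<ge> \<bar>t + u\<bar>" using abs_Im_le_cmod[of w] by (simp add: w_def S0_def)
      have "1 + \<bar>t\<bar> \<le> (1 + \<bar>t + u\<bar>) + \<bar>u\<bar>" by linarith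
      also have "\<dots> \<le> (1 + \<bar>t + u\<bar>) + (1 + \<bar>t + u\<bar>) * \<bar>u\<bar>"
        by (simp add: distrib_right)
      also have "\<dots> = (1 + \<bar>t + u\<bar>) * (1 + \<bar>u\<bar>)" by (simp add: algebra_simps)
      also have "\<dots> \<le> (3 * norm w) * (1 + \<bar>u\<bar>)" using w1 w2 by (intro mult_right_mono) auto
      finally have w3: "1 + \<bar>t\<bar> \<le> 3 * norm w * (1 + \<bar>u\<bar>)" .
      have "norm (P (S0 + Complex x u)) = fact l / (norm w * norm w ^ l)"
        by (simp add: P_def w_def norm_divide norm_mult norm_power)
      also have "\<dots> \<le> fact l / (((1 + \<bar>t\<bar>) / (3 * (1 + \<bar>u\<bar>))) * (1/2) ^ l)"
      proof (intro divide_left_mono mult_mono power_mono)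
        show "(1 + \<bar>t\<bar>) / (3 * (1 + \<bar>u\<bar>)) \<le> norm w" using w3 by (simp add: field_simps)
      qed (use w1 w0 in \<open>auto intro!: mult_pos_pos divide_pos_pos\<close>)
      also have "\<dots> = C0 * (1 + \<bar>u\<bar>) / (1 + \<bar>t\<bar>)" by (simp add: C0_def power_divide field_simps)
      finally show ?thesis .
    qed
    have PWb: "norm (P (S0 + Complex x u) * W (Complex x u)) \<le> (C0 / (1 + \<bar>t\<bar>) * E) * ((1 + \<bar>u\<bar>) ^ 1 * gauss v u)" if x: "x = 0 \<or> x = 3/2" for x u
    proof -
      have "norm (P (S0 + Complex x u) * W (Complex x u)) \<le> (C0 * (1 + \<bar>u\<bar>) / (1 + \<bar>t\<bar>)) * (E * gauss v u)"
        unfolding norm_mult using Pb[OF x] Wle[of x u] x C0 by (intro mult_mono) auto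
      then show ?thesis by (simp add: mult_ac)
    qed
    have contP: "continuous_on UNIV (\<lambda>u. P (S0 + Complex x u))" if "x = 0 \<or> x = 3/2" for x
      unfolding P_def using ne1[OF that] by (intro continuous_intros contC) auto
    have PWi: "integrable lborel (\<lambda>u. P (S0 + Complex x u) * W (Complex x u))" if x: "x = 0 \<or> x = 3/2" for x
    proof (rule Bochner_Integration.integrable_bound)
      show "integrable lborel (\<lambda>u. (C0 / (1 + \<bar>t\<bar>) * E) * ((1 + \<bar>u\<bar>) ^ 1 * gauss v u))"
        by (intro integrable_mult_right pgi)
      show "(\<lambda>u. P (S0 + Complex x u) * W (Complex x u)) \<in> borel_measurable lborel"
        using continuous_on_mult[OF contP[OF x] contW] by (simp add: borel_measurable_continuous_onI)
    qed (unfold real_norm_def, intro AE_I2 order_trans[OF PWb[OF x] abs_ge_self])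
    have PWint: "norm (LBINT u. P (S0 + Complex x u) * W (Complex x u)) \<le> (C0 / (1 + \<bar>t\<bar>) * E) * (exp 2 * 4 * v ^ 2)" if x: "x = 0 \<or> x = 3/2" for x
    proof -
      have "norm (LBINT u. P (S0 + Complex x u) * W (Complex x u)) \<le> (LBINT u. (C0 / (1 + \<bar>t\<bar>) * E) * ((1 + \<bar>u\<bar>) ^ 1 * gauss v u))"
        by (intro Bochner_Integration.integral_norm_bound_integral PWi[OF x] integrable_mult_right pgi PWb[OF x])
      also have "\<dots> = (C0 / (1 + \<bar>t\<bar>) * E) * (LBINT u. ((1 + \<bar>u\<bar>) ^ 1 * gauss v u))" by simp
      also have "\<dots> \<le> (C0 / (1 + \<bar>t\<bar>) * E) * (exp 2 * 4 * v ^ 2)"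
        using pgi(2) C0 E by (intro mult_left_mono) (auto simp: power2_eq_square)
      finally show ?thesis .
    qed
    \<comment> \<open>Only the entire part \<open>g\<close> is moved from real part 1/2 to real part 2; the pole part is already
      of size \<open>1/(1 + |t|)\<close> on both lines.\<close>
    define K where "K = (\<lambda>u. (Cg * E * (3 + \<bar>t\<bar>)) * ((1 + \<bar>u\<bar>) ^ 1 * gauss v u))"
    have gWb: "norm (g (S0 + Complex x u) * W (Complex x u)) \<le> K u" if x: "0 \<le> x" "x \<le> 3/2" for x u
    proof -
      have "norm (S0 + Complex x u) \<le> \<bar>1/2 + x\<bar> + \<bar>t + u\<bar>"
        using cmod_le[of "S0 + Complex x u"] by (simp add: S0_def)
      also have "\<dots> \<le> 2 + \<bar>t\<bar> + \<bar>u\<bar>" using x by linarith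
      finally have "1 + norm (S0 + Complex x u) \<le> (3 + \<bar>t\<bar>) + \<bar>u\<bar>" by simp
      also have "\<dots> \<le> (3 + \<bar>t\<bar>) * (1 + \<bar>u\<bar>)" by (simp add: algebra_simps)
      finally have "norm (g (S0 + Complex x u)) \<le> Cg * ((3 + \<bar>t\<bar>) * (1 + \<bar>u\<bar>))"
        using g(4)[of "S0 + Complex x u"] x g(2) by (auto simp: S0_def elim!: order_trans)
      then have "norm (g (S0 + Complex x u) * W (Complex x u)) \<le> (Cg * ((3 + \<bar>t\<bar>) * (1 + \<bar>u\<bar>))) * (E * gauss v u)"
        unfolding norm_mult using Wle[of x u] x g(2) by (intro mult_mono) auto
      then show ?thesis by (simp add: K_def mult_ac)
    qed
    have Ki: "integrable lborel K" unfolding K_def by (intro integrable_mult_right pgi)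
    have Klim: "(K \<longlongrightarrow> 0) at_top"
      unfolding K_def using v by real_asymp
    have shift: "(LBINT u. g (S0 + Complex 0 u) * W (Complex 0 u)) = (LBINT u. g (S0 + Complex (3/2) u) * W (Complex (3/2) u))"
    proof (rule contour_shift[where h="\<lambda>z. g (S0 + z) * W z" and K=K])
      have "(g \<circ> (\<lambda>z. S0 + z)) holomorphic_on UNIV"
        by (rule holomorphic_on_compose) (auto intro!: holomorphic_intros intro: holomorphic_on_subset[OF g(1)])
      then show "(\<lambda>z. g (S0 + z) * W z) holomorphic_on UNIV"
        unfolding W_def o_def using v by (intro holomorphic_intros) auto
      show "((\<lambda>y. K (- y)) \<longlongrightarrow> 0) at_top" using Klim by (simp add: K_def)
    qed (use gWb Ki Klim in auto)
    have gWi: "integrable lborel (\<lambda>u. g (S0 + Complex x u) * W (Complex x u))" if "0 \<le> x" "x \<le> 3/2" for x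
    proof (rule Bochner_Integration.integrable_bound[OF Ki])
      have "continuous_on UNIV (\<lambda>u. g (S0 + Complex x u))"
        by (rule continuous_on_compose2[OF contg]) (auto intro!: continuous_intros contC)
      from continuous_on_mult[OF this contW]
      show "(\<lambda>u. g (S0 + Complex x u) * W (Complex x u)) \<in> borel_measurable lborel" by (simp add: borel_measurable_continuous_onI)
    qed (unfold real_norm_def, intro AE_I2 order_trans[OF gWb[OF that] abs_ge_self])
    have Fdec: "(deriv ^^ l) zeta (S0 + Complex x u) * W (Complex x u) = P (S0 + Complex x u) * W (Complex x u) + g (S0 + Complex x u) * W (Complex x u)"
      if "x = 0 \<or> x = 3/2" for x u
      using g(3)[OF ne1[OF that]] by (simp add: P_def distrib_right)
    have I: "integrable lborel (\<lambda>u. (deriv ^^ l) zeta (S0 + Complex x u) * W (Complex x u))"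
      "(LBINT u. (deriv ^^ l) zeta (S0 + Complex x u) * W (Complex x u)) = (LBINT u. P (S0 + Complex x u) * W (Complex x u)) + (LBINT u. g (S0 + Complex x u) * W (Complex x u))"
      if x: "x = 0 \<or> x = 3/2" for x
    proof -
      have x': "0 \<le> x" "x \<le> 3/2" using x by auto
      show "integrable lborel (\<lambda>u. (deriv ^^ l) zeta (S0 + Complex x u) * W (Complex x u))"
        unfolding Fdec[OF x] by (intro Bochner_Integration.integrable_add PWi x gWi x')
      show "(LBINT u. (deriv ^^ l) zeta (S0 + Complex x u) * W (Complex x u)) = (LBINT u. P (S0 + Complex x u) * W (Complex x u)) + (LBINT u. g (S0 + Complex x u) * W (Complex x u))"
        unfolding Fdec[OF x] by (intro Bochner_Integration.integral_add PWi x gWi x')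
    qed
    \<comment> \<open>On the line of real part 2 the Dirichlet series may be integrated termwise. By
      \<open>gauss_kernel_integral\<close> a single term has the same integral on every vertical line, so the result
      can be written with the terms of real part 1/2, although the series diverges there.\<close>
    define T where "T = (\<lambda>n. (- of_real (ln (real (Suc n))))^l * (of_nat (Suc n) :: complex) powr (- S0) 
            * of_real (sqrt (2*pi * v) * exp (- v * (p - ln (real (Suc n)))\<^sup>2 / 2)))"
    define f where "f = (\<lambda>n u. (- of_real (ln (real (Suc n))))^l * (of_nat (Suc n) :: complex) powr (- (S0 + Complex (3/2) u)) * W (Complex (3/2) u))"
    have fT: "has_bochner_integral lborel (f n) (T n)" for n
    proof -
      have eq: "f n u = ((- of_real (ln (real (Suc n))))^l * (of_nat (Suc n) :: complex) powr (- S0)) *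
          exp ((Complex (3/2) u)\<^sup>2 / of_real (2 * v) + of_real (p - ln (real (Suc n))) * Complex (3/2) u)" for u
        unfolding f_def W_def nat_powr_exp by (simp add: exp_add[symmetric] algebra_simps del: of_nat_Suc)
      show ?thesis unfolding eq T_def using v by (intro has_bochner_integral_mult_right gauss_kernel_integral) auto
    qed
    have nf: "norm (f n u) \<le> ln (real (Suc n)) ^ l * real (Suc n) powr (-2) * (E * gauss v u)" for n u
    proof -
      have "norm ((of_nat (Suc n) :: complex) powr (- (S0 + Complex (3/2) u))) = real (Suc n) powr (-2)"
        using norm_powr_real_powr[of "of_nat (Suc n)" "- (S0 + Complex (3/2) u)"] by (simp add: S0_def)
      then show ?thesis using Wle[of "3/2" u]
        unfolding f_def norm_mult norm_power norm_minus_cancel norm_of_real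
        by (intro mult_mono) auto
    qed
    have sumln: "summable (\<lambda>n. ln (real (Suc n)) ^ l * real (Suc n) powr (-2))"
    proof (rule summable_comparison_test_bigo)
      show "summable (\<lambda>n. norm (real n powr (-3/2)))" by (simp add: summable_real_powr_iff)
      show "(\<lambda>n. ln (real (Suc n)) ^ l * real (Suc n) powr (-2)) \<in> O(\<lambda>n. real n powr (-3/2))"
        by real_asymp
    qed
    have fsum: "(\<lambda>n. f n u) sums ((deriv ^^ l) zeta (S0 + Complex (3/2) u) * W (Complex (3/2) u))" for u
      unfolding f_def by (intro sums_mult2 higher_deriv_zeta_sums) (simp add: S0_def)
    have gi: "integrable lborel (\<lambda>u. gauss v u)" "(LBINT u. gauss v u) = sqrt (2*pi * v)"
      using gauss_integral[of v] v by (auto simp: has_bochner_integral_iff)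
    have nint: "(LBINT u. norm (f n u)) \<le> ln (real (Suc n)) ^ l * real (Suc n) powr (-2) * (E * sqrt (2*pi * v))" for n
    proof -
      have "(LBINT u. norm (f n u)) \<le> (LBINT u. ln (real (Suc n)) ^ l * real (Suc n) powr (-2) * (E * gauss v u))"
      proof (intro integral_mono nf integrable_mult_right gi(1))
        show "integrable lborel (\<lambda>u. norm (f n u))" using fT[of n] by (auto simp: has_bochner_integral_iff)
      qed
      also have "\<dots> = ln (real (Suc n)) ^ l * real (Suc n) powr (-2) * (E * sqrt (2*pi * v))" using gi by simp
      finally show ?thesis .
    qed
    have sumn: "summable (\<lambda>n. LBINT u. norm (f n u))"
      by (rule summable_comparison_test'[OF summable_mult2[OF sumln, of "E * sqrt (2*pi * v)"], of 0])
         (use nint in auto)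
    have sumT: "T sums (LBINT u. (\<Sum>n. f n u))"
    proof -
      have "(\<lambda>n. integral\<^sup>L lborel (f n)) sums (LBINT u. (\<Sum>n. f n u))"
      proof (rule sums_integral)
        show "integrable lborel (f n)" for n using fT[of n] by (auto simp: has_bochner_integral_iff)
        show "AE u in lborel. summable (\<lambda>n. norm (f n u))"
          by (intro AE_I2 summable_comparison_test'[OF summable_mult2[OF sumln]]) (use nf in auto)
      qed (rule sumn)
      moreover have "integral\<^sup>L lborel (f n) = T n" for n using fT[of n] by (auto simp: has_bochner_integral_iff)
      ultimately show ?thesis by simp
    qed
    have sumT': "summable (\<lambda>n. norm (T n))"
    proof (rule summable_comparison_test'[OF sumn, of 0])
      fix n show "norm (norm (T n)) \<le> (LBINT u. norm (f n u))"
      proof -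
        have i: "integrable lborel (f n)" and T: "integral\<^sup>L lborel (f n) = T n"
          using fT[of n] by (auto simp: has_bochner_integral_iff)
        have "norm (integral\<^sup>L lborel (f n)) \<le> (LBINT u. norm (f n u))"
          by (intro Bochner_Integration.integral_norm_bound_integral i integrable_norm) simp
        then show ?thesis by (simp add: T)
      qed
    qed
    have Tsum: "(\<Sum>n. T n) = (LBINT u. (deriv ^^ l) zeta (S0 + Complex (3/2) u) * W (Complex (3/2) u))"
      using sums_unique[OF sumT] sums_unique[OF fsum] by simp
    have "(LBINT u. (deriv ^^ l) zeta (S0 + Complex 0 u) * W (Complex 0 u)) - (\<Sum>n. T n) =
       (LBINT u. P (S0 + Complex 0 u) * W (Complex 0 u)) - (LBINT u. P (S0 + Complex (3/2) u) * W (Complex (3/2) u))"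
      using I(2)[of 0] I(2)[of "3/2"] shift Tsum by simp
    then have "norm ((LBINT u. (deriv ^^ l) zeta (S0 + Complex 0 u) * W (Complex 0 u)) - (\<Sum>n. T n))
       \<le> norm (LBINT u. P (S0 + Complex 0 u) * W (Complex 0 u)) + norm (LBINT u. P (S0 + Complex (3/2) u) * W (Complex (3/2) u))"
      by (simp add: norm_triangle_ineq4)
    also have "\<dots> \<le> (C0 / (1 + \<bar>t\<bar>) * E) * (exp 2 * 4 * v ^ 2) + (C0 / (1 + \<bar>t\<bar>) * E) * (exp 2 * 4 * v ^ 2)"
      by (intro add_mono PWint) auto
    also have "\<dots> = C * v ^ 2 * exp (3/2 * \<bar>p\<bar>) / (1 + \<bar>t\<bar>)"
      by (simp add: C_def E_def exp_add mult_ac)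
    finally have fin: "norm ((LBINT u. (deriv ^^ l) zeta (S0 + Complex 0 u) * W (Complex 0 u)) - (\<Sum>n. T n)) \<le> C * v ^ 2 * exp (3/2 * \<bar>p\<bar>) / (1 + \<bar>t\<bar>)" .
    have S0u: "S0 + Complex 0 u = Complex (1/2) (t + u)" for u by (simp add: S0_def complex_eq_iff)
    show ?thesis using fin sumT' I(1)[of 0] unfolding T_def S0u W0 unfolding S0_def by simp
  qed
  have "C > 0" using C0 by (simp add: C_def)
  then show ?thesis using main by (intro that[of C]) blast+
qed

section \<open>A nonnegative weight with a transform of prescribed sign\<close>

text \<open>
  For \<open>\<sigma> = 1\<close> and for \<open>\<sigma> = -1\<close> the weight is nonnegative. Its Fourier transform \<open>trig_weight_hat\<close> consists of
  Gaussian bumps at the integers \<open>-J..J\<close>, of sign \<open>\<sigma>\<close> except for a positive one of height \<open>J\<close> at 0.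
\<close>
definition trig_weight :: "real \<Rightarrow> real \<Rightarrow> nat \<Rightarrow> real \<Rightarrow> real" where
  "trig_weight \<sigma> v J u = gauss v u * (\<Sum>j=1..J. 1 + \<sigma> * cos (real j * u))"

definition trig_weight_hat :: "real \<Rightarrow> real \<Rightarrow> nat \<Rightarrow> real \<Rightarrow> real" where
  "trig_weight_hat \<sigma> v J x = sqrt (2*pi * v) * (\<Sum>j=1..J. exp (- v * x\<^sup>2 / 2) +
      \<sigma> / 2 * (exp (- v * (real j - x)\<^sup>2 / 2) + exp (- v * (- real j - x)\<^sup>2 / 2)))"

lemma trig_weight_bounds:
  assumes "\<bar>\<sigma>\<bar> = 1"
  shows "0 \<le> trig_weight \<sigma> v J u" "trig_weight \<sigma> v J u \<le> 2 * real J * gauss v u"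
proof -
  have *: "\<bar>\<sigma> * cos (real j * u)\<bar> \<le> 1" for j using assms by (simp add: abs_mult)
  show "0 \<le> trig_weight \<sigma> v J u" unfolding trig_weight_def
  proof (intro mult_nonneg_nonneg sum_nonneg)
    show "0 \<le> 1 + \<sigma> * cos (real j * u)" for j using *[of j] by linarith
  qed simp
  have "(\<Sum>j=1..J. 1 + \<sigma> * cos (real j * u)) \<le> (\<Sum>j=1..J. 2)"
    proof (rule sum_mono)
    show "1 + \<sigma> * cos (real j * u) \<le> 2" for j using *[of j] by linarith
  qed
  then show "trig_weight \<sigma> v J u \<le> 2 * real J * gauss v u"
    unfolding trig_weight_def by (subst mult.commute, intro mult_right_mono) auto
qed

text \<open>
  For \<open>\<sigma> = -1\<close> the positive bump at 0 has to be dominated by the negative bump at 1. At \<open>y \<ge> ln 2 > 1/2\<close>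
  the latter is closer, and the quotient of the two Gaussians, \<open>exp(v (y - 1/2))\<close>, exceeds \<open>4 J\<close> by the
  choice of \<open>v\<close>, since \<open>ln 2 - 1/2 \<ge> 1/6\<close>.
\<close>
lemma trig_weight_hat_lower:
  assumes \<sigma>: "\<bar>\<sigma>\<bar> = 1" and J: "J \<ge> 1" and v: "v \<ge> 6 * ln (4 * real J)" and y: "y \<ge> ln 2"
  shows "\<sigma> * trig_weight_hat \<sigma> v J y \<ge> sqrt (2*pi * v) / 4 * (\<Sum>j=1..J. exp (- v * (real j - y)\<^sup>2 / 2))"
proof -
  define s where "s = (\<Sum>j=1..J. exp (- v * (real j - y)\<^sup>2 / 2))"
  define s' where "s' = (\<Sum>j=1..J. exp (- v * (- real j - y)\<^sup>2 / 2))"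
  define e where "e = exp (- v * y\<^sup>2 / 2)"
  have nn: "s' \<ge> 0" "s \<ge> 0" "e \<ge> 0" by (auto simp: s_def s'_def e_def intro!: sum_nonneg)
  have v0: "v \<ge> 0" proof -
    have "0 \<le> ln (4 * real J)" using J by (intro ln_ge_zero) linarith
    then show ?thesis using v by linarith
  qed
  have hat: "trig_weight_hat \<sigma> v J y = sqrt (2*pi * v) * (real J * e + \<sigma> / 2 * (s + s'))"
  proof -
    have "(\<Sum>j=1..J. exp (- v * y\<^sup>2 / 2) + \<sigma> / 2 * (exp (- v * (real j - y)\<^sup>2 / 2) + exp (- v * (- real j - y)\<^sup>2 / 2)))
      = (\<Sum>j=1..J. e) + \<sigma> / 2 * (s + s')"
      unfolding s_def s'_def e_def by (simp only: sum.distrib sum_distrib_left[symmetric])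
    then show ?thesis unfolding trig_weight_hat_def by simp
  qed
  have "real J * e \<le> s / 4"
  proof -
    have ln2: "ln 2 \<ge> (2::real)/3" by (rule ln2_ge_two_thirds)
    have "ln (4 * real J) \<le> v * (y - 1/2)"
    proof -
      have "ln (4 * real J) \<le> v * (1/6)" using v by simp
      also have "\<dots> \<le> v * (y - 1/2)"
      proof (rule mult_left_mono[OF _ v0])
        show "1/6 \<le> y - 1/2" using ln2 y by linarith
      qed
      finally show ?thesis .
    qed
    then have "exp (ln (4 * real J)) \<le> exp (v * (y - 1/2))" by simp
    then have "4 * real J \<le> exp (v * (y - 1/2))" using J by simp
    then have "4 * real J * e \<le> exp (v * (y - 1/2)) * e" using nn by (intro mult_right_mono)
    also have "\<dots> = exp (- v * (real 1 - y)\<^sup>2 / 2)"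
      unfolding e_def mult_exp_exp by (rule arg_cong[where f=exp]) (simp add: power2_eq_square field_simps)
    also have "\<dots> \<le> s" unfolding s_def by (rule member_le_sum[where i=1 and f="\<lambda>j. exp (- v * (real j - y)\<^sup>2 / 2)"]) (use J in simp_all)
    finally have "4 * real J * e \<le> s" .
    then show ?thesis by linarith
  qed
  then have le: "real J * e \<le> s / 4" .
  have Je: "0 \<le> real J * e" using nn by simp
  have key: "s / 4 \<le> \<sigma> * (real J * e + \<sigma> / 2 * (s + s'))"
  proof (cases "\<sigma> = 1")
    case True
    then have "\<sigma> * (real J * e + \<sigma> / 2 * (s + s')) = real J * e + (s / 2 + s' / 2)" by simp
    moreover have "s / 4 \<le> real J * e + (s / 2 + s' / 2)" using nn Je by linarith
    ultimately show ?thesis by (simp only:)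
  next
    case False
    then have "\<sigma> = -1" using \<sigma> by linarith
    then have "\<sigma> * (real J * e + \<sigma> / 2 * (s + s')) = - (real J * e) + (s / 2 + s' / 2)" by simp
    moreover have "s / 4 \<le> - (real J * e) + (s / 2 + s' / 2)" using nn le by linarith
    ultimately show ?thesis by (simp only:)
  qed
  have "sqrt (2*pi * v) / 4 * s = sqrt (2*pi * v) * (s / 4)" by simp
  also have "\<dots> \<le> sqrt (2*pi * v) * (\<sigma> * (real J * e + \<sigma> / 2 * (s + s')))"
    by (rule mult_left_mono[OF key]) (use v0 in simp)
  also have "\<dots> = \<sigma> * trig_weight_hat \<sigma> v J y" unfolding hat by (rule mult.left_commute)
  finally show ?thesis unfolding s_def .
qed

text \<open>
  Between \<open>ln 2\<close> and \<open>J\<close> there is a bump at distance at most 1/2.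
\<close>
lemma trig_weight_hat_signed_lower:
  assumes \<sigma>: "\<bar>\<sigma>\<bar> = 1" and J: "J \<ge> 1" and v: "v \<ge> 6 * ln (4 * real J)" and y: "y \<ge> ln 2" "y \<le> real J"
  shows "\<sigma> * trig_weight_hat \<sigma> v J y \<ge> sqrt (2*pi * v) / 4 * exp (- v / 8)"
proof -
  have v0: "v \<ge> 0" proof -
    have "0 \<le> ln (4 * real J)" using J by (intro ln_ge_zero) linarith
    then show ?thesis using v by linarith
  qed
  define j where "j = nat (round y)"
  have ln2: "ln 2 > (1::real)/2" using ln2_ge_two_thirds by linarith
  have r: "\<bar>of_int (round y) - y\<bar> \<le> 1/2" by (rule of_int_round_abs_le)
  then have "of_int (round y) > (0::real)" using y ln2 by linarith
  then have r1: "round y \<ge> 1" by linarith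
  then have j1: "real j = of_int (round y)" by (simp add: j_def)
  have "real j < real J + 1" using r j1 y by linarith
  then have j: "j \<in> {1..J}" using r1 j1 by (auto simp: j_def)
  have "(real j - y)\<^sup>2 \<le> (1/2)\<^sup>2" using r j1 by (subst abs_le_square_iff[symmetric]) simp
  then have "v * (real j - y)\<^sup>2 \<le> v * (1/4)" using v0 by (intro mult_left_mono) (auto simp: power2_eq_square)
  then have "exp (- v / 8) \<le> exp (- v * (real j - y)\<^sup>2 / 2)" by simp
  also have "\<dots> \<le> (\<Sum>j=1..J. exp (- v * (real j - y)\<^sup>2 / 2))" by (rule member_le_sum[where f="\<lambda>j. exp (- v * (real j - y)\<^sup>2 / 2)"]) (use j in simp_all)
  finally have "sqrt (2*pi * v) / 4 * exp (- v / 8) \<le> sqrt (2*pi * v) / 4 * (\<Sum>j=1..J. exp (- v * (real j - y)\<^sup>2 / 2))"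
    using v0 by (intro mult_left_mono) auto
  also have "\<dots> \<le> \<sigma> * trig_weight_hat \<sigma> v J y" by (rule trig_weight_hat_lower) fact+
  finally show ?thesis .
qed

text \<open>
  A Gaussian with centre at most \<open>J\<close> and variance at most 1 lies below \<open>exp(2 + 2 J - 2 y)\<close>. The decay
  \<open>exp(-2 y)\<close> suffices to make the sum over all \<open>k\<close>, with \<open>y = ln k\<close>, converge.
\<close>
lemma trig_weight_hat_upper:
  assumes \<sigma>: "\<bar>\<sigma>\<bar> = 1" and v: "v \<ge> 1" 
  shows "\<bar>trig_weight_hat \<sigma> v J y\<bar> \<le> sqrt (2*pi * v) * (2 * real J * exp (2 + 2 * real J - 2 * y))"
proof -
  have g: "exp (- v * (x - y)\<^sup>2 / 2) \<le> exp (2 + 2 * real J - 2 * y)" if "x \<le> real J" for x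
  proof -
    have "0 \<le> (y - x - 2)\<^sup>2" by simp
    moreover have "(y - x - 2)\<^sup>2 = (x - y)\<^sup>2 - 4 * (y - x) + 4" by (simp add: power2_eq_square algebra_simps)
    ultimately have "- (x - y)\<^sup>2 / 2 \<le> 2 - 2 * (y - x)" by linarith
    also have "\<dots> \<le> 2 + 2 * real J - 2 * y" using that by simp
    finally have 1: "- (x - y)\<^sup>2 / 2 \<le> 2 + 2 * real J - 2 * y" .
    have "1 * (x - y)\<^sup>2 \<le> v * (x - y)\<^sup>2" using v by (intro mult_right_mono) auto
    with 1 show ?thesis by simp
  qed
  have eq: "\<bar>trig_weight_hat \<sigma> v J y\<bar> = sqrt (2*pi * v) * \<bar>\<Sum>j=1..J. exp (- v * y\<^sup>2 / 2) +
      \<sigma> / 2 * (exp (- v * (real j - y)\<^sup>2 / 2) + exp (- v * (- real j - y)\<^sup>2 / 2))\<bar>"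
    (is "_ = _ * ?S") using v by (simp add: trig_weight_hat_def abs_mult)
  have S: "\<bar>\<Sum>j=1..J. exp (- v * y\<^sup>2 / 2) +
      \<sigma> / 2 * (exp (- v * (real j - y)\<^sup>2 / 2) + exp (- v * (- real j - y)\<^sup>2 / 2))\<bar> \<le> (\<Sum>j=1..J. 2 * exp (2 + 2 * real J - 2 * y))"
  proof (rule order_trans[OF sum_abs sum_mono])
    fix j assume j: "j \<in> {1..J}"
    have "\<bar>exp (- v * y\<^sup>2 / 2) + \<sigma> / 2 * (exp (- v * (real j - y)\<^sup>2 / 2) + exp (- v * (- real j - y)\<^sup>2 / 2))\<bar>
       \<le> \<bar>exp (- v * y\<^sup>2 / 2)\<bar> + \<bar>\<sigma> / 2 * (exp (- v * (real j - y)\<^sup>2 / 2) + exp (- v * (- real j - y)\<^sup>2 / 2))\<bar>" by (rule abs_triangle_ineq)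
    also have "\<dots> = exp (- v * (0 - y)\<^sup>2 / 2) + 1/2 * (exp (- v * (real j - y)\<^sup>2 / 2) + exp (- v * (- real j - y)\<^sup>2 / 2))"
      using \<sigma> by (simp add: abs_mult)
    also have "\<dots> \<le> exp (2 + 2 * real J - 2 * y) + 1/2 * (exp (2 + 2 * real J - 2 * y) + exp (2 + 2 * real J - 2 * y))"
      using j by (intro add_mono mult_left_mono g) auto
    finally show "\<bar>exp (- v * y\<^sup>2 / 2) + \<sigma> / 2 * (exp (- v * (real j - y)\<^sup>2 / 2) + exp (- v * (- real j - y)\<^sup>2 / 2))\<bar> \<le> 2 * exp (2 + 2 * real J - 2 * y)" by simp
  qed
  have "\<bar>trig_weight_hat \<sigma> v J y\<bar> = sqrt (2*pi * v) * ?S" by (rule eq)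
  also have "\<dots> \<le> sqrt (2*pi * v) * (\<Sum>j=1..J. 2 * exp (2 + 2 * real J - 2 * y))"
    by (rule mult_left_mono[OF S]) (use v in simp)
  finally show ?thesis by simp
qed

lemma zeta_deriv_critical_line_bound:
  obtains B where "B > 0" "\<And>y. norm (zeta_crit l y) \<le> B * (1 + \<bar>y\<bar>)"
proof -
  obtain g Cg where g: "g holomorphic_on UNIV" "Cg > 0"
    "\<And>s. s \<noteq> 1 \<Longrightarrow> (deriv ^^ l) zeta s = (-1)^l * fact l / (s-1)^(Suc l) + g s"
    "\<And>s. Re s \<ge> 1/2 \<Longrightarrow> norm (g s) \<le> Cg * (1 + norm s)"
    using zeta_deriv_decomp by metis
  show ?thesis
  proof (rule that[of "fact l * 2 ^ Suc l + 2 * Cg"])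
    fix y
    define s where "s = Complex (1/2) y"
    have s1: "s \<noteq> 1" by (simp add: s_def complex_eq_iff)
    have n: "norm (s - 1) \<ge> 1/2" using abs_Re_le_cmod[of "s-1"] by (simp add: s_def)
    have n0: "norm (s - 1) > 0" using s1 by simp
    have "fact l / norm (s - 1) ^ Suc l \<le> fact l / (1/2) ^ Suc l"
      using n n0 by (intro divide_left_mono power_mono mult_pos_pos zero_less_power) auto
    then have 1: "norm ((-1)^l * fact l / (s-1)^(Suc l)) \<le> fact l * 2 ^ Suc l"
      by (simp add: norm_divide norm_mult norm_power power_divide del: power_Suc)
    have "norm (g s) \<le> Cg * (1 + norm s)" by (rule g(4)) (simp add: s_def)
    also have "\<dots> \<le> Cg * (2 * (1 + \<bar>y\<bar>))" using g(2) cmod_le[of s] by (intro mult_left_mono) (auto simp: s_def)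
    finally have "norm ((deriv ^^ l) zeta s) \<le> fact l * 2 ^ Suc l + 2 * Cg * (1 + \<bar>y\<bar>)"
      unfolding g(3)[OF s1] using norm_triangle_ineq[of "(-1)^l * fact l / (s-1)^(Suc l)" "g s"] 1 by linarith
    also have "\<dots> \<le> fact l * 2 ^ Suc l * (1 + \<bar>y\<bar>) + 2 * Cg * (1 + \<bar>y\<bar>)"
      by (intro add_mono) (auto simp: distrib_left)
    finally show "norm (zeta_crit l y) \<le> (fact l * 2 ^ Suc l + 2 * Cg) * (1 + \<bar>y\<bar>)"
      by (simp add: s_def distrib_right)
  qed (use g(2) in \<open>auto intro!: add_pos_pos\<close>)
qed

section \<open>The smoothed derivative as an almost periodic function\<close>

text \<open>
  The coefficient of \<open>cos(t ln k)\<close> in the smoothed real part of the derivative, with the sign of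
  \<open>(-ln k)^l\<close> moved to the transform.
\<close>
definition smooth_coeff :: "nat \<Rightarrow> real \<Rightarrow> nat \<Rightarrow> nat \<Rightarrow> real" where
  "smooth_coeff l v J k = ln (real k) ^ l * real k powr (-1/2) * ((-1)^l * trig_weight_hat ((-1)^l) v J (ln (real k)))"

text \<open>
  The weight is a linear combination of Gaussians modulated by the frequencies 0 and \<open>\<plusminus>j\<close>, so this is
  the corresponding combination of instances of \<open>zeta_gauss_transform\<close>.
\<close>
lemma smoothed_zeta_identity:
  obtains C where "C > 0"
    "\<And>v J t. v \<ge> 1 \<Longrightarrow> integrable lborel (\<lambda>u. Re (zeta_crit l (t + u)) * trig_weight ((-1)^l) v J u)"
    "\<And>v J t. v \<ge> 1 \<Longrightarrow> \<bar>(LBINT u. Re (zeta_crit l (t + u)) * trig_weight ((-1)^l) v J u)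
        - (\<Sum>n. smooth_coeff l v J (Suc n) * cos (t * ln (real (Suc n))))\<bar> \<le> C * v ^ 2 * real J * exp (2 * real J) / (1 + \<bar>t\<bar>)"
proof -
  define F where "F = (deriv ^^ l) zeta"
  obtain C where C: "C > 0"
    "\<And>v p t. v \<ge> 1 \<Longrightarrow> integrable lborel (\<lambda>u. F (Complex (1/2) (t + u)) * (gauss v u *\<^sub>R cis (p * u)))"
    "\<And>v p t. v \<ge> 1 \<Longrightarrow> summable (\<lambda>n. norm ((- of_real (ln (real (Suc n))))^l * (of_nat (Suc n) :: complex) powr (- Complex (1/2) t) 
            * of_real (sqrt (2*pi * v) * exp (- v * (p - ln (real (Suc n)))\<^sup>2 / 2))))"
    "\<And>v p t. v \<ge> 1 \<Longrightarrow> norm ((LBINT u. F (Complex (1/2) (t + u)) * (gauss v u *\<^sub>R cis (p * u)))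
       - (\<Sum>n. (- of_real (ln (real (Suc n))))^l * (of_nat (Suc n) :: complex) powr (- Complex (1/2) t) 
            * of_real (sqrt (2*pi * v) * exp (- v * (p - ln (real (Suc n)))\<^sup>2 / 2))))
        \<le> C * v ^ 2 * exp (3/2 * \<bar>p\<bar>) / (1 + \<bar>t\<bar>)"
    unfolding F_def by (rule zeta_gauss_transform[of l]) blast
  define \<sigma> :: real where "\<sigma> = (-1)^l"
  have \<sigma>: "\<bar>\<sigma>\<bar> = 1" by (simp add: \<sigma>_def power_abs)
  have main: "integrable lborel (\<lambda>u. Re (F (Complex (1/2) (t + u))) * trig_weight \<sigma> v J u) \<and>
      \<bar>(LBINT u. Re (F (Complex (1/2) (t + u))) * trig_weight \<sigma> v J u)
        - (\<Sum>n. smooth_coeff l v J (Suc n) * cos (t * ln (real (Suc n))))\<bar> \<le> (2 * C) * v ^ 2 * real J * exp (2 * real J) / (1 + \<bar>t\<bar>)"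
    if v: "v \<ge> 1" for v t J
  proof -
    define I where "I = (\<lambda>p u. F (Complex (1/2) (t + u)) * (gauss v u *\<^sub>R cis (p * u)))"
    define T where "T = (\<lambda>p n. (- of_real (ln (real (Suc n))))^l * (of_nat (Suc n) :: complex) powr (- Complex (1/2) t) 
            * of_real (sqrt (2*pi * v) * exp (- v * (p - ln (real (Suc n)))\<^sup>2 / 2)))"
    define L where "L = (\<lambda>X :: real \<Rightarrow> complex. \<Sum>j=1..J. X 0 + of_real (\<sigma> / 2) * (X (real j) + X (- real j)))"
    have Ii: "integrable lborel (I p)" for p unfolding I_def by (rule C(2)[OF v])
    have sT: "(\<lambda>n. T p n) sums (\<Sum>n. T p n)" for p
      unfolding T_def by (rule summable_sums[OF summable_norm_cancel[OF C(3)[OF v]]])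
    have b: "norm (integral\<^sup>L lborel (I p) - (\<Sum>n. T p n)) \<le> C * v ^ 2 * exp (2 * real J) / (1 + \<bar>t\<bar>)" if "\<bar>p\<bar> \<le> real J" for p
    proof -
      have "norm (integral\<^sup>L lborel (I p) - (\<Sum>n. T p n)) \<le> C * v ^ 2 * exp (3/2 * \<bar>p\<bar>) / (1 + \<bar>t\<bar>)"
        unfolding I_def T_def by (rule C(4)[OF v])
      also have "\<dots> \<le> C * v ^ 2 * exp (2 * real J) / (1 + \<bar>t\<bar>)"
        using C(1) that by (intro divide_right_mono mult_left_mono) auto
      finally show ?thesis .
    qed
    have Fw: "F (Complex (1/2) (t + u)) * of_real (trig_weight \<sigma> v J u) = L (\<lambda>p. I p u)" for u
    proof -
      have "I 0 u + of_real (\<sigma> / 2) * (I (real j) u + I (- real j) u) = F (Complex (1/2) (t + u)) * of_real (gauss v u) * of_real (1 + \<sigma> * cos (real j * u))" for j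
      proof -
        have "cis (real j * u) + cis (- real j * u) = of_real (2 * cos (real j * u))" by (simp add: complex_eq_iff)
        then have "I (real j) u + I (- real j) u = F (Complex (1/2) (t + u)) * of_real (gauss v u) * of_real (2 * cos (real j * u))"
          unfolding I_def scaleR_conv_of_real by (simp only: distrib_left[symmetric] mult.assoc)
        then show ?thesis by (simp add: I_def scaleR_conv_of_real algebra_simps)
      qed
      then show ?thesis unfolding L_def trig_weight_def by (simp only: of_real_mult of_real_sum sum_distrib_left mult.assoc)
    qed
    have hasL: "has_bochner_integral lborel (\<lambda>u. L (\<lambda>p. I p u)) (L (\<lambda>p. integral\<^sup>L lborel (I p)))"
      unfolding L_def
      by (intro has_bochner_integral_sum has_bochner_integral_add has_bochner_integral_mult_right has_bochner_integral_integrable Ii)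
    have int: "integrable lborel (\<lambda>u. L (\<lambda>p. I p u))"
      and intL: "(LBINT u. L (\<lambda>p. I p u)) = L (\<lambda>p. integral\<^sup>L lborel (I p))"
      using hasL by (auto simp: has_bochner_integral_iff)
    have sumL: "(\<lambda>n. L (\<lambda>p. T p n)) sums L (\<lambda>p. \<Sum>n. T p n)"
      unfolding L_def by (intro sums_sum sums_add sums_mult sT)
    have TL: "Re (L (\<lambda>p. T p n)) = smooth_coeff l v J (Suc n) * cos (t * ln (real (Suc n)))" for n
    proof -
      define c where "c = (- of_real (ln (real (Suc n))))^l * (of_nat (Suc n) :: complex) powr (- Complex (1/2) t)"
      have "L (\<lambda>p. T p n) = c * of_real (trig_weight_hat \<sigma> v J (ln (real (Suc n))))"
        unfolding L_def T_def c_def[symmetric] trig_weight_hat_def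
        by (simp add: sum_distrib_left algebra_simps del: of_nat_Suc)
      moreover have "Re c = ln (real (Suc n)) ^ l * real (Suc n) powr (-1/2) * ((-1)^l * cos (t * ln (real (Suc n))))"
      proof -
        have "c = of_real ((- ln (real (Suc n)))^l) * exp (of_real (ln (real (Suc n))) * (- Complex (1/2) t))"
          unfolding c_def nat_powr_exp by simp
        moreover have "Re (exp (of_real (ln (real (Suc n))) * (- Complex (1/2) t))) = real (Suc n) powr (-1/2) * cos (t * ln (real (Suc n)))"
          by (simp add: Re_exp powr_def mult.commute del: of_nat_Suc)
        ultimately show ?thesis by (simp add: power_minus[of "ln _"] mult_ac del: of_nat_Suc)
      qed
      ultimately show ?thesis by (simp add: smooth_coeff_def \<sigma>_def mult_ac del: of_nat_Suc)
    qed
    have "norm (L (\<lambda>p. integral\<^sup>L lborel (I p)) - L (\<lambda>p. \<Sum>n. T p n)) = norm (\<Sum>j=1..J. 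
        ((integral\<^sup>L lborel (I 0)) - (\<Sum>n. T 0 n)) + of_real (\<sigma> / 2) * ((integral\<^sup>L lborel (I (real j)) - (\<Sum>n. T (real j) n)) + (integral\<^sup>L lborel (I (- real j)) - (\<Sum>n. T (- real j) n))))"
      unfolding L_def by (simp add: sum_subtractf[symmetric] algebra_simps)
    also have "\<dots> \<le> (\<Sum>j=1..J. 2 * (C * v ^ 2 * exp (2 * real J) / (1 + \<bar>t\<bar>)))" (is "_ \<le> (\<Sum>j=1..J. 2 * ?E)")
    proof (rule sum_norm_le)
      fix j assume j: "j \<in> {1..J}"
      have n\<sigma>: "norm (of_real (\<sigma> / 2) :: complex) = 1/2" using \<sigma> by simp
      have tri: "norm (x + of_real (\<sigma> / 2) * (y + z)) \<le> ?E + 1/2 * (?E + ?E)" if "norm x \<le> ?E" "norm y \<le> ?E" "norm z \<le> ?E" for x y z :: complex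
      proof -
        have "norm (x + of_real (\<sigma> / 2) * (y + z)) \<le> norm x + norm (of_real (\<sigma> / 2) * (y + z))" by (rule norm_triangle_ineq)
        also have "\<dots> = norm x + 1/2 * norm (y + z)" by (simp only: norm_mult n\<sigma>)
        finally show ?thesis using that norm_triangle_ineq[of y z] by argo
      qed
      have "norm (((integral\<^sup>L lborel (I 0)) - (\<Sum>n. T 0 n)) + of_real (\<sigma> / 2) * ((integral\<^sup>L lborel (I (real j)) - (\<Sum>n. T (real j) n)) + (integral\<^sup>L lborel (I (- real j)) - (\<Sum>n. T (- real j) n))))
        \<le> ?E + 1/2 * (?E + ?E)"
        by (rule tri; rule b) (use j in auto)
      then show "norm (((integral\<^sup>L lborel (I 0)) - (\<Sum>n. T 0 n)) + of_real (\<sigma> / 2) * ((integral\<^sup>L lborel (I (real j)) - (\<Sum>n. T (real j) n)) + (integral\<^sup>L lborel (I (- real j)) - (\<Sum>n. T (- real j) n))))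
        \<le> 2 * ?E" by simp
    qed
    also have "\<dots> = (2 * C) * v ^ 2 * real J * exp (2 * real J) / (1 + \<bar>t\<bar>)" by simp
    finally have n: "norm (L (\<lambda>p. integral\<^sup>L lborel (I p)) - L (\<lambda>p. \<Sum>n. T p n)) \<le> (2 * C) * v ^ 2 * real J * exp (2 * real J) / (1 + \<bar>t\<bar>)" .
    have Fi: "integrable lborel (\<lambda>u. F (Complex (1/2) (t + u)) * of_real (trig_weight \<sigma> v J u))"
      unfolding Fw by (rule int)
    have R: "(\<lambda>u. Re (F (Complex (1/2) (t + u))) * trig_weight \<sigma> v J u) = (\<lambda>u. Re (F (Complex (1/2) (t + u)) * of_real (trig_weight \<sigma> v J u)))"
      by simp
    have 1: "integrable lborel (\<lambda>u. Re (F (Complex (1/2) (t + u))) * trig_weight \<sigma> v J u)"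
      unfolding R by (rule integrable_Re[OF Fi])
    have 2: "(LBINT u. Re (F (Complex (1/2) (t + u))) * trig_weight \<sigma> v J u) = Re (L (\<lambda>p. integral\<^sup>L lborel (I p)))"
      unfolding R using integral_Re[OF Fi] unfolding Fw intL by simp
    have 3: "(\<Sum>n. smooth_coeff l v J (Suc n) * cos (t * ln (real (Suc n)))) = Re (L (\<lambda>p. \<Sum>n. T p n))"
      using sums_Re[OF sumL] unfolding TL by (rule sums_unique[symmetric])
    show ?thesis unfolding 2 3 using 1 n abs_Re_le_cmod[of "L (\<lambda>p. integral\<^sup>L lborel (I p)) - L (\<lambda>p. \<Sum>n. T p n)"] by auto
  qed
  show ?thesis by (rule that[of "2 * C"]) (use main C(1) in \<open>auto simp: F_def \<sigma>_def\<close>)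
qed

text \<open>
  The sign \<open>(-1)^l\<close> of the weight was chosen for this. For \<open>k = 1\<close> the coefficient vanishes because \<open>l > 0\<close>.
\<close>
lemma smooth_coeff_nonneg:
  assumes "l > 0" "J \<ge> 1" "v \<ge> 6 * ln (4 * real J)"
  shows "smooth_coeff l v J k \<ge> 0"
proof (cases "k \<ge> 2")
  case True
  have "sqrt (2*pi * v) / 4 * (\<Sum>j=1..J. exp (- v * (real j - ln (real k))\<^sup>2 / 2)) \<le> (-1)^l * trig_weight_hat ((-1)^l) v J (ln (real k))"
    by (rule trig_weight_hat_lower) (use assms True in \<open>auto simp: power_abs\<close>)
  moreover have "0 \<le> ln (4 * real J)" using assms(2) by (intro ln_ge_zero) linarith
  then have "0 \<le> v" using assms(3) by linarith
  then have "0 \<le> sqrt (2*pi * v) / 4 * (\<Sum>j=1..J. exp (- v * (real j - ln (real k))\<^sup>2 / 2))"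
    by (intro mult_nonneg_nonneg sum_nonneg) auto
  ultimately have "0 \<le> (-1)^l * trig_weight_hat ((-1)^l) v J (ln (real k))" by linarith
  then show ?thesis unfolding smooth_coeff_def by (rule mult_nonneg_nonneg[rotated]) (use True in auto)
next
  case False
  then have "k = 0 \<or> k = 1" by auto
  then show ?thesis using assms(1) by (auto simp: smooth_coeff_def zero_power)
qed

lemma smooth_coeff_lower:
  assumes "J \<ge> 1" "v \<ge> 6 * ln (4 * real J)" "k \<ge> 2" "ln (real k) \<le> real J"
  shows "smooth_coeff l v J k \<ge> (ln 2 ^ l / 4) * sqrt v * exp (- v / 8) * real k powr (-1/2)"
proof -
  have "0 \<le> ln (4 * real J)" using assms(1) by (intro ln_ge_zero) linarith
  then have v: "0 \<le> v" using assms(2) by linarith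
  have "sqrt v / 4 * exp (- v / 8) \<le> sqrt (2*pi * v) / 4 * exp (- v / 8)"
  proof (intro mult_right_mono divide_right_mono)
    have "1 * v \<le> (2 * pi) * v" using pi_gt3 v by (intro mult_right_mono) auto
    then show "sqrt v \<le> sqrt (2*pi * v)" by simp
  qed auto
  also have "\<dots> \<le> (-1)^l * trig_weight_hat ((-1)^l) v J (ln (real k))"
    by (rule trig_weight_hat_signed_lower) (use assms in \<open>auto simp: power_abs\<close>)
  finally have 1: "sqrt v / 4 * exp (- v / 8) \<le> (-1)^l * trig_weight_hat ((-1)^l) v J (ln (real k))" .
  have 2: "ln 2 ^ l * real k powr (-1/2) \<le> ln (real k) ^ l * real k powr (-1/2)"
    using assms by (intro mult_right_mono power_mono) auto
  have "(ln 2 ^ l * real k powr (-1/2)) * (sqrt v / 4 * exp (- v / 8)) \<le> smooth_coeff l v J k"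
    unfolding smooth_coeff_def by (rule mult_mono[OF 2 1]) (use assms v in auto)
  then show ?thesis by (simp add: mult_ac)
qed

lemma smooth_coeff_sum:
  obtains C where "C > 0" 
    "\<And>v J. v \<ge> 1 \<Longrightarrow> summable (\<lambda>n. \<bar>smooth_coeff l v J (Suc n)\<bar>)"
    "\<And>v J. v \<ge> 1 \<Longrightarrow> (\<Sum>n. \<bar>smooth_coeff l v J (Suc n)\<bar>) \<le> C * sqrt v * real J * exp (2 * real J)"
proof -
  have sumln: "summable (\<lambda>n. ln (real (Suc n)) ^ l * real (Suc n) powr (-5/2))"
  proof (rule summable_comparison_test_bigo)
    show "summable (\<lambda>n. norm (real n powr (-3/2)))" by (simp add: summable_real_powr_iff)
    show "(\<lambda>n. ln (real (Suc n)) ^ l * real (Suc n) powr (-5/2)) \<in> O(\<lambda>n. real n powr (-3/2))"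
      by real_asymp
  qed
  define M where "M = (\<Sum>n. ln (real (Suc n)) ^ l * real (Suc n) powr (-5/2))"
  have M: "M \<ge> 0" unfolding M_def by (intro suminf_nonneg sumln) auto
  define C where "C = sqrt (2 * pi) * 2 * exp 2 * M + 1"
  have b: "\<bar>smooth_coeff l v J (Suc n)\<bar> \<le> (sqrt (2 * pi) * 2 * exp 2 * (sqrt v * real J * exp (2 * real J))) * (ln (real (Suc n)) ^ l * real (Suc n) powr (-5/2))" if v: "v \<ge> 1" for v J n
  proof -
    have e: "exp (2 + 2 * real J - 2 * ln (real (Suc n))) = exp 2 * exp (2 * real J) * real (Suc n) powr (-2)"
      by (simp add: powr_def exp_add[symmetric] exp_diff del: of_nat_Suc)
    have "\<bar>smooth_coeff l v J (Suc n)\<bar> = ln (real (Suc n)) ^ l * real (Suc n) powr (-1/2) * \<bar>trig_weight_hat ((-1)^l) v J (ln (real (Suc n)))\<bar>"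
      unfolding smooth_coeff_def by (simp add: abs_mult power_abs del: of_nat_Suc)
    also have "\<dots> \<le> ln (real (Suc n)) ^ l * real (Suc n) powr (-1/2) * (sqrt (2*pi * v) * (2 * real J * exp (2 + 2 * real J - 2 * ln (real (Suc n)))))"
      by (intro mult_left_mono trig_weight_hat_upper v) (auto simp: power_abs)
    also have "\<dots> = (sqrt (2 * pi) * 2 * exp 2 * (sqrt v * real J * exp (2 * real J))) * (ln (real (Suc n)) ^ l * (real (Suc n) powr (-1/2) * real (Suc n) powr (-2)))"
      unfolding e real_sqrt_mult by (simp only: mult_ac)
    also have "real (Suc n) powr (-1/2) * real (Suc n) powr (-2) = real (Suc n) powr (-5/2)" by (simp flip: powr_add)
    finally show ?thesis .
  qed
  show ?thesis
  proof (rule that[of C])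
    show "C > 0" using M by (simp add: C_def add_nonneg_pos)
    fix v :: real and J assume v: "v \<ge> 1"
    show s: "summable (\<lambda>n. \<bar>smooth_coeff l v J (Suc n)\<bar>)"
      by (rule summable_comparison_test'[OF summable_mult[OF sumln]]) (use b[OF v] in auto)
    have "(\<Sum>n. \<bar>smooth_coeff l v J (Suc n)\<bar>) \<le> (\<Sum>n. (sqrt (2 * pi) * 2 * exp 2 * (sqrt v * real J * exp (2 * real J))) * (ln (real (Suc n)) ^ l * real (Suc n) powr (-5/2)))"
      by (intro suminf_le b[OF v] s summable_mult sumln)
    also have "\<dots> = (sqrt (2 * pi) * 2 * exp 2 * (sqrt v * real J * exp (2 * real J))) * M"
      unfolding M_def by (rule suminf_mult[OF sumln])
    also have "\<dots> = (sqrt (2 * pi) * 2 * exp 2 * M) * (sqrt v * real J * exp (2 * real J))" by (simp only: mult_ac)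
    also have "\<dots> \<le> C * (sqrt v * real J * exp (2 * real J))" using v by (intro mult_right_mono) (auto simp: C_def)
    finally show "(\<Sum>n. \<bar>smooth_coeff l v J (Suc n)\<bar>) \<le> C * sqrt v * real J * exp (2 * real J)" by (simp only: mult.assoc)
  qed
qed

text \<open>
  The weight is nonnegative, so the part of the average with \<open>|u| \<le> U\<close> is at most \<open>S\<close> times its mass.
  For larger \<open>|u|\<close> the derivative grows at most linearly, and \<open>((1 + |u|)/U)^m \<ge> 1\<close> can be inserted and
  paid for by the Gaussian.
\<close>
lemma smoothed_sum_le_sup:
  obtains C where "C > 0"
    "\<And>v J t S U y1 y2. v \<ge> 1 \<Longrightarrow> U > 0 \<Longrightarrow> S \<ge> 0 \<Longrightarrow> y1 + U \<le> t \<Longrightarrow> t + U \<le> y2 \<Longrightarrow>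
      (\<And>y. y1 \<le> y \<Longrightarrow> y \<le> y2 \<Longrightarrow> Re (zeta_crit l y) \<le> S) \<Longrightarrow>
      (\<Sum>n. smooth_coeff l v J (Suc n) * cos (t * ln (real (Suc n)))) \<le>
        C * real J * sqrt v * S + C * real J * v ^ (m + 2) * (1 + \<bar>t\<bar>) / U ^ m + C * v ^ 2 * real J * exp (2 * real J) / (1 + \<bar>t\<bar>)"
proof -
  obtain C0 where C0: "C0 > 0"
    "\<And>v J t. v \<ge> 1 \<Longrightarrow> integrable lborel (\<lambda>u. Re (zeta_crit l (t + u)) * trig_weight ((-1)^l) v J u)"
    "\<And>v J t. v \<ge> 1 \<Longrightarrow> \<bar>(LBINT u. Re (zeta_crit l (t + u)) * trig_weight ((-1)^l) v J u)
        - (\<Sum>n. smooth_coeff l v J (Suc n) * cos (t * ln (real (Suc n))))\<bar> \<le> C0 * v ^ 2 * real J * exp (2 * real J) / (1 + \<bar>t\<bar>)"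
    by (rule smoothed_zeta_identity[of l]) blast
  obtain B where B: "B > 0" "\<And>y. norm (zeta_crit l y) \<le> B * (1 + \<bar>y\<bar>)"
    by (rule zeta_deriv_critical_line_bound[of l]) blast
  define C where "C = C0 + 2 * sqrt (2 * pi) + 2 * B * (fact (m + 1) * exp 2 * 4)"
  show ?thesis
  proof (rule that[of C])
    show "C > 0" using C0(1) B(1) by (auto simp: C_def intro!: add_pos_pos)
    fix v t S U y1 y2 :: real and J
    assume v: "v \<ge> 1" and U: "U > 0" and S: "S \<ge> 0" and y1: "y1 + U \<le> t" and y2: "t + U \<le> y2"
      and le: "\<And>y. y1 \<le> y \<Longrightarrow> y \<le> y2 \<Longrightarrow> Re (zeta_crit l y) \<le> S"
    let ?H = "trig_weight ((-1)^l) v J" and ?g = "\<lambda>u::real. gauss v u"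
    have abs1: "\<bar>(-1)^l :: real\<bar> = 1" by (simp add: power_abs)
    note H = trig_weight_bounds[OF abs1, where v=v and J=J]
    define K where "K = 2 * real J * B * (1 + \<bar>t\<bar>) / U ^ m"
    have K0: "K \<ge> 0" using B(1) U by (simp add: K_def)
    have pt: "Re (zeta_crit l (t + u)) * ?H u \<le> (2 * real J * S) * ?g u + K * ((1 + \<bar>u\<bar>) ^ (m + 1) * ?g u)" for u
    proof (cases "\<bar>u\<bar> \<le> U")
      case True
      then have "Re (zeta_crit l (t + u)) * ?H u \<le> S * ?H u"
        using y1 y2 H(1) by (intro mult_right_mono le) auto
      also have "\<dots> \<le> S * (2 * real J * ?g u)" by (rule mult_left_mono[OF H(2) S])
      also have "\<dots> \<le> (2 * real J * S) * ?g u + K * ((1 + \<bar>u\<bar>) ^ (m + 1) * ?g u)"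
        using K0 by simp
      finally show ?thesis .
    next
      case False
      have "Re (zeta_crit l (t + u)) \<le> B * (1 + \<bar>t + u\<bar>)"
        using B(2)[of "t + u"] complex_Re_le_cmod order_trans by blast
      also have "\<dots> \<le> B * ((1 + \<bar>t\<bar>) * (1 + \<bar>u\<bar>))"
      proof (rule mult_left_mono)
        have "1 + \<bar>t + u\<bar> \<le> (1 + \<bar>t\<bar>) + \<bar>u\<bar>" by linarith
        also have "\<dots> \<le> (1 + \<bar>t\<bar>) * (1 + \<bar>u\<bar>)" by (simp add: algebra_simps)
        finally show "1 + \<bar>t + u\<bar> \<le> (1 + \<bar>t\<bar>) * (1 + \<bar>u\<bar>)" .
      qed (use B(1) in auto)
      also have "\<dots> \<le> B * ((1 + \<bar>t\<bar>) * (1 + \<bar>u\<bar>)) * ((1 + \<bar>u\<bar>) / U) ^ m"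
      proof -
        have "1 \<le> ((1 + \<bar>u\<bar>) / U) ^ m" using False U by (intro one_le_power) auto
        then have "B * ((1 + \<bar>t\<bar>) * (1 + \<bar>u\<bar>)) * 1 \<le> B * ((1 + \<bar>t\<bar>) * (1 + \<bar>u\<bar>)) * ((1 + \<bar>u\<bar>) / U) ^ m"
          using B(1) by (intro mult_left_mono) auto
        then show ?thesis by simp
      qed
      finally have 1: "Re (zeta_crit l (t + u)) \<le> B * ((1 + \<bar>t\<bar>) * (1 + \<bar>u\<bar>)) * ((1 + \<bar>u\<bar>) / U) ^ m" .
      have "Re (zeta_crit l (t + u)) * ?H u \<le> (B * ((1 + \<bar>t\<bar>) * (1 + \<bar>u\<bar>)) * ((1 + \<bar>u\<bar>) / U) ^ m) * (2 * real J * ?g u)"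
        by (rule mult_mono[OF 1 H(2)]) (use B(1) U H(1) in auto)
      also have "\<dots> = K * ((1 + \<bar>u\<bar>) ^ (m + 1) * ?g u)"
        by (simp add: K_def power_divide)
      also have "\<dots> \<le> (2 * real J * S) * ?g u + K * ((1 + \<bar>u\<bar>) ^ (m + 1) * ?g u)" using S by simp
      finally show ?thesis .
    qed
    have gi: "integrable lborel ?g" "(LBINT u. ?g u) = sqrt (2*pi * v)"
      using gauss_integral[of v] v by (auto simp: has_bochner_integral_iff)
    note pg = poly_gauss_integral[OF v, of "m + 1"]
    have "(LBINT u. Re (zeta_crit l (t + u)) * ?H u) \<le> (LBINT u. (2 * real J * S) * ?g u + K * ((1 + \<bar>u\<bar>) ^ (m + 1) * ?g u))"
      by (intro integral_mono C0(2) v pt Bochner_Integration.integrable_add integrable_mult_right gi pg)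
    also have "\<dots> = (2 * real J * S) * sqrt (2*pi * v) + K * (LBINT u. (1 + \<bar>u\<bar>) ^ (m + 1) * ?g u)"
      by (subst Bochner_Integration.integral_add) (use gi pg in \<open>auto intro!: integrable_mult_right\<close>)
    also have "\<dots> \<le> (2 * real J * S) * sqrt (2*pi * v) + K * ((fact (m + 1) * exp 2 * 4) * v ^ (m + 2))"
      using pg(2) K0 by (intro add_left_mono mult_left_mono) auto
    also have "\<dots> = (2 * sqrt (2 * pi)) * (real J * sqrt v * S) + (2 * B * (fact (m + 1) * exp 2 * 4)) * (real J * v ^ (m + 2) * (1 + \<bar>t\<bar>) / U ^ m)"
      by (simp add: K_def real_sqrt_mult mult_ac)
    also have "\<dots> \<le> C * (real J * sqrt v * S) + C * (real J * v ^ (m + 2) * (1 + \<bar>t\<bar>) / U ^ m)"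
      using C0(1) B(1) S U v by (intro add_mono mult_right_mono) (auto simp: C_def)
    finally have 1: "(LBINT u. Re (zeta_crit l (t + u)) * ?H u) \<le> C * (real J * sqrt v * S) + C * (real J * v ^ (m + 2) * (1 + \<bar>t\<bar>) / U ^ m)" .
    have "C0 * (v ^ 2 * real J * exp (2 * real J) / (1 + \<bar>t\<bar>)) \<le> C * (v ^ 2 * real J * exp (2 * real J) / (1 + \<bar>t\<bar>))"
      using B(1) by (intro mult_right_mono) (auto simp: C_def)
    then show "(\<Sum>n. smooth_coeff l v J (Suc n) * cos (t * ln (real (Suc n)))) \<le>
        C * real J * sqrt v * S + C * real J * v ^ (m + 2) * (1 + \<bar>t\<bar>) / U ^ m + C * v ^ 2 * real J * exp (2 * real J) / (1 + \<bar>t\<bar>)"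
      using 1 C0(3)[OF v, of t J] by (simp add: mult.assoc abs_le_iff)
  qed
qed

section \<open>The resonance inequality\<close>

text \<open>
  The point of this bound is that it does not depend on the number of lattice points: distinct
  frequencies of the resonator are almost orthogonal.
\<close>
lemma gauss_lattice_sum:
  fixes C :: "int set" and i :: int
  assumes "finite C"
  shows "(\<Sum>j\<in>C. exp (- (real_of_int (i - j))\<^sup>2 / 2)) \<le> 6"
proof -
  define N where "N = (\<Sum>d. exp (-1/2::real) ^ d)"
  have N: "N \<le> 3"
  proof -
    have "1 + 1/2 \<le> exp (1/2 :: real)" by (rule exp_ge_add_one_self)
    then have "exp (-1/2::real) \<le> 2/3" by (simp add: exp_minus field_simps)
    moreover have "N = 1 / (1 - exp (-1/2))" unfolding N_def by (rule suminf_geometric) simp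
    moreover from calculation have "1 / (1 - exp (-1/2)) \<le> 1 / (1/3 :: real)" by (intro divide_left_mono) auto
    ultimately show ?thesis by simp
  qed
  have g: "exp (- (real_of_int (i - j))\<^sup>2 / 2) \<le> exp (-1/2) ^ nat \<bar>i - j\<bar>" for j
  proof -
    have "real (nat \<bar>i - j\<bar>) \<le> (real_of_int (i - j))\<^sup>2"
    proof -
      have "\<bar>i - j\<bar> * 1 \<le> \<bar>i - j\<bar> * \<bar>i - j\<bar>" by (cases "i = j", simp, rule mult_left_mono) auto
      then have "\<bar>i - j\<bar> \<le> (i - j)\<^sup>2" by (simp add: power2_eq_square flip: abs_mult)
      then have "real_of_int \<bar>i - j\<bar> \<le> real_of_int ((i - j)\<^sup>2)" by (rule of_int_le_iff[THEN iffD2])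
      then show ?thesis by simp
    qed
    then show ?thesis by (simp flip: exp_of_nat_mult)
  qed
  have part: "(\<Sum>j\<in>A. exp (- (real_of_int (i - j))\<^sup>2 / 2)) \<le> 3" if A: "finite A" "inj_on (\<lambda>j. nat \<bar>i - j\<bar>) A" for A
  proof -
    have "(\<Sum>j\<in>A. exp (- (real_of_int (i - j))\<^sup>2 / 2)) \<le> (\<Sum>j\<in>A. exp (-1/2) ^ nat \<bar>i - j\<bar>)" by (intro sum_mono g)
    also have "\<dots> = (\<Sum>d\<in>(\<lambda>j. nat \<bar>i - j\<bar>) ` A. exp (-1/2) ^ d)" using A by (simp add: sum.reindex)
    also have "\<dots> \<le> N" unfolding N_def using A by (intro sum_le_suminf) auto
    finally show ?thesis using N by simp
  qed
  have "(\<Sum>j\<in>C. exp (- (real_of_int (i - j))\<^sup>2 / 2)) = (\<Sum>j\<in>{j\<in>C. j < i}. exp (- (real_of_int (i - j))\<^sup>2 / 2)) + (\<Sum>j\<in>{j\<in>C. j \<ge> i}. exp (- (real_of_int (i - j))\<^sup>2 / 2))"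
    using assms by (subst sum.union_disjoint[symmetric]) (auto intro!: sum.cong)
  also have "\<dots> \<le> 3 + 3" using assms by (intro add_mono part) (auto simp: inj_on_def)
  finally show ?thesis by simp
qed

text \<open>
  If \<open>D(t) = \<Sum> a(k) cos(t ln k)\<close> is at most \<open>V\<close> for \<open>t0 \<le> |t| \<le> t1\<close>, then its integral against a weight
  \<open>exp(-t\<^sup>2/2\<tau>\<^sup>2) |R(t)|\<^sup>2\<close> is at most \<open>V\<close> times the mass of the weight, apart from the other ranges of \<open>t\<close>.
  Expanding the integral gives nonnegative terms only, since all coefficients and the transform of the
  Gaussian are nonnegative; the terms with \<open>m = k n\<close> form the left-hand side. The cardinality of \<open>M\<close>
  enters through \<open>|R|\<^sup>2 \<le> card M * (\<Sum>m\<in>M. (f m)\<^sup>2)\<close>, so the elements of \<open>M\<close> may be arbitrarily large.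
\<close>
lemma resonance:
  fixes a :: "nat \<Rightarrow> real" and f :: "nat \<Rightarrow> real" and M :: "nat set"
  assumes a0: "\<And>k. a k \<ge> 0" and asum: "summable (\<lambda>n. a (Suc n))"
    and M: "finite M" "0 \<notin> M" and f0: "\<And>m. f m \<ge> 0"
    and \<tau>: "\<tau> > 0" and t12: "0 \<le> t0" "0 \<le> t1" and V: "V \<ge> 0"
    and le: "\<And>t. t0 \<le> t \<Longrightarrow> t \<le> t1 \<Longrightarrow> (\<Sum>n. a (Suc n) * cos (t * ln (real (Suc n)))) \<le> V"
  shows "exp (-1/2) * dvd_pair_sum M a f
     \<le> (6 * V + (\<Sum>n. a (Suc n)) * real (card M) * (2 * t0 / \<tau> + 2 * exp (- t1\<^sup>2 / (4 * \<tau>\<^sup>2)))) * (\<Sum>m\<in>M. (f m)\<^sup>2)"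
proof -
  define \<Phi> where "\<Phi> = (\<lambda>t::real. exp (- t\<^sup>2 / (2 * \<tau>\<^sup>2)))"
  define h where "h = (\<lambda>x. sqrt (2*pi * \<tau>\<^sup>2) * exp (- \<tau>\<^sup>2 * x\<^sup>2 / 2))"
  have \<tau>2: "\<tau>\<^sup>2 > 0" using \<tau> by simp
  have hc: "has_bochner_integral lborel (\<lambda>t. \<Phi> t * cos (x * t)) (h x)" for x
    unfolding \<Phi>_def h_def by (rule gauss_cos[OF \<tau>2])
  have h0: "h x \<ge> 0" for x by (simp add: h_def)
  \<comment> \<open>Elements of \<open>M\<close> can be much closer to each other than \<open>1/\<tau>\<close> on a logarithmic scale. They are
    merged into cells of that length, each represented by its left endpoint \<open>x c\<close>, so that the
    frequencies of the resonator lie in a lattice.\<close>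
  define cell where "cell = (\<lambda>m::nat. \<lfloor>\<tau> * ln (real m)\<rfloor>)"
  define C where "C = cell ` M"
  have C: "finite C" using M by (simp add: C_def)
  define r where "r = (\<lambda>c. sqrt (\<Sum>m\<in>{m\<in>M. cell m = c}. (f m)\<^sup>2))"
  have r0: "r c \<ge> 0" for c by (simp add: r_def sum_nonneg)
  define N2 where "N2 = (\<Sum>m\<in>M. (f m)\<^sup>2)"
  have N20: "N2 \<ge> 0" by (simp add: N2_def sum_nonneg)
  have r2: "(\<Sum>c\<in>C. (r c)\<^sup>2) = N2"
    unfolding r_def N2_def C_def by (simp add: sum_nonneg) (rule sum.image_gen[OF M(1), symmetric])
  define x where "x = (\<lambda>c::int. real_of_int c / \<tau>)"
  \<comment> \<open>\<open>Q\<close> is the squared absolute value of the resonator, multiplied out.\<close>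
  define Q where "Q = (\<lambda>t. \<Sum>i\<in>C. \<Sum>j\<in>C. r i * r j * cos ((x i - x j) * t))"
  have Qsq: "Q t = (\<Sum>i\<in>C. r i * cos (x i * t))\<^sup>2 + (\<Sum>i\<in>C. r i * sin (x i * t))\<^sup>2" for t
    unfolding Q_def power2_eq_square sum_product sum.distrib[symmetric]
    by (intro sum.cong refl) (simp add: cos_diff algebra_simps)
  have Q0: "Q t \<ge> 0" for t unfolding Qsq by simp
  have Qle: "Q t \<le> real (card M) * N2" for t
  proof -
    have "Q t \<le> (\<Sum>i\<in>C. \<Sum>j\<in>C. r i * r j)"
      unfolding Q_def using r0 by (intro sum_mono mult_left_le) auto
    also have "\<dots> = (\<Sum>i\<in>C. r i)\<^sup>2" by (simp add: power2_eq_square sum_product)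
    also have "\<dots> \<le> (\<Sum>i\<in>C. 1\<^sup>2) * (\<Sum>i\<in>C. (r i)\<^sup>2)"
      using Cauchy_Schwarz_ineq_sum[of "\<lambda>_. 1" r C] by simp
    also have "\<dots> = real (card C) * N2" by (simp add: r2)
    also have "\<dots> \<le> real (card M) * N2" using N20 M by (intro mult_right_mono) (auto simp: C_def card_image_le)
    finally show ?thesis .
  qed
  have Qint: "has_bochner_integral lborel (\<lambda>t. \<Phi> t * Q t) (\<Sum>i\<in>C. \<Sum>j\<in>C. r i * r j * h (x i - x j))"
  proof -
    have "has_bochner_integral lborel (\<lambda>t. \<Sum>i\<in>C. \<Sum>j\<in>C. (r i * r j) * (\<Phi> t * cos ((x i - x j) * t))) (\<Sum>i\<in>C. \<Sum>j\<in>C. r i * r j * h (x i - x j))"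
      by (intro has_bochner_integral_sum has_bochner_integral_mult_right hc)
    then show ?thesis by (simp add: Q_def sum_distrib_left mult_ac)
  qed
  have Qint_le: "(LBINT t. \<Phi> t * Q t) \<le> sqrt (2*pi * \<tau>\<^sup>2) * (6 * N2)"
  proof -
    have hx: "h (x i - x j) = sqrt (2*pi * \<tau>\<^sup>2) * exp (- (real_of_int (i - j))\<^sup>2 / 2)" for i j
      using \<tau> by (simp add: h_def x_def power_divide flip: diff_divide_distrib)
    have "(\<Sum>i\<in>C. \<Sum>j\<in>C. r i * r j * h (x i - x j)) \<le> (\<Sum>i\<in>C. \<Sum>j\<in>C. ((r i)\<^sup>2 / 2 + (r j)\<^sup>2 / 2) * h (x i - x j))"
    proof (intro sum_mono mult_right_mono h0)
      fix i j show "r i * r j \<le> (r i)\<^sup>2 / 2 + (r j)\<^sup>2 / 2" using sum_squares_bound[of "r i" "r j"] by simp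
    qed
    also have "\<dots> = (\<Sum>i\<in>C. \<Sum>j\<in>C. (r i)\<^sup>2 / 2 * h (x i - x j)) + (\<Sum>i\<in>C. \<Sum>j\<in>C. (r j)\<^sup>2 / 2 * h (x i - x j))"
      by (simp only: distrib_right sum.distrib)
    also have "(\<Sum>i\<in>C. \<Sum>j\<in>C. (r j)\<^sup>2 / 2 * h (x i - x j)) = (\<Sum>i\<in>C. \<Sum>j\<in>C. (r i)\<^sup>2 / 2 * h (x i - x j))"
      by (subst sum.swap) (simp add: hx power2_commute)
    also have "(\<Sum>i\<in>C. \<Sum>j\<in>C. (r i)\<^sup>2 / 2 * h (x i - x j)) + (\<Sum>i\<in>C. \<Sum>j\<in>C. (r i)\<^sup>2 / 2 * h (x i - x j)) = (\<Sum>i\<in>C. (r i)\<^sup>2 * (sqrt (2*pi * \<tau>\<^sup>2) * (\<Sum>j\<in>C. exp (- (real_of_int (i - j))\<^sup>2 / 2))))"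
      by (simp add: hx sum_distrib_left flip: sum.distrib)
    also have "\<dots> \<le> (\<Sum>i\<in>C. (r i)\<^sup>2 * (sqrt (2*pi * \<tau>\<^sup>2) * 6))"
      by (intro sum_mono mult_left_mono gauss_lattice_sum C) auto
    also have "\<dots> = sqrt (2*pi * \<tau>\<^sup>2) * (6 * N2)" by (simp add: r2[symmetric] sum_distrib_left mult_ac)
    finally show ?thesis using Qint by (simp add: has_bochner_integral_iff)
  qed
  define A0 where "A0 = (\<Sum>n. a (Suc n))"
  define D where "D = (\<lambda>t. \<Sum>n. a (Suc n) * cos (t * ln (real (Suc n))))"
  have Dab: "\<bar>a (Suc n) * cos (t * ln (real (Suc n)))\<bar> \<le> a (Suc n)" for n t
    using a0[of "Suc n"] by (simp add: abs_mult mult_left_le)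
  have Dsum: "summable (\<lambda>n. a (Suc n) * cos (t * ln (real (Suc n))))" for t
    by (rule summable_comparison_test'[OF asum]) (use Dab in auto)
  have A00: "A0 \<ge> 0" unfolding A0_def by (intro suminf_nonneg asum a0)
  have DA: "D t \<le> A0" for t
    unfolding D_def A0_def by (intro suminf_le Dsum asum) (use Dab abs_le_D1 in blast)
  have Dev: "D (- t) = D t" for t by (simp add: D_def)
  have DV: "D t \<le> V" if "t0 \<le> \<bar>t\<bar>" "\<bar>t\<bar> \<le> t1" for t
  proof -
    have "D \<bar>t\<bar> \<le> V" unfolding D_def by (rule le[OF that])
    then show ?thesis using Dev[of t] by (cases "t \<ge> 0") auto
  qed
  \<comment> \<open>In the upper bound \<open>D \<le> V\<close> is used in the range where it is known; elsewhere \<open>D \<le> A0\<close> and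
    \<open>Q \<le> card M * N2\<close>, and the short length of the inner range and the decay of the Gaussian in the
    outer one make up for the loss.\<close>
  define G where "G = (\<lambda>n t. a (Suc n) * cos (t * ln (real (Suc n))) * (\<Phi> t * Q t))"
  define P where "P = (\<lambda>k. \<Sum>i\<in>C. \<Sum>j\<in>C. r i * r j * h (ln k + (x i - x j)))"
  have Gint: "has_bochner_integral lborel (G n) (a (Suc n) * P (real (Suc n)))" for n
  proof -
    let ?k = "ln (real (Suc n))"
    have "has_bochner_integral lborel (\<lambda>t. a (Suc n) * (\<Sum>i\<in>C. \<Sum>j\<in>C. (r i * r j) * ((\<Phi> t * cos ((?k + (x i - x j)) * t) + \<Phi> t * cos ((?k - (x i - x j)) * t)) / 2)))
        (a (Suc n) * (\<Sum>i\<in>C. \<Sum>j\<in>C. (r i * r j) * ((h (?k + (x i - x j)) + h (?k - (x i - x j))) / 2)))"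
      by (intro has_bochner_integral_mult_right has_bochner_integral_sum has_bochner_integral_divide_zero has_bochner_integral_add hc)
    also have "(\<lambda>t. a (Suc n) * (\<Sum>i\<in>C. \<Sum>j\<in>C. (r i * r j) * ((\<Phi> t * cos ((?k + (x i - x j)) * t) + \<Phi> t * cos ((?k - (x i - x j)) * t)) / 2))) = G n"
    proof
      fix t
      have "\<Phi> t * cos ((?k + (x i - x j)) * t) + \<Phi> t * cos ((?k - (x i - x j)) * t) = 2 * (\<Phi> t * cos (t * ?k) * cos ((x i - x j) * t))" for i j
        by (simp only: distrib_right left_diff_distrib cos_add cos_diff) (simp add: algebra_simps)
      then show "a (Suc n) * (\<Sum>i\<in>C. \<Sum>j\<in>C. (r i * r j) * ((\<Phi> t * cos ((?k + (x i - x j)) * t) + \<Phi> t * cos ((?k - (x i - x j)) * t)) / 2)) = G n t"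
        by (simp add: G_def Q_def sum_distrib_left mult_ac)
    qed
    also have "(\<Sum>i\<in>C. \<Sum>j\<in>C. (r i * r j) * ((h (?k + (x i - x j)) + h (?k - (x i - x j))) / 2)) = P (real (Suc n))"
    proof -
      have "(\<Sum>i\<in>C. \<Sum>j\<in>C. (r i * r j) * ((h (?k + (x i - x j)) + h (?k - (x i - x j))) / 2)) =
        P (real (Suc n)) / 2 + (\<Sum>i\<in>C. \<Sum>j\<in>C. r i * r j * h (?k - (x i - x j))) / 2"
        by (simp add: P_def distrib_left add_divide_distrib sum.distrib sum_divide_distrib)
      also have "(\<Sum>i\<in>C. \<Sum>j\<in>C. r i * r j * h (?k - (x i - x j))) = P (real (Suc n))"
        unfolding P_def by (subst sum.swap) (simp add: mult_ac algebra_simps)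
      finally show ?thesis by simp
    qed
    finally show ?thesis .
  qed
  have Qi: "integrable lborel (\<lambda>t. \<Phi> t * Q t)" using Qint by (auto simp: has_bochner_integral_iff)
  have \<Phi>Q0: "\<Phi> t * Q t \<ge> 0" for t using Q0 by (simp add: \<Phi>_def)
  have Gle: "norm (G n t) \<le> a (Suc n) * (\<Phi> t * Q t)" for n t
  proof -
    have "norm (G n t) = \<bar>a (Suc n) * cos (t * ln (real (Suc n)))\<bar> * (\<Phi> t * Q t)"
      by (simp only: G_def real_norm_def abs_mult[where b="\<Phi> t * Q t"] abs_of_nonneg[OF \<Phi>Q0])
    then show ?thesis using mult_right_mono[OF Dab \<Phi>Q0] by simp
  qed
  have sG: "summable (\<lambda>n. LBINT t. norm (G n t))"
  proof (rule summable_comparison_test'[OF summable_mult2[OF asum]])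
    fix n
    have "(LBINT t. norm (G n t)) \<le> (LBINT t. a (Suc n) * (\<Phi> t * Q t))"
      using Gint[of n] by (intro integral_mono Gle integrable_mult_right Qi integrable_norm) (auto simp: has_bochner_integral_iff)
    then show "norm (LBINT t. norm (G n t)) \<le> a (Suc n) * (LBINT t. \<Phi> t * Q t)" by simp
  qed
  have AEs: "AE t in lborel. summable (\<lambda>n. norm (G n t))"
    by (intro AE_I2 summable_comparison_test'[OF summable_mult2[OF asum]]) (use Gle in auto)
  have Gi: "integrable lborel (G n)" for n using Gint by (auto simp: has_bochner_integral_iff)
  have Gsum: "(\<lambda>n. a (Suc n) * P (real (Suc n))) sums (LBINT t. \<Sum>n. G n t)"
    using sums_integral[OF Gi AEs sG] Gint by (simp add: has_bochner_integral_iff)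
  have GD: "(\<Sum>n. G n t) = D t * (\<Phi> t * Q t)" for t
    unfolding G_def D_def by (rule suminf_mult2[OF Dsum, symmetric])
  have Gint': "integrable lborel (\<lambda>t. D t * (\<Phi> t * Q t))"
    using integrable_suminf[OF Gi AEs sG] unfolding GD .
  define E1 where "E1 = A0 * (real (card M) * N2)"
  have E10: "E1 \<ge> 0" using A00 N20 by (simp add: E1_def)
  define e where "e = exp (- t1\<^sup>2 / (4 * \<tau>\<^sup>2))"
  have pt: "D t * (\<Phi> t * Q t) \<le> V * (\<Phi> t * Q t) + (E1 * indicator {-t0..t0} t + (E1 * e) * gauss (2 * \<tau>\<^sup>2) t)" for t
  proof (cases "t0 \<le> \<bar>t\<bar> \<and> \<bar>t\<bar> \<le> t1")
    case True
    then have "D t * (\<Phi> t * Q t) \<le> V * (\<Phi> t * Q t)" using DV \<Phi>Q0 by (intro mult_right_mono) auto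
    then show ?thesis using E10 by (simp add: e_def add_increasing2)
  next
    case False
    have "D t * (\<Phi> t * Q t) \<le> A0 * (\<Phi> t * (real (card M) * N2))"
      by (rule mult_mono[OF DA mult_left_mono[OF Qle]]) (use A00 \<Phi>Q0 in \<open>auto simp: \<Phi>_def\<close>)
    then have 1: "D t * (\<Phi> t * Q t) \<le> E1 * \<Phi> t" by (simp add: E1_def mult_ac)
    have "\<Phi> t \<le> indicator {-t0..t0} t + e * gauss (2 * \<tau>\<^sup>2) t"
    proof (cases "\<bar>t\<bar> < t0")
      case True
      then have "indicator {-t0..t0} t = (1::real)" by (auto simp: indicator_def)
      moreover have "\<Phi> t \<le> 1" by (simp add: \<Phi>_def)
      moreover have "0 \<le> e * gauss (2 * \<tau>\<^sup>2) t" by (simp add: e_def)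
      ultimately show ?thesis by linarith
    next
      case F2: False
      then have "\<bar>t\<bar> \<ge> t1" using False by auto
      then have "t1\<^sup>2 \<le> t\<^sup>2" using t12 by (simp add: abs_le_square_iff[symmetric])
      then have "- t\<^sup>2 / (2 * \<tau>\<^sup>2) \<le> - t1\<^sup>2 / (4 * \<tau>\<^sup>2) + - t\<^sup>2 / (2 * (2 * \<tau>\<^sup>2))"
        using \<tau>2 by (simp add: field_simps)
      then have "\<Phi> t \<le> e * gauss (2 * \<tau>\<^sup>2) t" by (simp add: \<Phi>_def e_def flip: exp_add)
      then show ?thesis by (simp add: add_increasing indicator_def)
    qed
    then have "E1 * \<Phi> t \<le> E1 * (indicator {-t0..t0} t + e * gauss (2 * \<tau>\<^sup>2) t)"
      using E10 by (rule mult_left_mono)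
    then have "D t * (\<Phi> t * Q t) \<le> E1 * (indicator {-t0..t0} t + e * gauss (2 * \<tau>\<^sup>2) t)" using 1 by linarith
    moreover have "0 \<le> V * (\<Phi> t * Q t)" using V \<Phi>Q0 by simp
    ultimately show ?thesis by (simp add: distrib_left mult.assoc)
  qed
  have gi: "has_bochner_integral lborel (\<lambda>t. gauss (2 * \<tau>\<^sup>2) t) (sqrt (2*pi * (2 * \<tau>\<^sup>2)))"
    by (rule gauss_integral) (use \<tau>2 in simp)
  have ind: "has_bochner_integral lborel (\<lambda>t. indicator {-t0..t0} t) (2 * t0)"
    using has_bochner_integral_real_indicator[of "{-t0..t0}" lborel] t12 by simp
  have rhs: "has_bochner_integral lborel (\<lambda>t. V * (\<Phi> t * Q t) + (E1 * indicator {-t0..t0} t + (E1 * e) * gauss (2 * \<tau>\<^sup>2) t))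
     (V * (LBINT t. \<Phi> t * Q t) + (E1 * (2 * t0) + (E1 * e) * sqrt (2*pi * (2 * \<tau>\<^sup>2))))"
    by (intro has_bochner_integral_add has_bochner_integral_mult_right gi ind has_bochner_integral_integrable Qi)
  define s where "s = sqrt (2*pi * \<tau>\<^sup>2)"
  have s\<tau>: "s \<ge> \<tau>"
  proof -
    have "1 * \<tau>\<^sup>2 \<le> (2 * pi) * \<tau>\<^sup>2" using pi_gt3 by (intro mult_right_mono) auto
    then show ?thesis unfolding s_def using \<tau> by (intro real_le_rsqrt) simp
  qed
  have s0: "s > 0" using s\<tau> \<tau> by linarith
  have upper: "(LBINT t. D t * (\<Phi> t * Q t)) \<le> s * ((6 * V + A0 * real (card M) * (2 * t0 / \<tau> + 2 * e)) * N2)"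
  proof -
    have "(LBINT t. D t * (\<Phi> t * Q t)) \<le> V * (LBINT t. \<Phi> t * Q t) + (E1 * (2 * t0) + (E1 * e) * sqrt (2*pi * (2 * \<tau>\<^sup>2)))"
      using integral_mono[OF Gint' _ pt] rhs by (simp add: has_bochner_integral_iff)
    also have "\<dots> \<le> V * (s * (6 * N2)) + (E1 * (2 * t0 / \<tau> * s) + (E1 * e) * (2 * s))"
    proof (intro add_mono mult_left_mono)
      show "(LBINT t. \<Phi> t * Q t) \<le> s * (6 * N2)" using Qint_le by (simp add: s_def)
      have "2 * t0 / \<tau> * \<tau> \<le> 2 * t0 / \<tau> * s" by (rule mult_left_mono[OF s\<tau>]) (use t12 \<tau> in auto)
      then show "2 * t0 \<le> 2 * t0 / \<tau> * s" using \<tau> by simp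
      have "sqrt (2*pi * (2 * \<tau>\<^sup>2)) = sqrt 2 * s" by (simp add: s_def real_sqrt_mult)
      also have "\<dots> \<le> 2 * s" by (rule mult_right_mono) (use s0 sqrt2_less_2 in auto)
      finally show "sqrt (2*pi * (2 * \<tau>\<^sup>2)) \<le> 2 * s" .
    qed (use V E10 in \<open>auto simp: e_def\<close>)
    also have "\<dots> = s * ((6 * V + A0 * real (card M) * (2 * t0 / \<tau> + 2 * e)) * N2)"
      by (simp add: E1_def algebra_simps)
    finally show ?thesis .
  qed
  \<comment> \<open>In the lower bound every term of \<open>P k\<close> is nonnegative. For \<open>m = k n\<close> the cells of \<open>n\<close> and \<open>m\<close>
    satisfy \<open>\<bar>ln k + x i - x j\<bar> \<le> 1/\<tau>\<close>, so that the Gaussian costs only the factor \<open>exp(-1/2)\<close>, and for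
    fixed \<open>k\<close> the pairs form a matching, to which the Cauchy-Schwarz inequality applies cell by cell.\<close>
  define R where "R = {(n,m). n \<in> M \<and> m \<in> M \<and> n dvd m}"
  have R: "finite R" unfolding R_def by (rule finite_subset[of _ "M \<times> M"]) (use M in auto)
  define K where "K = (\<lambda>(n,m). m div n) ` R"
  have K: "finite K" using R by (simp add: K_def)
  have K1: "k \<ge> 1" if kK: "k \<in> K" for k
  proof -
    obtain n m where nm: "n dvd m" "m \<in> M" "k = m div n" using kK by (auto simp: K_def R_def)
    then have "m \<noteq> 0" using M(2) by metis
    then have "k \<noteq> 0" using nm by (simp add: dvd_div_eq_0_iff)
    then show ?thesis by simp
  qed
  have Pk: "P (real k) \<ge> (\<Sum>(n,m)\<in>{p\<in>R. (\<lambda>(n,m). m div n) p = k}. s * exp (-1/2) * (f n * f m))" if k: "k \<in> K" for k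
  proof -
    define Rk where "Rk = {p\<in>R. (\<lambda>(n,m). m div n) p = k}"
    have finRk: "finite Rk" using R by (simp add: Rk_def)
    have Rkm: "m = k * n" "n > 0" "n \<in> M" "m \<in> M" if "(n,m) \<in> Rk" for n m
      using that M(2) by (auto simp: Rk_def R_def intro!: gr0I)
    have k0: "k > 0" using K1[OF k] by simp
    have "(\<Sum>(n,m)\<in>Rk. s * exp (-1/2) * (f n * f m)) = (\<Sum>c\<in>C\<times>C. \<Sum>p\<in>{p\<in>Rk. (\<lambda>(n,m). (cell n, cell m)) p = c}. (\<lambda>(n,m). s * exp (-1/2) * (f n * f m)) p)"
    proof (rule sum.group[symmetric, OF finRk finite_cartesian_product[OF C C]])
      show "(\<lambda>(n,m). (cell n, cell m)) ` Rk \<subseteq> C \<times> C"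
      proof
        fix c assume "c \<in> (\<lambda>(n,m). (cell n, cell m)) ` Rk"
        then obtain n m where "(n, m) \<in> Rk" "c = (cell n, cell m)" by auto
        then show "c \<in> C \<times> C" using Rkm(3)[of n m] Rkm(4)[of n m] by (simp add: C_def)
      qed
    qed
    also have "\<dots> \<le> (\<Sum>c\<in>C\<times>C. (\<lambda>(i,j). r i * r j * h (ln k + (x i - x j))) c)"
    proof (rule sum_mono)
      fix c assume "c \<in> C \<times> C"
      obtain i j where c: "c = (i,j)" by force
      define B where "B = {p\<in>Rk. (\<lambda>(n,m). (cell n, cell m)) p = c}"
      have finB: "finite B" using finRk by (simp add: B_def)
      show "(\<Sum>p\<in>B. (\<lambda>(n,m). s * exp (-1/2) * (f n * f m)) p) \<le> (\<lambda>(i,j). r i * r j * h (ln k + (x i - x j))) c"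
      proof (cases "B = {}")
        case True then show ?thesis using r0 h0 by (simp add: c)
      next
        case False
        then obtain n m where nm: "(n,m) \<in> B" by auto
        then have nm': "(n,m) \<in> Rk" "cell n = i" "cell m = j" by (auto simp: B_def c)
        have "ln (real m) = ln (real k) + ln (real n)"
          using Rkm[OF nm'(1)] k0 by (simp add: ln_mult)
        then have "\<tau> * ln k + \<tau> * ln n = \<tau> * ln m" by (simp add: algebra_simps)
        moreover have "real_of_int i \<le> \<tau> * ln n" "\<tau> * ln n < real_of_int i + 1" "real_of_int j \<le> \<tau> * ln m" "\<tau> * ln m < real_of_int j + 1"
          using nm'(2,3) unfolding cell_def by (auto simp: floor_eq_iff)
        ultimately have "\<bar>\<tau> * ln k + (real_of_int i - real_of_int j)\<bar> \<le> 1" by linarith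
        then have "(\<tau> * ln k + (real_of_int i - real_of_int j))\<^sup>2 \<le> 1" by (simp add: abs_square_le_1)
        moreover have "\<tau>\<^sup>2 * (ln k + (x i - x j))\<^sup>2 = (\<tau> * ln k + (real_of_int i - real_of_int j))\<^sup>2"
        proof -
          have "\<tau> * (ln k + (x i - x j)) = \<tau> * ln k + (real_of_int i - real_of_int j)"
            using \<tau> by (simp add: x_def field_simps)
          then show ?thesis by (simp only: power_mult_distrib[symmetric])
        qed
        ultimately have "exp (-1/2) \<le> exp (- \<tau>\<^sup>2 * (ln k + (x i - x j))\<^sup>2 / 2)" by simp
        then have hl: "s * exp (-1/2) \<le> h (ln k + (x i - x j))"
          unfolding h_def s_def[symmetric] using s0 by (intro mult_left_mono) auto
        have "(\<Sum>p\<in>B. f (fst p) * f (snd p)) \<le> r i * r j"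
        proof -
          have "(\<Sum>p\<in>B. f (fst p) * f (snd p))\<^sup>2 \<le> (\<Sum>p\<in>B. (f (fst p))\<^sup>2) * (\<Sum>p\<in>B. (f (snd p))\<^sup>2)"
            by (rule Cauchy_Schwarz_ineq_sum)
          also have "\<dots> \<le> (r i)\<^sup>2 * (r j)\<^sup>2"
          proof (intro mult_mono)
            have Bm: "snd p = k * fst p" "fst p \<in> M" "snd p \<in> M" "cell (fst p) = i" "cell (snd p) = j" if "p \<in> B" for p
            proof -
              obtain n m where p: "p = (n, m)" by force
              with that have nm: "(n, m) \<in> Rk" "cell n = i" "cell m = j" by (auto simp: B_def c)
              show "snd p = k * fst p" "fst p \<in> M" "snd p \<in> M" "cell (fst p) = i" "cell (snd p) = j"
                using Rkm[OF nm(1)] nm by (simp_all add: p)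
            qed
            have i1: "inj_on fst B" by (intro inj_onI prod_eqI) (simp_all add: Bm)
            have i2: "inj_on snd B" using k0 by (intro inj_onI prod_eqI) (simp_all add: Bm)
            have "(\<Sum>p\<in>B. (f (fst p))\<^sup>2) = (\<Sum>m\<in>fst ` B. (f m)\<^sup>2)" using i1 by (simp add: sum.reindex)
            also have "\<dots> \<le> (\<Sum>m\<in>{m\<in>M. cell m = i}. (f m)\<^sup>2)"
              by (rule sum_mono2) (use M in \<open>simp, intro image_subsetI CollectI conjI Bm, simp_all\<close>)
            also have "\<dots> = (r i)\<^sup>2" unfolding r_def by (simp add: sum_nonneg)
            finally show "(\<Sum>p\<in>B. (f (fst p))\<^sup>2) \<le> (r i)\<^sup>2" .
            have "(\<Sum>p\<in>B. (f (snd p))\<^sup>2) = (\<Sum>m\<in>snd ` B. (f m)\<^sup>2)" using i2 by (simp add: sum.reindex)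
            also have "\<dots> \<le> (\<Sum>m\<in>{m\<in>M. cell m = j}. (f m)\<^sup>2)"
              by (rule sum_mono2) (use M in \<open>simp, intro image_subsetI CollectI conjI Bm, simp_all\<close>)
            also have "\<dots> = (r j)\<^sup>2" unfolding r_def by (simp add: sum_nonneg)
            finally show "(\<Sum>p\<in>B. (f (snd p))\<^sup>2) \<le> (r j)\<^sup>2" .
          qed (auto intro: sum_nonneg)
          finally have "(\<Sum>p\<in>B. f (fst p) * f (snd p))\<^sup>2 \<le> (r i * r j)\<^sup>2" by (simp add: power_mult_distrib)
          then show ?thesis by (rule power2_le_imp_le) (use r0 in simp)
        qed
        then have "(s * exp (-1/2)) * (\<Sum>p\<in>B. f (fst p) * f (snd p)) \<le> h (ln k + (x i - x j)) * (r i * r j)"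
          using hl s0 h0 f0 by (intro mult_mono) (auto intro!: sum_nonneg mult_nonneg_nonneg)
        then show ?thesis by (simp add: c sum_distrib_left case_prod_beta mult_ac)
      qed
    qed
    also have "\<dots> = P (real k)" by (simp add: P_def sum.cartesian_product)
    finally show ?thesis unfolding Rk_def .
  qed
  have lower: "s * (exp (-1/2) * (\<Sum>(n,m)\<in>R. a (m div n) * f n * f m)) \<le> (LBINT t. D t * (\<Phi> t * Q t))"
  proof -
    have "s * (exp (-1/2) * (\<Sum>(n,m)\<in>R. a (m div n) * f n * f m)) = (\<Sum>p\<in>R. (\<lambda>(n,m). a (m div n) * (s * exp (-1/2) * (f n * f m))) p)"
      by (simp add: sum_distrib_left case_prod_beta mult_ac)
    also have "\<dots> = (\<Sum>k\<in>K. \<Sum>p\<in>{p\<in>R. (\<lambda>(n,m). m div n) p = k}. (\<lambda>(n,m). a (m div n) * (s * exp (-1/2) * (f n * f m))) p)"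
      unfolding K_def by (rule sum.image_gen[OF R])
    also have "\<dots> = (\<Sum>k\<in>K. a k * (\<Sum>(n,m)\<in>{p\<in>R. (\<lambda>(n,m). m div n) p = k}. (s * exp (-1/2) * (f n * f m))))"
      unfolding sum_distrib_left by (intro sum.cong refl) auto
    also have "\<dots> \<le> (\<Sum>k\<in>K. a k * P (real k))" by (intro sum_mono mult_left_mono Pk a0)
    also have "\<dots> = (\<Sum>n\<in>(\<lambda>k. k - 1) ` K. a (Suc n) * P (real (Suc n)))"
    proof -
      have "inj_on (\<lambda>k. k - 1) K" 
      proof (rule inj_onI)
        fix p q assume "p \<in> K" "q \<in> K" "p - 1 = q - 1"
        then show "p = q" using K1[of p] K1[of q] by linarith
      qed
      then have "(\<Sum>n\<in>(\<lambda>k. k - 1) ` K. a (Suc n) * P (real (Suc n))) = (\<Sum>k\<in>K. a (Suc (k - 1)) * P (real (Suc (k - 1))))"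
        by (simp only: sum.reindex o_def)
      also have "\<dots> = (\<Sum>k\<in>K. a k * P (real k))"
      proof (intro sum.cong refl)
        fix k assume "k \<in> K"
        then have "Suc (k - 1) = k" using K1[of k] by simp
        then show "a (Suc (k - 1)) * P (real (Suc (k - 1))) = a k * P (real k)" by simp
      qed
      finally show ?thesis by simp
    qed
    also have "\<dots> \<le> (\<Sum>n. a (Suc n) * P (real (Suc n)))"
      using K Gsum a0 r0 h0 by (intro sum_le_suminf) (auto simp: sums_iff P_def intro!: mult_nonneg_nonneg sum_nonneg)
    also have "\<dots> = (LBINT t. D t * (\<Phi> t * Q t))" using Gsum unfolding GD by (simp add: sums_iff)
    finally show ?thesis .
  qed
  have "s * (exp (-1/2) * (\<Sum>(n,m)\<in>R. a (m div n) * f n * f m)) \<le> s * ((6 * V + A0 * real (card M) * (2 * t0 / \<tau> + 2 * e)) * N2)"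
    by (rule order_trans[OF lower upper])
  then have "exp (-1/2) * (\<Sum>(n,m)\<in>R. a (m div n) * f n * f m) \<le> (6 * V + A0 * real (card M) * (2 * t0 / \<tau> + 2 * e)) * N2"
    by (rule mult_left_le_imp_le[OF _ s0])
  then show ?thesis unfolding R_def A0_def N2_def e_def .
qed

section \<open>Mertens' theorem on intervals\<close>

lemma real_div_bounds:
  fixes n d :: nat
  shows "real (n div d) \<le> real n / real d" "real n / real d - 1 \<le> real (n div d)"
proof -
  have "real (n div d) = of_int \<lfloor>real n / real d\<rfloor>" by (simp add: floor_divide_of_nat_eq)
  then show "real (n div d) \<le> real n / real d" "real n / real d - 1 \<le> real (n div d)" by linarith+
qed

text \<open>
  Sum \<open>ln m = (\<Sum>d | d dvd m. mangoldt d)\<close> over \<open>m \<le> n\<close> and count the multiples of each \<open>d\<close>.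
\<close>
lemma ln_fact_mangoldt:
  "ln (fact n :: real) = (\<Sum>d=1..n. mangoldt d * real (n div d))"
proof -
  have "ln (fact n :: real) = (\<Sum>m=1..n. ln (real m))"
    unfolding fact_prod of_nat_prod by (rule ln_prod) auto
  also have "\<dots> = (\<Sum>m=1..n. \<Sum>d | d dvd m. mangoldt d)"
    by (intro sum.cong refl) (simp add: mangoldt_sum)
  also have "\<dots> = (\<Sum>m=1..n. \<Sum>d\<in>{d\<in>{1..n}. d dvd m}. mangoldt d)"
    by (intro sum.cong refl) (auto dest: dvd_imp_le intro!: Suc_leI gr0I)
  also have "\<dots> = (\<Sum>d=1..n. \<Sum>m\<in>{m\<in>{1..n}. d dvd m}. mangoldt d)"
    by (rule sum.swap_restrict) auto
  also have "\<dots> = (\<Sum>d=1..n. mangoldt d * real (n div d))"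
  proof (intro sum.cong refl)
    fix d assume d: "d \<in> {1..n}"
    have "bij_betw (\<lambda>k. k * d) {1..n div d} {m\<in>{1..n}. d dvd m}"
      using d by (intro bij_betwI[where g="\<lambda>m. m div d"])
        (auto simp: less_eq_div_iff_mult_less_eq div_le_mono dvd_imp_le Suc_le_eq mult.commute elim!: dvdE)
    from bij_betw_same_card[OF this] show "(\<Sum>m\<in>{m\<in>{1..n}. d dvd m}. mangoldt d) = mangoldt d * real (n div d)"
      by simp
  qed
  finally show ?thesis .
qed

definition chebyshev_theta :: "nat \<Rightarrow> real" where
  "chebyshev_theta n = (\<Sum>p | prime p \<and> p \<le> n. ln (real p))"

lemma finite_primes_le: "finite {p::nat. prime p \<and> p \<le> n}" by simp

text \<open>
  Every prime in \<open>(m, 2m]\<close> divides the central binomial coefficient \<open>2m choose m \<le> 4^m\<close>. In terms of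
  \<open>ln_fact_mangoldt\<close>, its logarithm is a sum of nonnegative terms that contains \<open>ln p\<close> for these primes.
\<close>
lemma chebyshev_theta_double:
  "chebyshev_theta (2 * m) \<le> chebyshev_theta m + 2 * real m * ln 2"
proof -
  let ?A = "{p. prime p \<and> m < p \<and> p \<le> 2 * m}"
  have "{p. prime p \<and> p \<le> 2 * m} = {p. prime p \<and> p \<le> m} \<union> ?A" by auto
  moreover have "finite ?A" by simp
  ultimately have "chebyshev_theta (2 * m) = chebyshev_theta m + (\<Sum>p\<in>?A. ln (real p))"
    unfolding chebyshev_theta_def by (subst sum.union_disjoint[symmetric]) auto
  also have "(\<Sum>p\<in>?A. ln (real p)) \<le> (\<Sum>d=1..2*m. mangoldt d * (real (2 * m div d) - 2 * real (m div d)))"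
  proof -
    have "(\<Sum>p\<in>?A. ln (real p)) = (\<Sum>d\<in>?A. mangoldt d * (real (2 * m div d) - 2 * real (m div d)))"
    proof (intro sum.cong refl)
      fix p assume p: "p \<in> ?A"
      then have "2 * m div p = 1" by (intro div_nat_eqI) auto
      then show "ln (real p) = mangoldt p * (real (2 * m div p) - 2 * real (m div p))" using p by simp
    qed
    also have "\<dots> \<le> (\<Sum>d=1..2*m. mangoldt d * (real (2 * m div d) - 2 * real (m div d)))"
    proof (rule sum_mono2)
      fix d
      have "2 * (m div d) \<le> 2 * m div d" 
      proof (cases "d = 0")
        case False
        have "2 * (m div d) * d \<le> 2 * m" using div_times_less_eq_dividend[of m d] by simp
        then show ?thesis using False by (simp add: less_eq_div_iff_mult_less_eq)
      qed simp
      then have "2 * real (m div d) \<le> real (2 * m div d)" by linarith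
      then show "0 \<le> mangoldt d * (real (2 * m div d) - 2 * real (m div d))" by (simp add: mangoldt_nonneg)
    qed (use prime_ge_1_nat in auto)
    finally show ?thesis .
  qed
  also have "\<dots> = (\<Sum>d=1..2*m. mangoldt d * real (2 * m div d)) - 2 * (\<Sum>d=1..2*m. mangoldt d * real (m div d))"
    by (simp add: right_diff_distrib sum_subtractf sum_distrib_left mult_ac)
  also have "(\<Sum>d=1..2*m. mangoldt d * real (m div d)) = (\<Sum>d=1..m. mangoldt d * real (m div d))"
    by (rule sum.mono_neutral_right) auto
  also have "(\<Sum>d=1..2*m. mangoldt d * real (2 * m div d)) - 2 * (\<Sum>d=1..m. mangoldt d * real (m div d)) = ln (fact (2 * m)) - 2 * ln (fact m :: real)"
    by (simp only: ln_fact_mangoldt)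
  also have "\<dots> = ln (real ((2 * m) choose m))"
  proof -
    have "real ((2 * m) choose m) = fact (2 * m) / (fact m * fact m)"
      by (simp add: binomial_fact)
    then show ?thesis by (simp add: ln_div ln_mult)
  qed
  also have "\<dots> \<le> ln (2 ^ (2 * m))"
  proof -
    have "(2 * m) choose m \<le> 2 ^ (2 * m)" by (rule binomial_le_pow2)
    then have "real ((2 * m) choose m) \<le> real (2 ^ (2 * m))" by (rule of_nat_mono)
    then have "real ((2 * m) choose m) \<le> 2 ^ (2 * m)" by simp
    moreover have "0 < real ((2 * m) choose m)" by (simp add: zero_less_binomial_iff)
    ultimately show ?thesis by simp
  qed
  also have "\<dots> = 2 * real m * ln 2" by (simp add: ln_realpow)
  finally show ?thesis by simp
qed

lemma chebyshev_theta_le: "chebyshev_theta n \<le> 6 * ln 2 * real n"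
proof (induction n rule: less_induct)
  case (less n)
  show ?case
  proof (cases "n < 2")
    case True
    then have "{p. prime p \<and> p \<le> n} = {}" by (auto dest: prime_ge_2_nat)
    then show ?thesis unfolding chebyshev_theta_def by (simp only: sum.empty) simp
  next
    case False
    define m where "m = (n + 1) div 2"
    have m: "m < n" "n \<le> 2 * m" "2 * m \<le> n + 1" using False by (auto simp: m_def)
    have "chebyshev_theta n \<le> chebyshev_theta (2 * m)"
      unfolding chebyshev_theta_def
    proof (rule sum_mono2)
      fix p assume "p \<in> {p. prime p \<and> p \<le> 2 * m} - {p. prime p \<and> p \<le> n}"
      then have "1 \<le> p" by (auto dest: prime_ge_1_nat)
      then show "0 \<le> ln (real p)" by simp
    qed (use m in auto)
    also have "\<dots> \<le> chebyshev_theta m + 2 * real m * ln 2" by (rule chebyshev_theta_double)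
    also have "\<dots> \<le> 6 * ln 2 * real m + 2 * real m * ln 2" using less[OF m(1)] by linarith
    also have "\<dots> = ln 2 * (8 * real m)" by simp
    also have "\<dots> \<le> ln 2 * (6 * real n)" using m False by (intro mult_left_mono) auto
    finally show ?thesis by simp
  qed
qed

definition mertens_sum :: "nat \<Rightarrow> real" where
  "mertens_sum n = (\<Sum>p | prime p \<and> p \<le> n. ln (real p) / real p)"

text \<open>
  In \<open>ln (n!) \<ge> (\<Sum>p\<le>n. ln p * (n div p))\<close> replacing \<open>n div p\<close> by \<open>n/p\<close> costs at most Chebyshev's function
  \<open>\<theta>(n) = O(n)\<close>.
\<close>
lemma mertens_upper:
  assumes "n \<ge> 1"
  shows "mertens_sum n \<le> ln (real n) + 6 * ln 2"
proof -
  let ?A = "{p. prime p \<and> p \<le> n}"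
  have "real n * mertens_sum n - chebyshev_theta n = (\<Sum>p\<in>?A. ln (real p) * (real n / real p - 1))"
    unfolding mertens_sum_def chebyshev_theta_def by (simp add: sum_distrib_left sum_subtractf[symmetric] algebra_simps)
  also have "\<dots> \<le> (\<Sum>p\<in>?A. mangoldt p * real (n div p))"
  proof (rule sum_mono)
    fix p assume p: "p \<in> ?A"
    then have p0: "p > 0" by (auto simp: prime_gt_0_nat)
    have "real n / real p - 1 \<le> real (n div p)"
      by (rule real_div_bounds)
    moreover have "ln (real p) \<ge> 0" using p0 by simp
    ultimately show "ln (real p) * (real n / real p - 1) \<le> mangoldt p * real (n div p)"
      using p by (simp add: mult_left_mono)
  qed
  also have "\<dots> \<le> (\<Sum>d=1..n. mangoldt d * real (n div d))"
    by (rule sum_mono2) (use prime_ge_1_nat mangoldt_nonneg in \<open>auto intro!: mult_nonneg_nonneg\<close>)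
  also have "\<dots> = ln (fact n)" by (rule ln_fact_mangoldt[symmetric])
  also have "\<dots> \<le> real n * ln (real n)"
  proof -
    have "(fact n :: real) \<le> real n ^ n" using fact_le_power[of n, where ?'a=real] by simp
    then have "ln (fact n :: real) \<le> ln (real n ^ n)" using assms by (subst ln_le_cancel_iff) auto
    then show ?thesis using assms by (simp add: ln_realpow)
  qed
  finally have "real n * mertens_sum n \<le> real n * (ln (real n) + 6 * ln 2)"
    using chebyshev_theta_le[of n] by (simp add: algebra_simps)
  then show ?thesis using assms by simp
qed

lemma ln_fact_ge:
  assumes "n \<ge> 1"
  shows "ln (fact n :: real) \<ge> real n * ln (real n) - real n"
proof -
  have "real n ^ n \<le> exp (real n) * fact n" using power_le_fact_exp[of "real n" n] by (simp add: mult.commute)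
  then have "ln (real n ^ n) \<le> ln (exp (real n) * fact n)" using assms by (subst ln_le_cancel_iff) auto
  then show ?thesis using assms by (simp add: ln_realpow ln_mult)
qed

text \<open>
  By \<open>ln (n!) \<ge> n ln n - n\<close> the sum of \<open>mangoldt d / d\<close> over \<open>d \<le> n\<close> is at least \<open>ln n - 1\<close>. The prime powers
  that are not prime contribute only a bounded amount, since \<open>\<Sum> ln p / p\<^sup>2\<close> converges.
\<close>
lemma mertens_lower:
  obtains C where "\<And>n. n \<ge> 1 \<Longrightarrow> mertens_sum n \<ge> ln (real n) - C"
proof -
  have sumln: "summable (\<lambda>n. 2 * ln (real n) / (real n)^2)"
  proof (rule summable_comparison_test_bigo)
    show "summable (\<lambda>n. norm (real n powr (-3/2)))" by (simp add: summable_real_powr_iff)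
    show "(\<lambda>n. 2 * ln (real n) / (real n)^2) \<in> O(\<lambda>n. real n powr (-3/2))"
      by real_asymp
  qed
  define C where "C = (\<Sum>n. 2 * ln (real n) / (real n)^2)"
  show ?thesis
  proof (rule that[of "1 + C"])
    fix n :: nat assume n: "n \<ge> 1"
    let ?P = "{p. prime p \<and> p \<le> n}"
    define B where "B = {d\<in>{1..n}. primepow d \<and> \<not> prime d}"
    have "real n * ln (real n) - real n \<le> (\<Sum>d=1..n. mangoldt d * real (n div d))"
      using ln_fact_ge[OF n] by (simp only: ln_fact_mangoldt)
    also have "\<dots> \<le> (\<Sum>d=1..n. mangoldt d * (real n / real d))"
      by (intro sum_mono mult_left_mono mangoldt_nonneg real_div_bounds)
    also have "\<dots> = real n * (\<Sum>d=1..n. mangoldt d / real d)" by (simp add: sum_distrib_left mult_ac)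
    finally have "real n * (ln (real n) - 1) \<le> real n * (\<Sum>d=1..n. mangoldt d / real d)" by (simp add: algebra_simps)
    then have 1: "ln (real n) - 1 \<le> (\<Sum>d=1..n. mangoldt d / real d)" using n by simp
    have "(\<Sum>d=1..n. mangoldt d / real d) = (\<Sum>d\<in>?P \<union> B. mangoldt d / real d)"
      by (rule sum.mono_neutral_right) (auto simp: B_def mangoldt_def prime_ge_1_nat Suc_le_eq prime_gt_0_nat)
    also have "\<dots> = (\<Sum>d\<in>?P. mangoldt d / real d) + (\<Sum>d\<in>B. mangoldt d / real d)"
      by (rule sum.union_disjoint) (auto simp: B_def)
    also have "(\<Sum>d\<in>?P. mangoldt d / real d) = mertens_sum n"
      unfolding mertens_sum_def by (intro sum.cong refl) auto
    also have "(\<Sum>d\<in>B. mangoldt d / real d) \<le> C"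
    proof -
      have fB: "finite B" by (simp add: B_def)
      have B: "\<exists>p k. prime p \<and> 2 \<le> k \<and> k \<le> n \<and> p \<le> n \<and> d = p ^ k" if "d \<in> B" for d
      proof -
        from that obtain p k where pk: "prime p" "k > 0" "d = p ^ k" "\<not> prime d" "d \<le> n" by (auto simp: B_def primepow_def)
        have "k \<noteq> 1" using pk by auto
        then have "k \<ge> 2" using pk by simp
        moreover have "k < p ^ k" using prime_gt_1_nat[OF pk(1)] by (simp add: power_gt_expt)
        moreover have "p ^ 1 \<le> p ^ k" using pk prime_gt_0_nat[OF pk(1)] by (intro power_increasing) auto
        ultimately show ?thesis using pk by (intro exI[of _ p] exI[of _ k]) auto
      qed
      let ?S = "{p. prime p \<and> p \<le> n} \<times> {2..n}"
      have "B \<subseteq> (\<lambda>(p,k). p ^ k) ` ?S"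
      proof
        fix d assume "d \<in> B"
        then obtain p k where pk: "prime p" "2 \<le> k" "k \<le> n" "p \<le> n" "d = p ^ k" using B by blast
        then have "(p, k) \<in> ?S" by simp
        then show "d \<in> (\<lambda>(p,k). p ^ k) ` ?S" using pk(5) by (intro image_eqI[of _ _ "(p,k)"]) auto
      qed
      then have "(\<Sum>d\<in>B. mangoldt d / real d) \<le> (\<Sum>d\<in>(\<lambda>(p,k). p ^ k) ` ?S. mangoldt d / real d :: real)"
        by (intro sum_mono2) (auto simp: mangoldt_nonneg)
      also have "\<dots> \<le> (\<Sum>x\<in>?S. ((\<lambda>d. mangoldt d / real d) \<circ> (\<lambda>(p,k). p ^ k)) x)"
        by (rule sum_image_le) (auto simp: mangoldt_nonneg)
      also have "\<dots> = (\<Sum>(p,k)\<in>?S. ln (real p) * (1 / real p) ^ k)"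
        by (intro sum.cong refl) (auto simp: power_one_over)
      also have "\<dots> = (\<Sum>p | prime p \<and> p \<le> n. \<Sum>k=2..n. ln (real p) * (1 / real p) ^ k)"
        by (simp add: sum.cartesian_product)
      also have "\<dots> \<le> (\<Sum>p | prime p \<and> p \<le> n. 2 * ln (real p) / (real p)^2)"
      proof (rule sum_mono)
        fix p assume p: "p \<in> ?P"
        then have p2: "real p \<ge> 2" using prime_ge_2_nat by fastforce
        define x where "x = 1 / real p"
        have x: "0 < x" "x \<le> 1/2" using p2 by (auto simp: x_def field_simps)
        have "(\<Sum>k=2..n. x ^ k) \<le> x\<^sup>2 * (\<Sum>k. x ^ k)"
        proof -
          have "(\<Sum>k=2..n. x ^ k) \<le> (\<Sum>k\<in>(\<lambda>i. i + 2) ` {..n}. x ^ k)"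
          proof (rule sum_mono2)
            show "{2..n} \<subseteq> (\<lambda>i. i + 2) ` {..n}"
            proof
              fix k assume "k \<in> {2..n}"
              then have "k = (k - 2) + 2" "k - 2 \<in> {..n}" by auto
              then show "k \<in> (\<lambda>i. i + 2) ` {..n}" by blast
            qed
          qed (use x in auto)
          also have "\<dots> = x\<^sup>2 * (\<Sum>i\<le>n. x ^ i)" by (subst sum.reindex) (auto simp: inj_on_def power_add sum_distrib_left mult_ac power2_eq_square)
          also have "\<dots> \<le> x\<^sup>2 * (\<Sum>k. x ^ k)"
            using x by (intro mult_left_mono sum_le_suminf summable_geometric) auto
          finally show ?thesis .
        qed
        also have "(\<Sum>k. x ^ k) = 1 / (1 - x)" using x by (intro suminf_geometric) auto
        also have "x\<^sup>2 * (1 / (1 - x)) \<le> x\<^sup>2 * (1 / (1/2))" using x by (intro mult_left_mono divide_left_mono) auto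
        finally have "(\<Sum>k=2..n. x ^ k) \<le> 2 * x\<^sup>2" by simp
        then have "ln (real p) * (\<Sum>k=2..n. x ^ k) \<le> ln (real p) * (2 * x\<^sup>2)" using p2 by (intro mult_left_mono) auto
        then show "(\<Sum>k=2..n. ln (real p) * (1 / real p) ^ k) \<le> 2 * ln (real p) / (real p)^2"
          by (simp add: sum_distrib_left x_def power_one_over field_simps)
      qed
      also have "\<dots> \<le> C" unfolding C_def
      proof (rule sum_le_suminf[OF sumln])
        show "0 \<le> 2 * ln (real n) / (real n)\<^sup>2" for n by (cases "n = 0") auto
      qed simp
      finally show ?thesis .
    qed
    finally show "ln (real n) - (1 + C) \<le> mertens_sum n" using 1 by simp
  qed
qed

lemma mertens_interval:
  obtains C :: real where "C > 0"
    "\<And>x A. x \<ge> 2 \<Longrightarrow> A \<ge> 0 \<Longrightarrow> (\<Sum>p | prime p \<and> x < real p \<and> real p \<le> exp A * x. ln (real p) / real p) \<ge> A - C"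
proof -
  obtain C1 where C1: "\<And>n. n \<ge> 1 \<Longrightarrow> mertens_sum n \<ge> ln (real n) - C1" by (rule mertens_lower) blast
  define C where "C = max 1 (C1 + 6 * ln 2 + ln 2)"
  show ?thesis
  proof (rule that[of C])
    show "C > 0" by (simp add: C_def)
    fix x A :: real assume x: "x \<ge> 2" and A: "A \<ge> 0"
    define n where "n = nat \<lfloor>x\<rfloor>"
    define m where "m = nat \<lfloor>exp A * x\<rfloor>"
    have "1 * x \<le> exp A * x" using A x by (intro mult_right_mono) auto
    then have xm: "x \<le> exp A * x" by simp
    have n1: "n \<ge> 1" "real n \<le> x" using x by (auto simp: n_def le_nat_iff) 
    have ge1: "1 \<le> exp A * x" using x xm by linarith
    then have "real m = of_int \<lfloor>exp A * x\<rfloor>" by (simp add: m_def)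
    then have m1: "m \<ge> 1" "real m > exp A * x - 1" using ge1 by (auto simp: m_def le_nat_iff)
    have nm: "n \<le> m" unfolding n_def m_def using xm by (intro nat_mono floor_mono)
    have eq: "{p. prime p \<and> p \<le> m} = {p. prime p \<and> p \<le> n} \<union> {p. prime p \<and> x < real p \<and> real p \<le> exp A * x}"
    proof -
      have "p \<le> n \<longleftrightarrow> real p \<le> x" for p using x by (simp add: n_def le_nat_iff le_floor_iff)
      moreover have "p \<le> m \<longleftrightarrow> real p \<le> exp A * x" for p using x xm by (simp add: m_def le_nat_iff le_floor_iff)
      ultimately show ?thesis using xm by auto
    qed
    have disj: "{p. prime p \<and> p \<le> n} \<inter> {p. prime p \<and> x < real p \<and> real p \<le> exp A * x} = {}" using n1 by force
    have fin: "finite {p. prime p \<and> x < real p \<and> real p \<le> exp A * x}"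
      by (rule finite_subset[OF _ finite_primes_le[of m]]) (subst eq, rule Un_upper2)
    have "mertens_sum m = mertens_sum n + (\<Sum>p | prime p \<and> x < real p \<and> real p \<le> exp A * x. ln (real p) / real p)"
      unfolding mertens_sum_def eq by (rule sum.union_disjoint) (use fin disj in auto)
    moreover have "mertens_sum n \<le> ln x + 6 * ln 2"
    proof -
      have "ln (real n) \<le> ln x" using n1 x by (subst ln_le_cancel_iff) auto
      then show ?thesis using mertens_upper[OF n1(1)] by linarith
    qed
    moreover have "ln (real m) \<ge> A + ln x - ln 2"
    proof -
      have "exp A * x / 2 \<le> real m" using m1(2) xm x by linarith
      then have "ln (exp A * x / 2) \<le> ln (real m)" using x m1 by (subst ln_le_cancel_iff) auto
      then show ?thesis using x by (simp add: ln_div ln_mult)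
    qed
    ultimately show "A - C \<le> (\<Sum>p | prime p \<and> x < real p \<and> real p \<le> exp A * x. ln (real p) / real p)"
      using C1[OF m1(1)] by (simp add: C_def)
  qed
qed

section \<open>Resonators with a fixed number of primes in each block\<close>

text \<open>
  The elementary symmetric polynomial of degree \<open>w\<close> in the reciprocals of the elements of \<open>P\<close>.
\<close>
definition esym :: "nat set \<Rightarrow> nat \<Rightarrow> real" where
  "esym P w = (\<Sum>S\<in>{S. S \<subseteq> P \<and> card S = w}. \<Prod>p\<in>S. 1 / real p)"

lemma finite_subsets_card: "finite P \<Longrightarrow> finite {S. S \<subseteq> P \<and> card S = w}"
  by (rule finite_subset[of _ "Pow P"]) auto

text \<open>
  Count the pairs of a set \<open>S\<close> with \<open>w + 1\<close> elements and \<open>p \<in> S\<close> through \<open>S - {p}\<close>: given that set, \<open>p\<close>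
  runs over its complement in \<open>P\<close>, which misses \<open>w\<close> reciprocals of size at most \<open>1/y\<close>.
\<close>
lemma esym_step:
  assumes P: "finite P" "\<And>p. p \<in> P \<Longrightarrow> p > 0" and y: "y > 0" "\<And>p. p \<in> P \<Longrightarrow> y \<le> real p"
  shows "real (Suc w) * esym P (Suc w) \<ge> ((\<Sum>p\<in>P. 1 / real p) - real w / y) * esym P w"
proof -
  let ?x = "\<lambda>S. \<Prod>p\<in>S. 1 / real p" and ?L = "\<lambda>w. {S. S \<subseteq> P \<and> card S = w}"
  have x0: "?x S \<ge> 0" for S by (intro prod_nonneg) auto
  note fin = finite_subsets_card[OF P(1)]
  have finS: "finite S" if "S \<subseteq> P" for S using P that finite_subset by blast
  have "real (Suc w) * esym P (Suc w) = (\<Sum>S\<in>?L (Suc w). \<Sum>p\<in>S. ?x S)"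
    unfolding esym_def by (simp add: sum_distrib_left)
  also have "\<dots> = (\<Sum>(S,p)\<in>Sigma (?L (Suc w)) (\<lambda>S. S). ?x S)"
    by (rule sum.Sigma) (use fin finS in auto)
  also have "\<dots> = (\<Sum>(S,p)\<in>Sigma (?L w) (\<lambda>S. P - S). ?x S * (1 / real p))"
  proof (rule sum.reindex_bij_witness[where i="\<lambda>(S,p). (insert p S, p)" and j="\<lambda>(S,p). (S - {p}, p)"])
    fix a assume a: "a \<in> Sigma (?L (Suc w)) (\<lambda>S. S)"
    obtain S p where [simp]: "a = (S, p)" by force
    have S: "S \<subseteq> P" "card S = Suc w" "p \<in> S" using a by auto
    show "(case case a of (S, p) \<Rightarrow> (S - {p}, p) of (S, p) \<Rightarrow> (insert p S, p)) = a" using S by auto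
    show "(case a of (S, p) \<Rightarrow> (S - {p}, p)) \<in> Sigma (?L w) (\<lambda>S. P - S)" using S finS by auto
    show "(case case a of (S, p) \<Rightarrow> (S - {p}, p) of (S, p) \<Rightarrow> ?x S * (1 / real p)) = (case a of (S, p) \<Rightarrow> ?x S)"
      using S finS[of S] by (simp add: prod.remove[of S p])
  next
    fix b assume b: "b \<in> Sigma (?L w) (\<lambda>S. P - S)"
    obtain S p where [simp]: "b = (S, p)" by force
    have S: "S \<subseteq> P" "card S = w" "p \<in> P" "p \<notin> S" using b by auto
    show "(case case b of (S, p) \<Rightarrow> (insert p S, p) of (S, p) \<Rightarrow> (S - {p}, p)) = b" using S by auto
    show "(case b of (S, p) \<Rightarrow> (insert p S, p)) \<in> Sigma (?L (Suc w)) (\<lambda>S. S)" using S finS[of S] by auto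
  qed
  also have "\<dots> = (\<Sum>S\<in>?L w. \<Sum>p\<in>P - S. ?x S * (1 / real p))"
    by (rule sum.Sigma[symmetric]) (use fin P in auto)
  also have "\<dots> = (\<Sum>S\<in>?L w. ?x S * (\<Sum>p\<in>P - S. 1 / real p))"
    by (simp only: sum_distrib_left)
  also have "\<dots> \<ge> (\<Sum>S\<in>?L w. ?x S * ((\<Sum>p\<in>P. 1 / real p) - real w / y))"
  proof (intro sum_mono mult_left_mono x0)
    fix S assume S: "S \<in> ?L w"
    have "(\<Sum>p\<in>S. 1 / real p) \<le> (\<Sum>p\<in>S. 1 / y)"
      using S y P by (intro sum_mono divide_left_mono mult_pos_pos) (auto simp: subset_iff)
    then have "(\<Sum>p\<in>S. 1 / real p) \<le> real w / y" using S by simp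
    moreover have "(\<Sum>p\<in>P - S. 1 / real p) = (\<Sum>p\<in>P. 1 / real p) - (\<Sum>p\<in>S. 1 / real p)"
      using S P by (intro sum_diff) auto
    ultimately show "(\<Sum>p\<in>P. 1 / real p) - real w / y \<le> (\<Sum>p\<in>P - S. 1 / real p)" by simp
  qed
  finally show ?thesis unfolding esym_def by (simp add: sum_distrib_left mult.commute)
qed

lemma esym_pos:
  assumes "finite P" "\<And>p. p \<in> P \<Longrightarrow> p > 0" "w \<le> card P"
  shows "esym P w > 0"
proof -
  obtain S where S: "S \<subseteq> P" "card S = w" using obtain_subset_with_card_n[OF assms(3)] by metis
  have "(\<Prod>p\<in>S. 1 / real p) > 0" using S assms(2) by (intro prod_pos) auto
  also have "(\<Prod>p\<in>S. 1 / real p) \<le> esym P w"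
    unfolding esym_def using S by (intro member_le_sum[where f="\<lambda>S. \<Prod>p\<in>S. 1 / real p"] finite_subsets_card assms(1)) (auto intro!: prod_nonneg)
  finally show ?thesis .
qed

lemma esym_ratio:
  assumes P: "finite P" "\<And>p. p \<in> P \<Longrightarrow> p > 0" and y: "y > 0" "\<And>p. p \<in> P \<Longrightarrow> y \<le> real p"
    and E: "E \<ge> 0" "E \<le> (\<Sum>p\<in>P. 1 / real p) - real w / y" and s: "s \<le> w"
  shows "fact w * esym P w \<ge> E ^ s * (fact (w - s) * esym P (w - s))"
  using s
proof (induction s)
  case (Suc s)
  define v where "v = w - Suc s"
  have v: "w - s = Suc v" "v \<le> w" using Suc.prems by (auto simp: v_def)
  have e0: "esym P v \<ge> 0" unfolding esym_def by (intro sum_nonneg prod_nonneg) auto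
  have "E \<le> (\<Sum>p\<in>P. 1 / real p) - real v / y"
  proof -
    have "real v / y \<le> real w / y" using v y by (intro divide_right_mono) auto
    then show ?thesis using E by linarith
  qed
  then have "E * esym P v \<le> ((\<Sum>p\<in>P. 1 / real p) - real v / y) * esym P v" using e0 by (rule mult_right_mono)
  also have "\<dots> \<le> real (Suc v) * esym P (Suc v)" by (rule esym_step[OF P y])
  finally have "fact v * (E * esym P v) \<le> fact v * (real (Suc v) * esym P (Suc v))" by (intro mult_left_mono) auto
  then have "E * (fact v * esym P v) \<le> fact (Suc v) * esym P (Suc v)" by (simp add: mult_ac)
  then have "E ^ s * (E * (fact v * esym P v)) \<le> E ^ s * (fact (Suc v) * esym P (Suc v))" using E by (intro mult_left_mono) auto
  also have "\<dots> \<le> fact w * esym P w" using Suc.IH Suc.prems v by simp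
  finally show ?case unfolding v_def by (simp add: mult_ac)
qed simp

lemma fact_ge_quot_power: "s \<le> w \<Longrightarrow> (fact w :: real) \<ge> fact (w - s) * real (w - s) ^ s"
proof (induction s)
  case (Suc s)
  define v where "v = w - Suc s"
  have v: "w - s = Suc v" using Suc.prems by (auto simp: v_def)
  have "fact v * real v ^ Suc s \<le> fact v * (real (Suc v) * real (Suc v) ^ s)"
    by (intro mult_left_mono, unfold power_Suc) (auto intro!: mult_mono power_mono)
  also have "\<dots> = fact (Suc v) * real (Suc v) ^ s" by simp
  also have "\<dots> \<le> fact w" using Suc v by simp
  finally show ?case unfolding v_def .
qed simp

text \<open>
  Iterating \<open>esym_step\<close> shows that \<open>esym P w / esym P (w - s)\<close> is at least \<open>E^s (w - s)! / w!\<close>, so the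
  square of the left-hand side is at least \<open>E^s w! / ((w - s)! s!\<^sup>2) \<ge> (E (w - s))^s / s!\<^sup>2\<close>. The largest
  useful \<open>s\<close> is about \<open>sqrt(E w)\<close>, for which \<open>s^s/s!\<close> is about \<open>exp(sqrt(E w))\<close>.
\<close>
lemma block_gain:
  assumes P: "finite P" "\<And>p. p \<in> P \<Longrightarrow> p > 0" and y: "y > 0" "\<And>p. p \<in> P \<Longrightarrow> y \<le> real p"
    and E: "E \<ge> 0" "E \<le> (\<Sum>p\<in>P. 1 / real p) - real w / y" and s: "s \<le> w" and w: "w \<le> card P"
    and sE: "(real s)\<^sup>2 \<le> E * real (w - s)"
  shows "real (w choose s) * sqrt (esym P w / esym P (w - s)) \<ge> real s ^ s / fact s"
proof -
  have e: "esym P w > 0" "esym P (w - s) > 0" using w by (auto intro!: esym_pos P)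
  have "(real s ^ s / fact s)\<^sup>2 = ((real s)\<^sup>2) ^ s / (fact s)\<^sup>2"
    by (simp add: power_divide power_mult[symmetric] mult.commute)
  also have "\<dots> \<le> (E * real (w - s)) ^ s / (fact s)\<^sup>2"
    using sE by (intro divide_right_mono power_mono) auto
  also have "\<dots> = E ^ s * real (w - s) ^ s / (fact s)\<^sup>2" by (simp add: power_mult_distrib)
  also have "\<dots> \<le> E ^ s * (fact w / fact (w - s)) / (fact s)\<^sup>2"
    using fact_ge_quot_power[OF s] E by (intro divide_right_mono mult_left_mono) (auto simp: field_simps)
  also have "\<dots> = (fact w / (fact s * fact (w - s)))\<^sup>2 * (E ^ s * fact (w - s) / fact w)"
    by (simp add: power2_eq_square field_simps)
  also have "\<dots> = (real (w choose s))\<^sup>2 * (E ^ s * fact (w - s) / fact w)"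
    using s by (simp add: binomial_fact)
  also have "\<dots> \<le> (real (w choose s))\<^sup>2 * (esym P w / esym P (w - s))"
    using esym_ratio[OF P y E s] e by (intro mult_left_mono) (auto simp: field_simps)
  also have "\<dots> = (real (w choose s) * sqrt (esym P w / esym P (w - s)))\<^sup>2"
    using e by (simp add: power_mult_distrib)
  finally show ?thesis by (rule power2_le_imp_le) (use e in auto)
qed

text \<open>
  A weak form of Stirling's formula, sharp up to a power of \<open>s\<close>.
\<close>
lemma ln_fact_le:
  assumes "s \<ge> 1"
  shows "ln (fact s :: real) \<le> 1 + (real s + 1) * ln (real s) - real s"
  using assms
proof (induction s rule: nat_induct_at_least)
  case (Suc s)
  have s0: "real s > 0" using Suc by simp
  have "ln (real s / real (Suc s)) \<le> real s / real (Suc s) - 1"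
    using s0 by (intro ln_le_minus_one) auto
  then have "real (Suc s) * ln (real s / real (Suc s)) \<le> real (Suc s) * (real s / real (Suc s) - 1)"
    by (intro mult_left_mono) auto
  also have "\<dots> = - 1" by (simp add: field_simps)
  finally have 1: "real (Suc s) * ln (real s) - real (Suc s) * ln (real (Suc s)) \<le> - 1"
    using s0 by (simp add: ln_div right_diff_distrib del: of_nat_Suc)
  have "ln (fact (Suc s) :: real) = ln (real (Suc s)) + ln (fact s)"
    by (simp add: ln_mult del: of_nat_Suc)
  then show ?case using Suc.IH 1 by (simp add: algebra_simps)
qed simp

lemma power_div_fact_ge:
  assumes "s \<ge> 1"
  shows "real s ^ s / fact s \<ge> exp (real s - 1 - ln (real s))"
proof -
  have "real s ^ s / fact s = exp (real s * ln (real s) - ln (fact s))"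
    using assms by (simp add: exp_diff exp_of_nat_mult)
  moreover have "real s - 1 - ln (real s) \<le> real s * ln (real s) - ln (fact s)"
    using ln_fact_le[OF assms] by (simp add: distrib_right)
  ultimately show ?thesis by simp
qed

text \<open>
  A member selects \<open>w i\<close> elements, later primes, of each block \<open>P i\<close>; \<open>layer_prod\<close> is the integer that
  the selection stands for.
\<close>
definition layers :: "nat set \<Rightarrow> (nat \<Rightarrow> nat set) \<Rightarrow> (nat \<Rightarrow> nat) \<Rightarrow> (nat \<Rightarrow> nat set) set" where
  "layers I P w = PiE I (\<lambda>i. {S. S \<subseteq> P i \<and> card S = w i})"

definition layer_prod :: "nat set \<Rightarrow> (nat \<Rightarrow> nat set) \<Rightarrow> nat" where
  "layer_prod I g = (\<Prod>i\<in>I. \<Prod>(g i))"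

lemma prime_dvd_layer_prod_iff:
  assumes I: "finite I" and P: "\<And>i. i \<in> I \<Longrightarrow> finite (P i)" "\<And>i p. i \<in> I \<Longrightarrow> p \<in> P i \<Longrightarrow> prime p"
    and g: "\<And>i. i \<in> I \<Longrightarrow> g i \<subseteq> P i" and p: "prime p"
  shows "p dvd layer_prod I g \<longleftrightarrow> (\<exists>i\<in>I. p \<in> g i)"
proof -
  have fin: "finite (g i)" if "i \<in> I" for i using g[OF that] P(1)[OF that] finite_subset by blast
  have "p dvd layer_prod I g \<longleftrightarrow> (\<exists>i\<in>I. p dvd \<Prod>(g i))"
    unfolding layer_prod_def using prime_dvd_prod_iff[OF I p] by simp
  also have "\<dots> \<longleftrightarrow> (\<exists>i\<in>I. \<exists>q\<in>g i. p dvd q)"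
    using prime_dvd_prod_iff[OF fin p, of _ "\<lambda>x. x"] by auto
  also have "\<dots> \<longleftrightarrow> (\<exists>i\<in>I. p \<in> g i)"
  proof (intro bex_cong refl iffI)
    fix i assume i: "i \<in> I" and "\<exists>q\<in>g i. p dvd q"
    then obtain q where q: "q \<in> g i" "p dvd q" by blast
    then have "prime q" using g[OF i] P(2)[OF i] by blast
    then have "p = q" using q p primes_dvd_imp_eq by blast
    then show "p \<in> g i" using q by simp
  qed (use dvd_refl in blast)
  finally show ?thesis .
qed

text \<open>
  The set chosen from block \<open>i\<close> can be read off as the set of prime divisors in \<open>P i\<close>.
\<close>
lemma inj_on_layer_prod:
  assumes I: "finite I" and P: "\<And>i. i \<in> I \<Longrightarrow> finite (P i)" "\<And>i p. i \<in> I \<Longrightarrow> p \<in> P i \<Longrightarrow> prime p"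
    and disj: "\<And>i j. i \<in> I \<Longrightarrow> j \<in> I \<Longrightarrow> i \<noteq> j \<Longrightarrow> P i \<inter> P j = {}"
  shows "inj_on (layer_prod I) (PiE I (\<lambda>i. Pow (P i)))"
proof (rule inj_onI)
  fix g h assume g: "g \<in> PiE I (\<lambda>i. Pow (P i))" and h: "h \<in> PiE I (\<lambda>i. Pow (P i))" and eq: "layer_prod I g = layer_prod I h"
  have key: "f i = {p\<in>P i. p dvd layer_prod I f}" if f: "f \<in> PiE I (\<lambda>i. Pow (P i))" and i: "i \<in> I" for f i
  proof -
    have sub: "\<And>i. i \<in> I \<Longrightarrow> f i \<subseteq> P i" using f by (auto simp: PiE_iff)
    have "p \<in> f i \<longleftrightarrow> p dvd layer_prod I f" if p: "p \<in> P i" for p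
    proof -
      have "(\<exists>j\<in>I. p \<in> f j) \<longleftrightarrow> p \<in> f i" using sub disj i p by (metis IntI empty_iff subsetD)
      then show ?thesis using prime_dvd_layer_prod_iff[where P=P and g=f and p=p, OF I P sub P(2)[OF i p]] by simp
    qed
    then show ?thesis using sub[OF i] by auto
  qed
  show "g = h"
    by (rule PiE_ext[OF g h]) (simp add: key[OF g] key[OF h] eq)
qed

lemma sum_layers:
  assumes I: "finite I" and P: "\<And>i. i \<in> I \<Longrightarrow> finite (P i)"
  shows "(\<Sum>g\<in>layers I P w. 1 / real (layer_prod I g)) = (\<Prod>i\<in>I. esym (P i) (w i))"
proof -
  have "(\<Prod>i\<in>I. esym (P i) (w i)) = (\<Sum>g\<in>layers I P w. \<Prod>i\<in>I. \<Prod>p\<in>g i. 1 / real p)"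
    unfolding esym_def layers_def by (rule prod_sum_PiE) (use I P finite_subsets_card in auto)
  then show ?thesis by (simp add: layer_prod_def prod_dividef)
qed

lemma card_layers:
  assumes I: "finite I" and P: "\<And>i. i \<in> I \<Longrightarrow> finite (P i)"
  shows "card (layers I P w) = (\<Prod>i\<in>I. card (P i) choose w i)"
  unfolding layers_def using I P by (simp add: card_PiE n_subsets)

lemma sqrt_prod: "sqrt (prod f A) = (\<Prod>a\<in>A. sqrt (f a))"
  by (induction A rule: infinite_finite_induct) (auto simp: real_sqrt_mult)

text \<open>
  Let \<open>U\<close> and \<open>V\<close> be the integers with exactly \<open>w i\<close>, respectively \<open>w i - s i\<close>, primes from each block, and
  normalise \<open>m^(-1/2)\<close> to square sum 1 on each of them. For \<open>n \<in> V\<close> dividing \<open>m \<in> U\<close> the product of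
  \<open>n^(-1/2)\<close>, \<open>m^(-1/2)\<close> and \<open>(m/n)^(-1/2)\<close> is just \<open>1/m\<close>, and each \<open>m\<close> has \<open>\<Prod> (w i choose s i)\<close> such
  divisors. What remains is the quotient of the normalisations, which are products of elementary
  symmetric polynomials over the blocks. Since the quotients \<open>m/n\<close> have exactly \<open>s i\<close> primes in each block,
  the coefficients \<open>a k\<close> need to be bounded from below in a short range of \<open>k\<close> only.
\<close>
lemma layered_resonator:
  fixes I :: "nat set" and P :: "nat \<Rightarrow> nat set" and w s :: "nat \<Rightarrow> nat"
  assumes I: "finite I" and P: "\<And>i. i \<in> I \<Longrightarrow> finite (P i)" "\<And>i p. i \<in> I \<Longrightarrow> p \<in> P i \<Longrightarrow> prime p"
    and disj: "\<And>i j. i \<in> I \<Longrightarrow> j \<in> I \<Longrightarrow> i \<noteq> j \<Longrightarrow> P i \<inter> P j = {}"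
    and w: "\<And>i. i \<in> I \<Longrightarrow> w i \<le> card (P i)" and s: "\<And>i. i \<in> I \<Longrightarrow> s i \<le> w i" "\<exists>i\<in>I. s i \<ge> 1"
    and L: "\<And>i p. i \<in> I \<Longrightarrow> p \<in> P i \<Longrightarrow> ln (real p) \<le> L i"
  obtains M f where "finite M" "0 \<notin> M" "\<And>m. f m \<ge> 0"
    "card M \<le> (\<Prod>i\<in>I. card (P i) choose w i) + (\<Prod>i\<in>I. card (P i) choose (w i - s i))"
    "(\<Sum>m\<in>M. (f m)\<^sup>2) \<le> (4::real)"
    "\<And>a c. (\<And>k. a k \<ge> 0) \<Longrightarrow> (\<And>k. k \<ge> 2 \<Longrightarrow> ln (real k) \<le> (\<Sum>i\<in>I. real (s i) * L i) \<Longrightarrow> a k \<ge> c * real k powr (-1/2)) \<Longrightarrow> c \<ge> 0 \<Longrightarrow>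
      dvd_pair_sum M a f \<ge> c * (\<Prod>i\<in>I. real (w i choose s i) * sqrt (esym (P i) (w i) / esym (P i) (w i - s i)))"
proof -
  define v where "v = (\<lambda>i. w i - s i)"
  define U where "U = layers I P w"
  define V where "V = layers I P v"
  define val where "val = layer_prod I"
  have p0: "p > 0" if "i \<in> I" "p \<in> P i" for i p using P(2)[OF that] by (rule prime_gt_0_nat)
  have injP: "inj_on val (PiE I (\<lambda>i. Pow (P i)))" unfolding val_def by (rule inj_on_layer_prod[OF I P disj])
  have UP: "U \<subseteq> PiE I (\<lambda>i. Pow (P i))" and VP: "V \<subseteq> PiE I (\<lambda>i. Pow (P i))"
    by (auto simp: U_def V_def layers_def PiE_iff)
  have finU: "finite U" and finV: "finite V"
    unfolding U_def V_def layers_def using I P(1) by (auto intro!: finite_PiE finite_subsets_card)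
  have injU: "inj_on val U" and injV: "inj_on val V" using inj_on_subset[OF injP] UP VP by auto
  define eU where "eU = (\<Prod>i\<in>I. esym (P i) (w i))"
  define eV where "eV = (\<Prod>i\<in>I. esym (P i) (v i))"
  have vw: "v i \<le> w i" for i by (simp add: v_def)
  have eU: "eU > 0" unfolding eU_def by (intro prod_pos ballI esym_pos P(1) p0 w)
  have eV: "eV > 0" unfolding eV_def using w vw order_trans by (intro prod_pos ballI esym_pos P(1) p0) blast+
  have cl: "card (layers I P w') = (\<Prod>i\<in>I. card (P i) choose w' i)" for w'
    by (rule card_layers[OF I]) (rule P(1))
  have sumU: "(\<Sum>g\<in>U. 1 / real (val g)) = eU" unfolding U_def val_def eU_def by (rule sum_layers[OF I P(1)])
  have sumV: "(\<Sum>g\<in>V. 1 / real (val g)) = eV" unfolding V_def val_def eV_def by (rule sum_layers[OF I P(1)])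
  have valpos: "val g > 0" if "g \<in> PiE I (\<lambda>i. Pow (P i))" for g
    unfolding val_def layer_prod_def using that p0 by (intro prod_pos ballI) (auto simp: PiE_iff)
  define M where "M = val ` U \<union> val ` V"
  define fU where "fU = (\<lambda>m. if m \<in> val ` U then 1 / sqrt (real m * eU) else 0)"
  define fV where "fV = (\<lambda>m. if m \<in> val ` V then 1 / sqrt (real m * eV) else 0)"
  define f where "f = (\<lambda>m. fU m + fV m)"
  have fU0: "fU m \<ge> 0" and fV0: "fV m \<ge> 0" for m using eU eV by (auto simp: fU_def fV_def)
  show ?thesis
  proof (rule that[of M f])
    show "finite M" using finU finV by (simp add: M_def)
    have pos: "m > 0" if "m \<in> M" for m using that valpos UP VP by (auto simp: M_def)
    then show "0 \<notin> M" by blast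
    show "f m \<ge> 0" for m using fU0 fV0 by (simp add: f_def)
    have "card M \<le> card U + card V"
      unfolding M_def by (intro order_trans[OF card_Un_le] add_mono card_image_le finU finV)
    then show "card M \<le> (\<Prod>i\<in>I. card (P i) choose w i) + (\<Prod>i\<in>I. card (P i) choose (w i - s i))"
      unfolding U_def V_def cl by (simp add: v_def)
    show "(\<Sum>m\<in>M. (f m)\<^sup>2) \<le> 4"
    proof -
      have "(\<Sum>m\<in>M. (f m)\<^sup>2) \<le> (\<Sum>m\<in>M. 2 * (fU m)\<^sup>2 + 2 * (fV m)\<^sup>2)"
      proof (rule sum_mono)
        fix m have "0 \<le> (fU m - fV m)\<^sup>2" by simp
        then show "(f m)\<^sup>2 \<le> 2 * (fU m)\<^sup>2 + 2 * (fV m)\<^sup>2" by (simp add: f_def power2_eq_square algebra_simps)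
      qed
      also have "\<dots> = 2 * (\<Sum>m\<in>M. (fU m)\<^sup>2) + 2 * (\<Sum>m\<in>M. (fV m)\<^sup>2)"
        by (simp add: sum.distrib sum_distrib_left)
      also have "(\<Sum>m\<in>M. (fU m)\<^sup>2) = (\<Sum>m\<in>val ` U. (fU m)\<^sup>2)"
        by (rule sum.mono_neutral_right) (use finU finV in \<open>auto simp: M_def fU_def\<close>)
      also have "\<dots> = (\<Sum>g\<in>U. (1 / real (val g)) / eU)"
        using injU eU by (simp add: sum.reindex fU_def power_divide)
      also have "\<dots> = 1" unfolding sum_divide_distrib[symmetric] sumU using eU by simp
      also have "(\<Sum>m\<in>M. (fV m)\<^sup>2) = (\<Sum>m\<in>val ` V. (fV m)\<^sup>2)"
        by (rule sum.mono_neutral_right) (use finU finV in \<open>auto simp: M_def fV_def\<close>)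
      also have "\<dots> = (\<Sum>g\<in>V. (1 / real (val g)) / eV)"
        using injV eV by (simp add: sum.reindex fV_def power_divide)
      also have "\<dots> = 1" unfolding sum_divide_distrib[symmetric] sumV using eV by simp
      finally show ?thesis by simp
    qed
    fix a :: "nat \<Rightarrow> real" and c :: real
    assume a0: "\<And>k. a k \<ge> 0" and c0: "c \<ge> 0"
      and al: "\<And>k. k \<ge> 2 \<Longrightarrow> ln (real k) \<le> (\<Sum>i\<in>I. real (s i) * L i) \<Longrightarrow> a k \<ge> c * real k powr (-1/2)"
    define D :: "(nat \<Rightarrow> nat set) \<Rightarrow> (nat \<Rightarrow> nat set) set" where "D = (\<lambda>g. PiE I (\<lambda>i. {S. S \<subseteq> g i \<and> card S = v i}))"
    define N where "N = (\<Prod>i\<in>I. w i choose s i)"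
    have gU: "g i \<subseteq> P i" "card (g i) = w i" "finite (g i)" if "g \<in> U" "i \<in> I" for g i
      using that P(1)[of i] by (auto simp: U_def layers_def PiE_iff intro: finite_subset)
    have DV: "D g \<subseteq> V" if "g \<in> U" for g
      unfolding D_def V_def layers_def
    proof (rule PiE_mono)
      fix i assume "i \<in> I"
      then show "{S. S \<subseteq> g i \<and> card S = v i} \<subseteq> {S. S \<subseteq> P i \<and> card S = v i}" using gU(1)[OF that] by blast
    qed
    have cardD: "card (D g) = N" if "g \<in> U" for g
    proof -
      have "card (D g) = (\<Prod>i\<in>I. card (g i) choose v i)"
        unfolding D_def using I gU[OF that] by (simp add: card_PiE n_subsets)
      also have "\<dots> = N" unfolding N_def
      proof (intro prod.cong refl)
        fix i assume i: "i \<in> I"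
        show "card (g i) choose v i = w i choose s i"
          using gU(2)[OF that i] s(1)[OF i] binomial_symmetric[OF s(1)[OF i]] by (simp add: v_def)
      qed
      finally show ?thesis .
    qed
    let ?R = "{(n,m). n \<in> M \<and> m \<in> M \<and> n dvd m}"
    let ?S = "Sigma U D"
    have finR: "finite ?R" by (rule finite_subset[of _ "M \<times> M"]) (use finU finV in \<open>auto simp: M_def\<close>)
    have finD: "finite (D g)" if "g \<in> U" for g using DV[OF that] finV finite_subset by blast
    have pairb: "val h dvd val g \<and> a (val g div val h) * f (val h) * f (val g) \<ge> c / sqrt (eU * eV) * (1 / real (val g))" if g: "g \<in> U" and h: "h \<in> D g" for g h
    proof -
      define d where "d = (\<lambda>i. g i - h i)"
      have hV: "h \<in> V" using DV g h by blast
      have hg: "h i \<subseteq> g i" "card (h i) = v i" "finite (h i)" if "i \<in> I" for i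
        using h that gU(3)[OF g that] by (auto simp: D_def PiE_iff intro: finite_subset)
      define k where "k = layer_prod I d"
      have gk: "val g = k * val h"
        unfolding val_def k_def layer_prod_def d_def prod.distrib[symmetric]
        by (intro prod.cong refl prod.subset_diff) (use hg gU(3)[OF g] in auto)
      have vg: "val g > 0" and vh: "val h > 0" using valpos UP VP g hV by auto
      have k0: "k > 0" using gk vg by (metis gr0I mult_0)
      have dP: "d i \<subseteq> P i" if "i \<in> I" for i using gU(1)[OF g that] by (auto simp: d_def)
      have dfin: "finite (d i)" if "i \<in> I" for i using dP[OF that] P(1)[OF that] finite_subset by blast
      have dcard: "card (d i) = s i" if "i \<in> I" for i
        using that hg[OF that] gU(2)[OF g that] s(1)[OF that] by (simp add: d_def card_Diff_subset v_def)
      have k2: "k \<ge> 2"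
      proof -
        obtain i where i: "i \<in> I" "s i \<ge> 1" using s(2) by blast
        then have "d i \<noteq> {}" using dcard[of i] by auto
        then obtain p where p: "p \<in> d i" by blast
        then have pp: "prime p" using dP[OF i(1)] P(2)[OF i(1)] by blast
        have "p dvd k \<longleftrightarrow> (\<exists>i\<in>I. p \<in> d i)" unfolding k_def
          by (rule prime_dvd_layer_prod_iff[where P=P]) (use I P dP pp in auto)
        then have "p dvd k" using i p by blast
        then show ?thesis using k0 prime_ge_2_nat[OF pp] dvd_imp_le le_trans by blast
      qed
      have lnk: "ln (real k) \<le> (\<Sum>i\<in>I. real (s i) * L i)"
      proof -
        have p00: "real p \<noteq> 0" if "i \<in> I" "p \<in> d i" for i p using p0 that dP by fastforce
        have "ln (real k) = (\<Sum>i\<in>I. \<Sum>p\<in>d i. ln (real p))"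
          unfolding k_def layer_prod_def of_nat_prod using p00 I dfin
          by (subst ln_prod) (auto simp: ln_prod prod_pos p0 intro!: sum.cong gr0I)
        also have "\<dots> \<le> (\<Sum>i\<in>I. \<Sum>p\<in>d i. L i)" using dP L by (intro sum_mono) blast
        also have "\<dots> = (\<Sum>i\<in>I. real (s i) * L i)" by (intro sum.cong refl) (simp add: dcard)
        finally show ?thesis .
      qed
      have ak: "a k \<ge> c * real k powr (-1/2)" by (rule al[OF k2 lnk])
      have kp: "real k powr (-1/2) = 1 / sqrt (real k)"
        using k0 by (simp add: powr_minus_divide powr_half_sqrt)
      have f1: "f (val h) \<ge> 1 / sqrt (real (val h) * eV)" using hV fU0 by (simp add: f_def fV_def)
      have f2: "f (val g) \<ge> 1 / sqrt (real (val g) * eU)" using g fV0 by (simp add: f_def fU_def)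
      have "c / sqrt (eU * eV) * (1 / real (val g)) = (c * real k powr (-1/2)) * (1 / sqrt (real (val h) * eV)) * (1 / sqrt (real (val g) * eU))"
      proof -
        have "sqrt (real k) * sqrt (real (val h)) * sqrt (real (val g)) = real (val g)"
        proof -
          have "sqrt (real k) * sqrt (real (val h)) = sqrt (real (val g))" unfolding gk by (simp add: real_sqrt_mult)
          then show ?thesis by simp
        qed
        then show ?thesis unfolding kp by (simp add: real_sqrt_mult field_simps)
      qed
      also have "\<dots> \<le> a k * f (val h) * f (val g)"
        using ak f1 f2 c0 eU eV a0[of k] fU0 fV0 by (intro mult_mono mult_nonneg_nonneg) (auto simp: f_def)
      also have "k = val g div val h" using gk vh by simp
      finally show ?thesis using gk by simp
    qed
    have injS: "inj_on (\<lambda>(g,h). (val h, val g)) ?S"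
    proof (rule inj_onI)
      fix x y assume xy: "x \<in> ?S" "y \<in> ?S" "(\<lambda>(g,h). (val h, val g)) x = (\<lambda>(g,h). (val h, val g)) y"
      obtain g h g' h' where [simp]: "x = (g,h)" "y = (g',h')" by force
      have "g \<in> U" "g' \<in> U" "h \<in> V" "h' \<in> V" using xy DV by auto
      moreover have "val g = val g'" "val h = val h'" using xy by auto
      ultimately show "x = y" using injU injV by (auto simp: inj_on_def)
    qed
    have "c * (\<Prod>i\<in>I. real (w i choose s i) * sqrt (esym (P i) (w i) / esym (P i) (w i - s i))) = c / sqrt (eU * eV) * real N * eU"
    proof -
      have "(\<Prod>i\<in>I. real (w i choose s i) * sqrt (esym (P i) (w i) / esym (P i) (w i - s i))) = real N * sqrt (eU / eV)"
      proof -
        have "sqrt (eU / eV) = (\<Prod>i\<in>I. sqrt (esym (P i) (w i) / esym (P i) (w i - s i)))"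
          unfolding eU_def eV_def v_def prod_dividef[symmetric] by (rule sqrt_prod)
        then show ?thesis by (simp add: prod.distrib N_def)
      qed
      moreover have "sqrt (eU / eV) = 1 / sqrt (eU * eV) * eU"
        using eU eV by (simp add: real_sqrt_divide real_sqrt_mult field_simps)
      ultimately show ?thesis by simp
    qed
    also have "\<dots> = (\<Sum>g\<in>U. \<Sum>h\<in>D g. c / sqrt (eU * eV) * (1 / real (val g)))"
    proof -
      have "(\<Sum>g\<in>U. \<Sum>h\<in>D g. c / sqrt (eU * eV) * (1 / real (val g))) = (\<Sum>g\<in>U. c / sqrt (eU * eV) * real N * (1 / real (val g)))"
        by (intro sum.cong refl) (simp add: cardD)
      then show ?thesis by (simp only: sum_distrib_left[symmetric] sumU)
    qed
    also have "\<dots> = (\<Sum>(g,h)\<in>?S. c / sqrt (eU * eV) * (1 / real (val g)))"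
      by (rule sum.Sigma) (use finU finD in auto)
    also have "\<dots> \<le> (\<Sum>(g,h)\<in>?S. a (val g div val h) * f (val h) * f (val g))"
      by (rule sum_mono) (use pairb in auto)
    also have "\<dots> = (\<Sum>(n,m)\<in>(\<lambda>(g,h). (val h, val g)) ` ?S. a (m div n) * f n * f m)"
      by (subst sum.reindex[OF injS]) (simp add: case_prod_beta o_def)
    also have "\<dots> \<le> (\<Sum>(n,m)\<in>?R. a (m div n) * f n * f m)"
    proof (rule sum_mono2[OF finR])
      show "(\<lambda>(g,h). (val h, val g)) ` ?S \<subseteq> ?R" using pairb DV by (fastforce simp: M_def)
    qed (use a0 fU0 fV0 in \<open>auto simp: f_def\<close>)
    finally show "c * (\<Prod>i\<in>I. real (w i choose s i) * sqrt (esym (P i) (w i) / esym (P i) (w i - s i))) \<le> (\<Sum>(n,m)\<in>?R. a (m div n) * f n * f m)" .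
  qed
qed

section \<open>A resonator of prescribed size\<close>

lemma harmonic_block_bounds:
  assumes "1 \<le> a" "a \<le> b"
  shows "(\<Sum>k\<in>{a<..b}. 1 / real k) \<le> ln (real b) - ln (real a)"
    and "ln (real (Suc b)) - ln (real (Suc a)) \<le> (\<Sum>k\<in>{a<..b}. 1 / real k)"
  using assms(2)
proof (induction b rule: dec_induct)
  case (step n)
  have n0: "real n > 0" using step assms(1) by simp
  have eq: "(\<Sum>k\<in>{a<..Suc n}. 1 / real k) = 1 / real (Suc n) + (\<Sum>k\<in>{a<..n}. 1 / real k)"
  proof -
    have "{a<..Suc n} = insert (Suc n) {a<..n}" using step by auto
    then show ?thesis by simp
  qed
  { case 1
    have "ln (real n / real (Suc n)) \<le> real n / real (Suc n) - 1" using n0 by (intro ln_le_minus_one) auto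
    also have "\<dots> = - 1 / real (Suc n)" using n0 by (simp add: field_simps)
    finally have "1 / real (Suc n) \<le> ln (real (Suc n)) - ln (real n)" using n0 by (simp add: ln_div del: of_nat_Suc)
    then show ?case using step.IH(1) step eq by linarith
  }
  { case 2
    have "ln (real (Suc (Suc n)) / real (Suc n)) \<le> real (Suc (Suc n)) / real (Suc n) - 1" by (intro ln_le_minus_one) auto
    also have "\<dots> = 1 / real (Suc n)" by (simp add: field_simps)
    finally have "ln (real (Suc (Suc n))) - ln (real (Suc n)) \<le> 1 / real (Suc n)" by (simp add: ln_div del: of_nat_Suc)
    then show ?case using step.IH(2) step eq by linarith
  }
qed auto

text \<open>
  The familiar bound \<open>Q choose j \<le> (e Q / j)^j\<close>, in a form monotone in \<open>j\<close>, so that it applies at once to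
  \<open>w\<close> and to \<open>w - s\<close>.
\<close>
lemma binomial_le_exp_power:
  assumes Y: "Y > 0" "Y \<le> real j" and j: "j \<le> w" and Q: "real Q \<le> B" and B: "Y \<le> exp 1 * B"
  shows "real (Q choose j) \<le> (exp 1 * B / Y) ^ w"
proof -
  have "real ((Q choose j) * fact j) \<le> real (Q ^ j)"
    by (rule of_nat_mono) (rule binomial_fact_pow)
  then have 1: "real (Q choose j) * fact j \<le> real Q ^ j" by simp
  have "real j ^ j \<le> exp 1 ^ j * fact j"
    using power_le_fact_exp[of "real j" j] by (simp add: mult.commute exp_of_nat_mult[symmetric])
  moreover have "Y ^ j \<le> real j ^ j" using Y by (intro power_mono) auto
  ultimately have 2: "Y ^ j \<le> exp 1 ^ j * fact j" by linarith
  have "real (Q choose j) * Y ^ j \<le> real (Q choose j) * (exp 1 ^ j * fact j)" by (intro mult_left_mono 2) auto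
  also have "\<dots> = exp 1 ^ j * (real (Q choose j) * fact j)" by simp
  also have "\<dots> \<le> exp 1 ^ j * real Q ^ j" by (intro mult_left_mono 1) auto
  also have "\<dots> \<le> exp 1 ^ j * B ^ j" using Q by (intro mult_left_mono power_mono) auto
  finally have "real (Q choose j) \<le> (exp 1 * B / Y) ^ j"
    using Y by (simp add: power_divide power_mult_distrib field_simps)
  also have "\<dots> \<le> (exp 1 * B / Y) ^ w" using B Y j by (intro power_increasing) auto
  finally show ?thesis .
qed

text \<open>
  Here \<open>x\<close> stands for \<open>ln T\<close>. Block \<open>k\<close> consists of the primes between \<open>exp(A k) x\<close> and \<open>exp(A (k+1)) x\<close>,
  with \<open>w k = c x / (k\<^sup>2 ln ln x)\<close> primes chosen from it and \<open>s k = \<mu> q / k\<close> of them removed, up to rounding.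
  The logarithm of the number of choices is about \<open>w k\<close> times \<open>ln (exp(A k) x / w k)\<close>, which is \<open>A k\<close> up to
  logarithms; they are negligible because \<open>k \<ge> (ln ln x)\<^sup>2\<close>. Because \<open>k \<le> ln x / (ln ln x)\<^sup>2\<close>, all primes
  used have logarithm about \<open>ln x\<close>, so the reciprocals in a block sum to about \<open>A / ln x\<close>. Therefore \<open>ln (card M)\<close>
  and the logarithm of the gain are multiples of \<open>\<Sum> 1/k\<close>, which is about \<open>ln ln x\<close>.
\<close>
lemma resonator_exists:
  fixes lam \<rho> \<eta> :: real
  assumes lam: "lam > 0" and \<rho>: "0 < \<rho>" "\<rho> < sqrt lam" and \<eta>: "\<eta> > 0"
  shows "\<forall>\<^sub>F x in at_top. \<exists>(M :: nat set) f. finite M \<and> 0 \<notin> M \<and> (\<forall>m. f m \<ge> 0) \<and>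
     real (card M) \<le> 2 * exp (lam * x) \<and> (\<Sum>m\<in>M. (f m)\<^sup>2) \<le> (4::real) \<and>
     (\<forall>a c. (\<forall>k. a k \<ge> 0) \<longrightarrow> (\<forall>k\<ge>2. ln (real k) \<le> \<eta> * x \<longrightarrow> a k \<ge> c * real k powr (-1/2)) \<longrightarrow> c \<ge> 0 \<longrightarrow>
       dvd_pair_sum M a f \<ge> c * exp (\<rho> * sqrt (x * ln (ln x) / ln x)))"
proof -
  obtain C where C: "C > 0"
    "\<And>x A. x \<ge> 2 \<Longrightarrow> A \<ge> 0 \<Longrightarrow> (\<Sum>p | prime p \<and> x < real p \<and> real p \<le> exp A * x. ln (real p) / real p) \<ge> A - C"
    by (rule mertens_interval) blast
  \<comment> \<open>\<open>e\<close> bounds all relative losses below: \<open>mu e * (1 - 2 * e)\<close> tends to \<open>sqrt lam\<close> as \<open>e\<close> tends to 0.\<close>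
  define mu where "mu = (\<lambda>e::real. sqrt (lam * ((1 - e) / (1 + e)) * ((1 - e) / (1 + e) - e)))"
  have "((\<lambda>e. mu e * (1 - 2 * e)) \<longlongrightarrow> sqrt (lam * ((1 - 0) / (1 + 0)) * ((1 - 0) / (1 + 0) - 0)) * (1 - 2 * 0)) (at_right 0)"
    unfolding mu_def by (intro tendsto_intros) auto
  then have "\<forall>\<^sub>F e in at_right 0. mu e * (1 - 2 * e) > \<rho>" using \<rho> by (intro order_tendstoD(1)) auto
  moreover have "\<forall>\<^sub>F e in at_right (0::real). 0 < e \<and> e < 1/4" by (intro eventually_at_rightI[of 0 "1/4"]) auto
  ultimately have "\<forall>\<^sub>F e in at_right 0. mu e * (1 - 2 * e) > \<rho> \<and> 0 < e \<and> e < 1/4" by eventually_elim auto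
  then obtain e where e: "mu e * (1 - 2 * e) > \<rho>" "0 < e" "e < 1/4"
    using eventually_happens'[OF trivial_limit_at_right_real] by blast
  define \<mu> where "\<mu> = mu e"
  have \<mu>: "\<mu> * (1 - 2 * e) > \<rho>" using e by (simp add: \<mu>_def)
  have \<mu>0: "\<mu> > 0" proof (rule ccontr)
    assume "\<not> \<mu> > 0"
    then have "\<mu> * (1 - 2 * e) \<le> 0" using e by (intro mult_nonpos_nonneg) auto
    then show False using \<mu> \<rho> by linarith
  qed
  \<comment> \<open>The blocks are so long that the error term of Mertens' theorem is at most a fraction \<open>e\<close> of the main term.\<close>
  define A where "A = max 1 (C / e)"
  have A: "A \<ge> 1" "C \<le> e * A" using e by (auto simp: A_def max_def field_simps)
  \<comment> \<open>A prime of block \<open>k\<close> costs at most \<open>(1 + e) * A * k\<close> in \<open>ln (card M)\<close>; with this \<open>c\<close> the total is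
    \<open>lam * x\<close>.\<close>
  define c where "c = lam / ((1 + e) * A)"
  have c: "c > 0" using lam e A by (simp add: c_def)
  have cA: "(1 + e) * A * c = lam" using e A by (simp add: c_def)
  define E0 where "E0 = (A - C) / (1 + e) - e"
  have E0: "E0 \<ge> A * ((1 - e) / (1 + e) - e)"
  proof -
    have "A * (1 - e) \<le> A - C" using A by (simp add: algebra_simps)
    then have "A * (1 - e) / (1 + e) \<le> (A - C) / (1 + e)" using e by (intro divide_right_mono) auto
    moreover have "e * 1 \<le> e * A" using A e by (intro mult_left_mono) auto
    ultimately show ?thesis by (simp add: E0_def algebra_simps)
  qed
  have \<mu>2: "\<mu>\<^sup>2 \<le> E0 * (1 - e) * c" and E00: "E0 > 0"
  proof -
    have "lam * ((1 - e) / (1 + e)) * ((1 - e) / (1 + e) - e) > 0"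
      using \<mu>0 unfolding \<mu>_def mu_def real_sqrt_gt_0_iff .
    moreover have "lam * ((1 - e) / (1 + e)) > 0" using lam e by simp
    ultimately have "(1 - e) / (1 + e) - e > 0" by (rule zero_less_mult_pos)
    then have "0 < A * ((1 - e) / (1 + e) - e)" using A by simp
    with E0 show "E0 > 0" by linarith
    have "\<mu>\<^sup>2 = lam * ((1 - e) / (1 + e)) * ((1 - e) / (1 + e) - e)"
      using \<open>lam * ((1 - e) / (1 + e)) * ((1 - e) / (1 + e) - e) > 0\<close> by (simp add: \<mu>_def mu_def)
    also have "\<dots> = (A * ((1 - e) / (1 + e) - e)) * ((1 - e) * c)" using A by (simp add: c_def)
    also have "\<dots> \<le> E0 * ((1 - e) * c)" using E0 e c by (intro mult_right_mono) auto
    finally show "\<mu>\<^sup>2 \<le> E0 * (1 - e) * c" by (simp add: mult_ac)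
  qed
  \<comment> \<open>Block \<open>k\<close> contributes \<open>exp (\<mu> * q x / k)\<close> to the gain, up to a power of \<open>q x\<close>.\<close>
  define q where "q = (\<lambda>x::real. sqrt (x / (ln x * ln (ln x))))"
  have ev: "\<forall>\<^sub>F x in at_top. x \<ge> 2 \<and> ln x \<ge> 1 \<and> ln (ln x) \<ge> 1
      \<and> A * (ln x / (ln (ln x))\<^sup>2 + 1) \<le> e * ln x
      \<and> c * ln x \<le> e * exp (A * (ln (ln x))\<^sup>2)
      \<and> (ln x)\<^sup>2 * ln (ln x) + \<mu> * q x * ln x * ln (ln x) \<le> e * c * x
      \<and> 1 + A + ln (2 * (ln x)\<^sup>2 * ln (ln x) / c) \<le> e * A * (ln (ln x))\<^sup>2
      \<and> \<mu> * q x / ln x \<ge> 1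
      \<and> (ln (ln x))\<^sup>2 + 2 \<le> ln x / (ln (ln x))\<^sup>2 
      \<and> ln (ln x / (ln (ln x))\<^sup>2) - ln ((ln (ln x))\<^sup>2 + 2) \<ge> (1 - e) * ln (ln x)
      \<and> ln x * (2 + ln (\<mu> * q x)) \<le> e * \<mu> * sqrt (x * ln (ln x) / ln x)
      \<and> 2 * ln x * \<mu> * sqrt (x * ln (ln x) / ln x) \<le> \<eta> * x"
    unfolding q_def
  proof (intro eventually_conj)
    show "\<forall>\<^sub>F x in at_top. (2::real) \<le> x" by real_asymp
    show "\<forall>\<^sub>F x in at_top. (1::real) \<le> ln x" by real_asymp
    show "\<forall>\<^sub>F x in at_top. (1::real) \<le> ln (ln x)" by real_asymp
    show "\<forall>\<^sub>F x in at_top. A * (ln x / (ln (ln x))\<^sup>2 + 1) \<le> e * ln x" using e A(1) by real_asymp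
    show "\<forall>\<^sub>F x in at_top.  c * ln x \<le> e * exp (A * (ln (ln x))\<^sup>2)" using e A(1) c by real_asymp
    show "\<forall>\<^sub>F x in at_top. (ln x)\<^sup>2 * ln (ln x) + \<mu> * sqrt (x / (ln x * ln (ln x))) * ln x * ln (ln x) \<le> e * c * x" using e A(1) c \<mu>0 by real_asymp
    show "\<forall>\<^sub>F x in at_top. 1 + A + ln (2 * (ln x)\<^sup>2 * ln (ln x) / c) \<le> e * A * (ln (ln x))\<^sup>2" using e A(1) c by real_asymp
    show "\<forall>\<^sub>F x in at_top. 1 \<le> \<mu> * sqrt (x / (ln x * ln (ln x))) / ln x" using \<mu>0 by real_asymp
    show "\<forall>\<^sub>F x::real in at_top. (ln (ln x))\<^sup>2 + 2 \<le> ln x / (ln (ln x))\<^sup>2" by real_asymp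
    show "\<forall>\<^sub>F x in at_top. (1 - e) * ln (ln x) \<le> ln (ln x / (ln (ln x))\<^sup>2) - ln ((ln (ln x))\<^sup>2 + 2)" using e by real_asymp
    show "\<forall>\<^sub>F x in at_top. ln x * (2 + ln (\<mu> * sqrt (x / (ln x * ln (ln x))))) \<le> e * \<mu> * sqrt (x * ln (ln x) / ln x)" using e \<mu>0 by real_asymp
    show "\<forall>\<^sub>F x in at_top. 2 * ln x * \<mu> * sqrt (x * ln (ln x) / ln x) \<le> \<eta> * x" using \<eta> \<mu>0 by real_asymp
  qed
  show ?thesis
    using ev
  proof eventually_elim
    case (elim x)
    define z where "z = ln x"
    define y3 where "y3 = ln z"
    define Psi where "Psi = sqrt (x * y3 / z)"
    define Q where "Q = q x"
    have x: "x \<ge> 2" and z: "z \<ge> 1" and y3: "y3 \<ge> 1" using elim by (auto simp: z_def y3_def)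
    have h1: "A * (z / y3\<^sup>2 + 1) \<le> e * z" and h2: "c * z \<le> e * exp (A * y3\<^sup>2)"
      and h3: "z\<^sup>2 * y3 + \<mu> * Q * z * y3 \<le> e * c * x"
      and h4: "1 + A + ln (2 * z\<^sup>2 * y3 / c) \<le> e * A * y3\<^sup>2"
      and h5: "\<mu> * Q / z \<ge> 1" and h6: "y3\<^sup>2 + 2 \<le> z / y3\<^sup>2"
      and h7: "ln (z / y3\<^sup>2) - ln (y3\<^sup>2 + 2) \<ge> (1 - e) * y3"
      and h8: "z * (2 + ln (\<mu> * Q)) \<le> e * \<mu> * Psi"
      and h9: "2 * z * \<mu> * Psi \<le> \<eta> * x"
      using elim by (auto simp: z_def y3_def Psi_def Q_def)
    have Qz: "Q = sqrt (x / (z * y3))" by (simp add: Q_def q_def z_def y3_def)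
    have Q2: "Q\<^sup>2 = x / (z * y3)" and Q0: "Q > 0" using x z y3 by (auto simp: Qz)
    have QP: "Q * y3 = Psi"
    proof -
      have "Q * y3 = sqrt (x / (z * y3)) * sqrt (y3\<^sup>2)" using y3 by (simp add: Qz)
      also have "\<dots> = sqrt (x / (z * y3) * y3\<^sup>2)" by (simp only: real_sqrt_mult)
      also have "x / (z * y3) * y3\<^sup>2 = x * y3 / z" using y3 by (simp add: power2_eq_square)
      finally show ?thesis by (simp add: Psi_def)
    qed
    define K0 where "K0 = nat \<lceil>y3\<^sup>2\<rceil>"
    define K1 where "K1 = nat \<lfloor>z / y3\<^sup>2\<rfloor>"
    have y32: "y3\<^sup>2 \<ge> 1" using y3 by simp
    have K0: "real K0 \<ge> y3\<^sup>2" "real K0 < y3\<^sup>2 + 1" "K0 \<ge> 1" 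
    proof -
      have "real K0 = of_int \<lceil>y3\<^sup>2\<rceil>" using y32 by (simp add: K0_def)
      then show "real K0 \<ge> y3\<^sup>2" "real K0 < y3\<^sup>2 + 1" by linarith+
      then show "K0 \<ge> 1" using y32 by linarith
    qed
    have K1: "real K1 \<le> z / y3\<^sup>2" "real K1 > z / y3\<^sup>2 - 1"
    proof -
      have "0 \<le> z / y3\<^sup>2" using z by simp
      then have "real K1 = of_int \<lfloor>z / y3\<^sup>2\<rfloor>" by (simp add: K1_def)
      then show "real K1 \<le> z / y3\<^sup>2" "real K1 > z / y3\<^sup>2 - 1" by linarith+
    qed
    have K01: "K0 < K1"
    proof -
      have "real K0 < real K1" using K0 K1 h6 by linarith
      then show ?thesis by simp
    qed
    have zy: "z / y3\<^sup>2 \<le> z" using z y32 by (simp add: divide_le_eq mult_le_cancel_left1)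
    define I where "I = {K0<..K1}"
    have I: "real k \<ge> y3\<^sup>2" "real k \<ge> 1" "real k \<le> z / y3\<^sup>2" "real k \<le> z" if "k \<in> I" for k
    proof -
      have "real K0 \<le> real k" "real k \<le> real K1" using that by (auto simp: I_def)
      then show "real k \<ge> y3\<^sup>2" "real k \<ge> 1" "real k \<le> z / y3\<^sup>2" "real k \<le> z" using K0 K1 zy y32 by linarith+
    qed
    have finI: "finite I" by (simp add: I_def)
    have harm: "(\<Sum>k\<in>I. 1 / real k) \<le> y3" "(1 - e) * y3 \<le> (\<Sum>k\<in>I. 1 / real k)"
    proof -
      have "(\<Sum>k\<in>I. 1 / real k) \<le> ln (real K1) - ln (real K0)"
        unfolding I_def using K0 K01 by (intro harmonic_block_bounds) auto
      also have "\<dots> \<le> ln (real K1)" using K0 by simp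
      also have "\<dots> \<le> y3" unfolding y3_def
      proof (rule ln_mono)
        show "0 < real K1" using K01 by simp
        show "real K1 \<le> z" using K1 zy by linarith
      qed
      finally show "(\<Sum>k\<in>I. 1 / real k) \<le> y3" .
      have "ln (z / y3\<^sup>2) \<le> ln (real (Suc K1))"
        by (rule ln_mono) (use z y3 K1 in auto)
      moreover have "ln (real (Suc K0)) \<le> ln (y3\<^sup>2 + 2)"
        by (rule ln_mono) (use K0 in auto)
      moreover have "ln (real (Suc K1)) - ln (real (Suc K0)) \<le> (\<Sum>k\<in>I. 1 / real k)"
        unfolding I_def using K0 K01 by (intro harmonic_block_bounds) auto
      ultimately show "(1 - e) * y3 \<le> (\<Sum>k\<in>I. 1 / real k)" using h7 by linarith
    qed
    define P where "P = (\<lambda>k::nat. {p::nat. prime p \<and> exp (A * real k) * x < real p \<and> real p \<le> exp A * (exp (A * real k) * x)})"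
    define X where "X = (\<lambda>k::nat. c * x / ((real k)\<^sup>2 * y3))"
    define w where "w = (\<lambda>k. nat \<lfloor>X k\<rfloor>)"
    define s where "s = (\<lambda>k::nat. nat \<lfloor>\<mu> * Q / real k\<rfloor>)"
    define L where "L = (\<lambda>k::nat. A * (real k + 1) + z)"
    have X0: "X k > 0" if "k \<in> I" for k using I[OF that] c x y3 by (simp add: X_def)
    have w1: "real (w k) \<le> X k" "real (w k) > X k - 1" if "k \<in> I" for k
    proof -
      have "real (w k) = of_int \<lfloor>X k\<rfloor>" using X0[OF that] by (simp add: w_def)
      then show "real (w k) \<le> X k" "real (w k) > X k - 1" by linarith+
    qed
    have s0: "\<mu> * Q / real k \<ge> 1" if "k \<in> I" for k
    proof -
      have "\<mu> * Q / z \<le> \<mu> * Q / real k" using I[OF that] \<mu>0 Q0 by (intro divide_left_mono) auto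
      then show ?thesis using h5 by linarith
    qed
    have s1: "real (s k) \<le> \<mu> * Q / real k" "real (s k) > \<mu> * Q / real k - 1" "s k \<ge> 1" if "k \<in> I" for k
    proof -
      have "real (s k) = of_int \<lfloor>\<mu> * Q / real k\<rfloor>" using s0[OF that] by (simp add: s_def)
      then show "real (s k) \<le> \<mu> * Q / real k" "real (s k) > \<mu> * Q / real k - 1" by linarith+
      show "s k \<ge> 1" using s0[OF that] by (simp add: s_def le_nat_iff le_floor_iff)
    qed
    \<comment> \<open>\<open>s k\<close> is at most about the square root of \<open>X k\<close>, so removing \<open>s k\<close> primes hardly changes
      their number.\<close>
    have sX: "1 + \<mu> * Q / real k \<le> e * X k" if k: "k \<in> I" for k
    proof -
      have "(real k)\<^sup>2 * y3 + \<mu> * Q * real k * y3 \<le> z\<^sup>2 * y3 + \<mu> * Q * z * y3"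
        using I[OF k] y3 \<mu>0 Q0 by (intro add_mono mult_right_mono mult_left_mono power_mono) auto
      also note h3
      finally have "(real k)\<^sup>2 * y3 + \<mu> * Q * real k * y3 \<le> e * c * x" .
      then have "((real k)\<^sup>2 * y3 + \<mu> * Q * real k * y3) / ((real k)\<^sup>2 * y3) \<le> e * c * x / ((real k)\<^sup>2 * y3)"
        using y3 by (intro divide_right_mono) auto
      moreover have "((real k)\<^sup>2 * y3 + \<mu> * Q * real k * y3) / ((real k)\<^sup>2 * y3) = 1 + \<mu> * Q / real k"
        using I[OF k] y3 by (simp add: field_simps power2_eq_square)
      ultimately show ?thesis by (simp add: X_def)
    qed
    have ws: "real (w k) - real (s k) \<ge> (1 - e) * X k" if k: "k \<in> I" for k
      using w1(2)[OF k] s1(1)[OF k] sX[OF k] by (simp add: left_diff_distrib)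
    have sw: "s k \<le> w k" if k: "k \<in> I" for k
    proof -
      have "0 \<le> (1 - e) * X k" using e X0[OF k] by simp
      then have "real (s k) \<le> real (w k)" using ws[OF k] by linarith
      then show ?thesis by simp
    qed
    have wsr: "real (w k - s k) \<ge> (1 - e) * X k" if k: "k \<in> I" for k
      using ws[OF k] sw[OF k] by (simp add: of_nat_diff)
    have finP: "finite (P k)" for k
    proof (rule finite_subset)
      show "P k \<subseteq> {..nat \<lfloor>exp A * (exp (A * real k) * x)\<rfloor>}" by (auto simp: P_def le_nat_floor)
    qed simp
    have primeP: "prime p" if "p \<in> P k" for p k using that by (simp add: P_def)
    have lnP: "ln (real p) \<le> L k" if "p \<in> P k" for p k
    proof -
      have p0: "real p > 0" using primeP[OF that] prime_gt_0_nat by simp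
      have "real p \<le> exp A * (exp (A * real k) * x)" using that by (simp add: P_def)
      then have "ln (real p) \<le> ln (exp A * (exp (A * real k) * x))" by (rule ln_mono[OF _ p0])
      also have "\<dots> = L k" using x by (simp add: L_def z_def ln_mult distrib_left)
      finally show ?thesis .
    qed
    have Lz: "L k \<le> (1 + e) * z" if k: "k \<in> I" for k
    proof -
      have "A * (real k + 1) \<le> A * (z / y3\<^sup>2 + 1)" using I[OF k] A by (intro mult_left_mono) auto
      then show ?thesis using h1 by (simp add: L_def distrib_right)
    qed
    have disj: "P i \<inter> P j = {}" if "i \<noteq> j" for i j
    proof -
      have "P i \<inter> P j = {}" if "i < j" for i j :: nat
      proof -
        have "A * (1 + real i) \<le> A * real j" using that A by (intro mult_left_mono) auto
        then have "exp A * exp (A * real i) \<le> exp (A * real j)" by (simp add: distrib_left flip: exp_add)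
        then have "exp A * (exp (A * real i) * x) \<le> exp (A * real j) * x" using x by simp
        then show ?thesis by (force simp: P_def)
      qed
      from this[of i j] this[of j i] show ?thesis using that by (cases "i < j") auto
    qed
    define y where "y = (\<lambda>k::nat. exp (A * real k) * x)"
    have y0: "y k > 0" and yP: "\<And>p. p \<in> P k \<Longrightarrow> y k \<le> real p" for k using x by (auto simp: y_def P_def)
    define E where "E = E0 / z"
    have E: "E > 0" using E00 z by (simp add: E_def)
    have EP: "E \<le> (\<Sum>p\<in>P k. 1 / real p) - real (w k) / y k" if k: "k \<in> I" for k
    proof -
      have "1 * 2 \<le> exp (A * real k) * x" using A x by (intro mult_mono) auto
      then have "A - C \<le> (\<Sum>p\<in>P k. ln (real p) / real p)"
        unfolding P_def using A by (intro C(2)) auto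
      also have "\<dots> \<le> (\<Sum>p\<in>P k. (1 + e) * z * (1 / real p))"
      proof (rule sum_mono)
        fix p assume p: "p \<in> P k"
        have "ln (real p) \<le> (1 + e) * z" using lnP[OF p] Lz[OF k] by linarith
        then have "ln (real p) / real p \<le> ((1 + e) * z) / real p" by (rule divide_right_mono) simp
        then show "ln (real p) / real p \<le> (1 + e) * z * (1 / real p)" by simp
      qed
      also have "\<dots> = (1 + e) * z * (\<Sum>p\<in>P k. 1 / real p)" by (simp only: sum_distrib_left)
      finally have 1: "(A - C) / ((1 + e) * z) \<le> (\<Sum>p\<in>P k. 1 / real p)"
        using e z by (simp add: divide_le_eq mult.commute)
      have "real (w k) / y k \<le> X k / y k" using w1(1)[OF k] y0[of k] by (intro divide_right_mono) auto
      also have "\<dots> = c / ((real k)\<^sup>2 * y3 * exp (A * real k))" using x by (simp add: X_def y_def)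
      also have "\<dots> \<le> c / exp (A * y3\<^sup>2)"
      proof (intro divide_left_mono mult_pos_pos)
        have "1 \<le> (real k)\<^sup>2 * y3" using I[OF k] y3 mult_mono[of 1 "(real k)\<^sup>2" 1 y3] by simp
        moreover have "A * y3\<^sup>2 \<le> A * real k" using I[OF k] A by (intro mult_left_mono) auto
        ultimately have "1 * exp (A * y3\<^sup>2) \<le> ((real k)\<^sup>2 * y3) * exp (A * real k)" by (intro mult_mono) auto
        then show "exp (A * y3\<^sup>2) \<le> (real k)\<^sup>2 * y3 * exp (A * real k)" by simp
      qed (use c I[OF k] y3 in auto)
      also have "\<dots> \<le> e / z" using h2 z by (simp add: field_simps)
      finally have 2: "real (w k) / y k \<le> e / z" .
      have "E = (A - C) / ((1 + e) * z) - e / z" by (simp add: E_def E0_def diff_divide_distrib)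
      with 1 2 show ?thesis by linarith
    qed
    have wcard: "w k \<le> card (P k)" if k: "k \<in> I" for k
    proof -
      have "(\<Sum>p\<in>P k. 1 / real p) \<le> (\<Sum>p\<in>P k. 1 / y k)"
      proof (rule sum_mono)
        fix p assume p: "p \<in> P k"
        have "0 < real p" using y0[of k] yP[OF p] by linarith
        then show "1 / real p \<le> 1 / y k" using y0[of k] yP[OF p] by (intro divide_left_mono mult_pos_pos) auto
      qed
      also have "\<dots> = real (card (P k)) / y k" by simp
      finally have "real (w k) / y k \<le> real (card (P k)) / y k" using EP[OF k] E by linarith
      then show ?thesis using y0[of k] by (simp add: divide_le_cancel)
    qed
    have sE: "(real (s k))\<^sup>2 \<le> E * real (w k - s k)" if k: "k \<in> I" for k
    proof -
      have "(real (s k))\<^sup>2 \<le> (\<mu> * Q / real k)\<^sup>2" using s1[OF k] by (intro power_mono) auto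
      also have "\<dots> = \<mu>\<^sup>2 * (x / (z * y3)) / (real k)\<^sup>2" by (simp add: power_divide power_mult_distrib Q2)
      also have "\<dots> \<le> (E0 * (1 - e) * c) * (x / (z * y3)) / (real k)\<^sup>2"
        using x z y3 by (intro divide_right_mono mult_right_mono \<mu>2) auto
      also have "\<dots> = E * ((1 - e) * X k)" by (simp add: E_def X_def mult_ac)
      also have "\<dots> \<le> E * real (w k - s k)" using E by (intro mult_left_mono wsr[OF k]) auto
      finally show ?thesis .
    qed
    have gain: "real (w k choose s k) * sqrt (esym (P k) (w k) / esym (P k) (w k - s k)) \<ge> exp (\<mu> * Q / real k - 2 - ln (\<mu> * Q))" if k: "k \<in> I" for k
    proof -
      have "real (w k choose s k) * sqrt (esym (P k) (w k) / esym (P k) (w k - s k)) \<ge> real (s k) ^ s k / fact (s k)"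
        by (rule block_gain[OF finP _ y0 yP _ EP[OF k] sw[OF k] wcard[OF k] sE[OF k]])
           (use E prime_gt_0_nat primeP in auto)
      moreover have "real (s k) ^ s k / fact (s k) \<ge> exp (real (s k) - 1 - ln (real (s k)))"
        by (rule power_div_fact_ge[OF s1(3)[OF k]])
      moreover have "\<mu> * Q / real k - 2 - ln (\<mu> * Q) \<le> real (s k) - 1 - ln (real (s k))"
      proof -
        have "\<mu> * Q / real k \<le> \<mu> * Q / 1" using I[OF k] \<mu>0 Q0 by (intro divide_left_mono) auto
        then have "real (s k) \<le> \<mu> * Q" using s1(1)[OF k] by simp
        then have "ln (real (s k)) \<le> ln (\<mu> * Q)" using s1(3)[OF k] by (intro ln_mono) auto
        then show ?thesis using s1(2)[OF k] by linarith
      qed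
      ultimately show ?thesis by (meson exp_le_cancel_iff order_trans)
    qed
    have count: "real (card (P k) choose j) \<le> exp (lam * x / y3 * (1 / real k))" if k: "k \<in> I" and j: "j = w k \<or> j = w k - s k" for k j
    proof -
      define B where "B = exp (A * real k + A) * x"
      have cardP: "real (card (P k)) \<le> B"
      proof -
        have "P k \<subseteq> {1..nat \<lfloor>B\<rfloor>}"
          using primeP[of _ k] by (auto simp: P_def B_def exp_add le_nat_floor mult_ac Suc_le_eq prime_gt_0_nat)
        from card_mono[OF _ this] have "card (P k) \<le> nat \<lfloor>B\<rfloor>" by simp
        moreover have "B \<ge> 0" using x by (simp add: B_def)
        ultimately show ?thesis by linarith
      qed
      have XB: "exp 1 * B / (X k / 2) = exp (1 + A * real k + A + ln (2 * (real k)\<^sup>2 * y3 / c))"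
        using I[OF k] y3 c x by (simp add: X_def B_def exp_add mult_ac)
      have lnb: "1 + A * real k + A + ln (2 * (real k)\<^sup>2 * y3 / c) \<le> (1 + e) * A * real k"
      proof -
        have "2 * (real k)\<^sup>2 * y3 / c \<le> 2 * z\<^sup>2 * y3 / c"
          using I[OF k] y3 c by (intro divide_right_mono mult_right_mono mult_left_mono power_mono) auto
        then have "ln (2 * (real k)\<^sup>2 * y3 / c) \<le> ln (2 * z\<^sup>2 * y3 / c)"
          using I[OF k] y3 c by (intro ln_mono) auto
        moreover have "e * A * y3\<^sup>2 \<le> e * A * real k" using I[OF k] e A by (intro mult_left_mono) auto
        moreover have "(1 + e) * A * real k = A * real k + e * A * real k" by (simp add: algebra_simps)
        ultimately show ?thesis using h4 by linarith
      qed
      have X2: "X k / 2 > 0" "X k / 2 \<le> real j"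
      proof -
        show "X k / 2 > 0" using X0[OF k] by simp
        have "X k * (1/2) \<le> X k * (1 - e)" using X0[OF k] e by (intro mult_left_mono) auto
        then have "X k / 2 \<le> real (w k - s k)" using wsr[OF k] by (simp add: mult.commute)
        moreover have "real (w k - s k) \<le> real (w k)" by simp
        ultimately show "X k / 2 \<le> real j" using j by auto
      qed
      have "real (card (P k) choose j) \<le> (exp 1 * B / (X k / 2)) ^ w k"
      proof (rule binomial_le_exp_power[OF X2 _ cardP])
        show "j \<le> w k" using j by auto
        have "X k / 2 \<le> real j" by (rule X2)
        also have "\<dots> \<le> real (w k)" using j by auto
        also have "\<dots> \<le> real (card (P k))" using wcard[OF k] by simp
        also note cardP
        also have "1 * B \<le> exp 1 * B" by (rule mult_right_mono) (use x in \<open>auto simp: B_def\<close>)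
        finally show "X k / 2 \<le> exp 1 * B" by simp
      qed
      also have "\<dots> \<le> exp ((1 + e) * A * real k) ^ w k" unfolding XB using lnb by (intro power_mono) auto
      also have "\<dots> = exp (real (w k) * ((1 + e) * A * real k))" by (simp add: exp_of_nat_mult)
      also have "\<dots> \<le> exp (X k * ((1 + e) * A * real k))"
      proof -
        have "real (w k) * ((1 + e) * A * real k) \<le> X k * ((1 + e) * A * real k)"
          using e A by (intro mult_right_mono w1(1)[OF k]) auto
        then show ?thesis by simp
      qed
      also have "X k * ((1 + e) * A * real k) = ((1 + e) * A * c) * x / y3 * (1 / real k)"
        using I[OF k] by (simp add: X_def power2_eq_square mult_ac)
      also have "(1 + e) * A * c = lam" by (rule cA)
      finally show ?thesis .
    qed
    have prodcount: "(\<Prod>k\<in>I. real (card (P k) choose j k)) \<le> exp (lam * x)" if j: "\<And>k. k \<in> I \<Longrightarrow> j k = w k \<or> j k = w k - s k" for j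
    proof -
      have "(\<Prod>k\<in>I. real (card (P k) choose j k)) \<le> (\<Prod>k\<in>I. exp (lam * x / y3 * (1 / real k)))"
        using count j by (intro prod_mono) auto
      also have "\<dots> = exp (lam * x / y3 * (\<Sum>k\<in>I. 1 / real k))"
        by (simp only: exp_sum[OF finI, symmetric] sum_distrib_left)
      also have "\<dots> \<le> exp (lam * x / y3 * y3)"
      proof -
        have "lam * x / y3 * (\<Sum>k\<in>I. 1 / real k) \<le> lam * x / y3 * y3"
          by (rule mult_left_mono[OF harm(1)]) (use lam x y3 in auto)
        then show ?thesis by simp
      qed
      finally show ?thesis using y3 by simp
    qed
    have ex1: "\<exists>k\<in>I. s k \<ge> 1"
    proof -
      have "K1 \<in> I" using K01 by (simp add: I_def)
      then show ?thesis using s1(3) by blast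
    qed
    have Lsum: "(\<Sum>i\<in>I. real (s i) * L i) \<le> \<eta> * x"
    proof -
      have "(\<Sum>i\<in>I. real (s i) * L i) \<le> (\<Sum>i\<in>I. (\<mu> * Q / real i) * (2 * z))"
      proof (rule sum_mono)
        fix i assume i: "i \<in> I"
        have "(1 + e) * z \<le> 2 * z" using e z by (intro mult_right_mono) auto
        then have "L i \<le> 2 * z" using Lz[OF i] by linarith
        moreover have "0 \<le> L i" using A z I[OF i] by (simp add: L_def)
        ultimately show "real (s i) * L i \<le> (\<mu> * Q / real i) * (2 * z)"
          using s1(1)[OF i] s0[OF i] by (intro mult_mono) auto
      qed
      also have "\<dots> = 2 * z * \<mu> * Q * (\<Sum>i\<in>I. 1 / real i)" by (simp add: sum_distrib_left mult_ac)
      also have "\<dots> \<le> 2 * z * \<mu> * Q * y3" using harm(1) z \<mu>0 Q0 by (intro mult_left_mono) auto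
      also have "\<dots> = 2 * z * \<mu> * Psi" using QP by (simp add: mult.assoc)
      also note h9
      finally show ?thesis .
    qed
    have total: "(\<Prod>i\<in>I. real (w i choose s i) * sqrt (esym (P i) (w i) / esym (P i) (w i - s i))) \<ge> exp (\<rho> * Psi)"
    proof -
      have Psi0: "Psi \<ge> 0" using x y3 z by (simp add: Psi_def)
      have muQ: "\<mu> * Q \<ge> 1" using h5 z by (simp add: le_divide_eq split: if_splits)
      have cardI: "real (card I) \<le> z" using K1 zy by (simp add: I_def of_nat_diff)
      have "\<rho> * Psi \<le> (\<mu> * (1 - 2 * e)) * Psi" using \<mu> Psi0 by (intro mult_right_mono) auto
      also have "\<dots> = \<mu> * ((1 - e) * Psi) - e * \<mu> * Psi" by (simp add: algebra_simps)
      also have "\<dots> \<le> \<mu> * Q * (\<Sum>k\<in>I. 1 / real k) - real (card I) * (2 + ln (\<mu> * Q))"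
      proof -
        have "\<mu> * ((1 - e) * Psi) = \<mu> * Q * ((1 - e) * y3)" using QP by (simp add: mult_ac)
        also have "\<dots> \<le> \<mu> * Q * (\<Sum>k\<in>I. 1 / real k)" using harm(2) \<mu>0 Q0 by (intro mult_left_mono) auto
        finally have 1: "\<mu> * ((1 - e) * Psi) \<le> \<mu> * Q * (\<Sum>k\<in>I. 1 / real k)" .
        have "real (card I) * (2 + ln (\<mu> * Q)) \<le> z * (2 + ln (\<mu> * Q))" using cardI muQ by (intro mult_right_mono) auto
        then show ?thesis using 1 h8 by linarith
      qed
      also have "\<dots> = (\<Sum>k\<in>I. \<mu> * Q / real k - 2 - ln (\<mu> * Q))"
        by (simp add: sum_subtractf sum_distrib_left algebra_simps)
      finally have "exp (\<rho> * Psi) \<le> exp (\<Sum>k\<in>I. \<mu> * Q / real k - 2 - ln (\<mu> * Q))" by simp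
      also have "\<dots> = (\<Prod>k\<in>I. exp (\<mu> * Q / real k - 2 - ln (\<mu> * Q)))" by (rule exp_sum[OF finI])
      also have "\<dots> \<le> (\<Prod>i\<in>I. real (w i choose s i) * sqrt (esym (P i) (w i) / esym (P i) (w i - s i)))"
        using gain by (intro prod_mono) auto
      finally show ?thesis .
    qed
    have f1: "\<And>i. i \<in> I \<Longrightarrow> finite (P i)" and f2: "\<And>i p. i \<in> I \<Longrightarrow> p \<in> P i \<Longrightarrow> prime p"
      and f3: "\<And>i j. i \<in> I \<Longrightarrow> j \<in> I \<Longrightarrow> i \<noteq> j \<Longrightarrow> P i \<inter> P j = {}" and f4: "\<And>i p. i \<in> I \<Longrightarrow> p \<in> P i \<Longrightarrow> ln (real p) \<le> L i"
      using finP primeP disj lnP by auto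
    show ?case
    proof (rule layered_resonator[OF finI f1 f2 f3 wcard sw ex1 f4])
      fix M :: "nat set" and f :: "nat \<Rightarrow> real"
      assume M: "finite M" "0 \<notin> M" "\<And>m. f m \<ge> 0"
        "card M \<le> (\<Prod>i\<in>I. card (P i) choose w i) + (\<Prod>i\<in>I. card (P i) choose (w i - s i))"
        "(\<Sum>m\<in>M. (f m)\<^sup>2) \<le> 4"
        "\<And>a c. (\<And>k. a k \<ge> 0) \<Longrightarrow> (\<And>k. k \<ge> 2 \<Longrightarrow> ln (real k) \<le> (\<Sum>i\<in>I. real (s i) * L i) \<Longrightarrow> a k \<ge> c * real k powr (-1/2)) \<Longrightarrow> c \<ge> 0 \<Longrightarrow>
          dvd_pair_sum M a f \<ge> c * (\<Prod>i\<in>I. real (w i choose s i) * sqrt (esym (P i) (w i) / esym (P i) (w i - s i)))"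
    have cardM: "real (card M) \<le> 2 * exp (lam * x)"
    proof -
      have "real (card M) \<le> real ((\<Prod>i\<in>I. card (P i) choose w i) + (\<Prod>i\<in>I. card (P i) choose (w i - s i)))"
        by (rule of_nat_mono[OF M(4)])
      also have "\<dots> = (\<Prod>i\<in>I. real (card (P i) choose w i)) + (\<Prod>i\<in>I. real (card (P i) choose (w i - s i)))"
        by simp
      also have "\<dots> \<le> exp (lam * x) + exp (lam * x)" by (intro add_mono prodcount) auto
      finally show ?thesis by simp
    qed
    have fin: "dvd_pair_sum M a f \<ge> c' * exp (\<rho> * Psi)"
      if a: "\<forall>k. a k \<ge> 0" "\<forall>k\<ge>2. ln (real k) \<le> \<eta> * x \<longrightarrow> a k \<ge> c' * real k powr (-1/2)" and c': "c' \<ge> 0" for a c'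
    proof -
      have "c' * exp (\<rho> * Psi) \<le> c' * (\<Prod>i\<in>I. real (w i choose s i) * sqrt (esym (P i) (w i) / esym (P i) (w i - s i)))"
        by (rule mult_left_mono[OF total c'])
      also have "\<dots> \<le> dvd_pair_sum M a f"
      proof (rule M(6))
        show "a k \<ge> c' * real k powr (-1/2)" if "k \<ge> 2" "ln (real k) \<le> (\<Sum>i\<in>I. real (s i) * L i)" for k
          using a(2) that Lsum by auto
      qed (use a(1) c' in auto)
      finally show ?thesis .
    qed
    show ?case
      unfolding z_def[symmetric] y3_def[symmetric] Psi_def[symmetric]
      by (intro HOL.exI[of _ M] HOL.exI[of _ f] conjI allI impI M(1-3,5) cardM fin) auto
    qed
  qed
qed

section \<open>Large values\<close>

text \<open>
  The balance of exponents: with \<open>T = exp x\<close>, the unknown range \<open>|t| \<le> T^b\<close> contributes \<open>T^b\<close>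
  times \<open>card M \<le> 2 T^lam\<close> times \<open>\<Sum> a k\<close>, which is \<open>T^(2\<eta>)\<close> up to logarithms, and this is small compared
  with \<open>T\<close> because \<open>lam + b + 4\<eta> \<le> 1\<close>. All other losses are powers of \<open>x\<close> and are absorbed by the gap
  between \<open>\<rho>0\<close> and \<open>\<rho>1\<close>. The condition \<open>2\<eta> < b\<close> makes the error from the pole of zeta small.
\<close>
lemma zeta_deriv_large_exponents:
  assumes l: "l > 0" and b: "0 \<le> \<beta>" "\<beta> < b" "b < 1" and \<eta>: "\<eta> > 0" "\<eta> < 1" and lam: "lam > 0" "lam + b + 4 * \<eta> \<le> 1" and \<rho>: "0 < \<rho>0" "\<rho>0 < \<rho>1" "\<rho>1 < sqrt lam"
    and \<kappa>: "2 * \<eta> < b"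
  shows "\<forall>\<^sub>F x in at_top. \<forall>S. (\<forall>y. exp (\<beta> * x) \<le> y \<and> y \<le> exp x \<longrightarrow> Re (zeta_crit l y) \<le> S) \<longrightarrow>
     exp (\<rho>0 * sqrt (x * ln (ln x) / ln x)) \<le> S"
proof -
  \<comment> \<open>The window leaves the interval only at a distance of at least \<open>U = exp (b * x) / 2\<close>, and \<open>U ^ m\<close>
    beats the linear growth of the derivative on the critical line.\<close>
  define m where "m = nat \<lceil>2 / b\<rceil>"
  have b0: "b > 0" using b by linarith
  have m: "real m * b \<ge> 2"
  proof -
    have "2 / b \<le> real m" unfolding m_def by linarith
    then show ?thesis using b0 by (simp add: field_simps)
  qed
  obtain C1 where C1: "C1 > 0"
    "\<And>v J t S U y1 y2. v \<ge> 1 \<Longrightarrow> U > 0 \<Longrightarrow> S \<ge> 0 \<Longrightarrow> y1 + U \<le> t \<Longrightarrow> t + U \<le> y2 \<Longrightarrow>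
      (\<And>y. y1 \<le> y \<Longrightarrow> y \<le> y2 \<Longrightarrow> Re (zeta_crit l y) \<le> S) \<Longrightarrow>
      (\<Sum>n. smooth_coeff l v J (Suc n) * cos (t * ln (real (Suc n)))) \<le>
        C1 * real J * sqrt v * S + C1 * real J * v ^ (m + 2) * (1 + \<bar>t\<bar>) / U ^ m + C1 * v ^ 2 * real J * exp (2 * real J) / (1 + \<bar>t\<bar>)"
    by (rule smoothed_sum_le_sup[where l=l and m=m]) blast
  obtain C2 where C2: "C2 > 0" 
    "\<And>v J. v \<ge> 1 \<Longrightarrow> summable (\<lambda>n. \<bar>smooth_coeff l v J (Suc n)\<bar>)"
    "\<And>v J. v \<ge> 1 \<Longrightarrow> (\<Sum>n. \<bar>smooth_coeff l v J (Suc n)\<bar>) \<le> C2 * sqrt v * real J * exp (2 * real J)"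
    by (rule smooth_coeff_sum[of l]) blast
  define K where "K = exp (-1/2) * (ln 2 ^ l / 4 :: real)"
  have K: "K > 0" by (simp add: K_def)
  \<comment> \<open>Upper bounds, without rounding, for the parameters \<open>J\<close> and \<open>v\<close> of the weight.\<close>
  define Jb where "Jb = (\<lambda>x. \<eta> * x + 1)"
  define vb where "vb = (\<lambda>x. 6 * ln (4 * Jb x))"
  define k where "k = real (m + 2)"
  have k: "k > 0" by (simp add: k_def)
  define k2 where "k2 = (2::real) ^ (m + 1)"
  have k2: "k2 > 0" by (simp add: k2_def)
  define d where "d = \<rho>1 - \<rho>0"
  have d: "d > 0" using \<rho> by (simp add: d_def)
  define kap where "kap = b - 2 * \<eta>"
  have kap: "kap > 0" using \<kappa> by (simp add: kap_def)
  define gap where "gap = b - \<beta>"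
  have gap: "gap > 0" using b by (simp add: gap_def)
  have ev: "\<forall>\<^sub>F x in at_top. x \<ge> 1 \<and> ln x \<ge> 1 \<and> ln (ln x) \<ge> 1 \<and> gap * x \<ge> ln 2
     \<and> k * ln (vb x) \<le> \<eta> * x
     \<and> C1 * Jb x * (k2 * exp ((\<eta> - 1) * x)) \<le> 1
     \<and> C1 * (vb x)\<^sup>2 * Jb x * (exp 2 * exp (- kap * x)) \<le> 1
     \<and> C2 * sqrt (vb x) * Jb x * (2 * exp 2 * (2 * x * exp (- (2 * \<eta>) * x) + 2 * exp ((2 * \<eta> + lam) * x - x\<^sup>2 / 16))) \<le> 1
     \<and> 24 * C1 * Jb x * sqrt (vb x) + 52 < K * (4 * Jb x) powr (-3/4) * exp (d * sqrt (x * ln (ln x) / ln x))"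
    unfolding vb_def Jb_def
  proof (intro eventually_conj)
    show "\<forall>\<^sub>F x::real in at_top. 1 \<le> x" by real_asymp
    show "\<forall>\<^sub>F x::real in at_top. 1 \<le> ln x" by real_asymp
    show "\<forall>\<^sub>F x::real in at_top. 1 \<le> ln (ln x)" by real_asymp
    show "\<forall>\<^sub>F x::real in at_top. ln 2 \<le> gap * x" using gap by real_asymp
    show "\<forall>\<^sub>F x::real in at_top. k * ln (6 * ln (4 * (\<eta> * x + 1))) \<le> \<eta> * x" using k \<eta>(1) by real_asymp
    show "\<forall>\<^sub>F x::real in at_top. C1 * (\<eta> * x + 1) * (k2 * exp ((\<eta> - 1) * x)) \<le> 1" using C1(1) k2 \<eta> by real_asymp
    show "\<forall>\<^sub>F x::real in at_top. C1 * (6 * ln (4 * (\<eta> * x + 1)))\<^sup>2 * (\<eta> * x + 1) * (exp 2 * exp (- kap * x)) \<le> 1" using C1(1) \<eta>(1) kap by real_asymp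
    show "\<forall>\<^sub>F x::real in at_top. C2 * sqrt (6 * ln (4 * (\<eta> * x + 1))) * (\<eta> * x + 1) * (2 * exp 2 * (2 * x * exp (- (2 * \<eta>) * x) + 2 * exp ((2 * \<eta> + lam) * x - x\<^sup>2 / 16))) \<le> 1" 
      using C2(1) \<eta>(1) lam(1) by real_asymp
    show "\<forall>\<^sub>F x::real in at_top. 24 * C1 * (\<eta> * x + 1) * sqrt (6 * ln (4 * (\<eta> * x + 1))) + 52 < K * (4 * (\<eta> * x + 1)) powr (-3/4) * exp (d * sqrt (x * ln (ln x) / ln x))"
      using C1(1) K d \<eta>(1) by real_asymp
  qed
  have res: "\<forall>\<^sub>F x in at_top. \<exists>(M :: nat set) f. finite M \<and> 0 \<notin> M \<and> (\<forall>m. f m \<ge> 0) \<and>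
     real (card M) \<le> 2 * exp (lam * x) \<and> (\<Sum>m\<in>M. (f m)\<^sup>2) \<le> (4::real) \<and>
     (\<forall>a c. (\<forall>k. a k \<ge> 0) \<longrightarrow> (\<forall>k\<ge>2. ln (real k) \<le> \<eta> * x \<longrightarrow> a k \<ge> c * real k powr (-1/2)) \<longrightarrow> c \<ge> 0 \<longrightarrow>
       dvd_pair_sum M a f \<ge> c * exp (\<rho>1 * sqrt (x * ln (ln x) / ln x)))"
    by (rule resonator_exists) (use lam \<rho> \<eta> in auto)
  show ?thesis
    using ev res
  proof eventually_elim
    case (elim x)
    define Psi where "Psi = sqrt (x * ln (ln x) / ln x)"
    have x: "x \<ge> 1" "ln x \<ge> 1" "ln (ln x) \<ge> 1" "gap * x \<ge> ln 2" using elim by auto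
    have Psi: "Psi \<ge> 0" using x by (simp add: Psi_def)
    have h1: "k * ln (vb x) \<le> \<eta> * x"
      and h2: "C1 * Jb x * (k2 * exp ((\<eta> - 1) * x)) \<le> 1"
      and h3: "C1 * (vb x)\<^sup>2 * Jb x * (exp 2 * exp (- kap * x)) \<le> 1"
      and h4: "C2 * sqrt (vb x) * Jb x * (2 * exp 2 * (2 * x * exp (- (2 * \<eta>) * x) + 2 * exp ((2 * \<eta> + lam) * x - x\<^sup>2 / 16))) \<le> 1"
      and h5: "24 * C1 * Jb x * sqrt (vb x) + 52 < K * (4 * Jb x) powr (-3/4) * exp (d * Psi)"
      using elim by (simp_all add: Psi_def)
    define J where "J = nat \<lceil>\<eta> * x\<rceil>"
    have J: "\<eta> * x \<le> real J" "real J \<le> Jb x" "J \<ge> 1"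
    proof -
      have "\<eta> * x > 0" using \<eta> x by simp
      then have "real J = of_int \<lceil>\<eta> * x\<rceil>" by (simp add: J_def)
      then show "\<eta> * x \<le> real J" "real J \<le> Jb x" unfolding Jb_def by linarith+
      then show "J \<ge> 1" using \<open>\<eta> * x > 0\<close> by linarith
    qed
    define v where "v = 6 * ln (4 * real J)"
    have v1: "v \<ge> 1"
    proof -
      have "ln 4 \<le> ln (4 * real J)" using J by (intro ln_mono) auto
      moreover have "ln 4 = 2 * ln (2::real)" using ln_realpow[of 2 2] by simp
      ultimately show ?thesis using ln2_ge_two_thirds by (simp add: v_def)
    qed
    have vle: "v \<le> vb x" unfolding v_def vb_def using J by (intro mult_left_mono ln_mono) auto
    have vb0: "vb x \<ge> 1" using v1 vle by linarith
    have ev8: "exp (- v / 8) = (4 * real J) powr (-3/4)"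
      using J by (simp add: v_def powr_def)
    have eJ: "exp (2 * real J) \<le> exp (2 * \<eta> * x) * exp 2"
      using J(2) by (simp add: Jb_def flip: exp_add)
    show ?case
    proof (intro allI impI)
      fix S assume S: "\<forall>y. exp (\<beta> * x) \<le> y \<and> y \<le> exp x \<longrightarrow> Re (zeta_crit l y) \<le> S"
      define Sp where "Sp = max S 0"
      define a where "a = smooth_coeff l v J"
      define V where "V = C1 * real J * sqrt v * Sp + 2"
      have V0: "V \<ge> 0" using C1(1) v1 by (auto simp: V_def Sp_def intro!: add_nonneg_nonneg mult_nonneg_nonneg)
      have bound: "(\<Sum>n. a (Suc n) * cos (t * ln (real (Suc n)))) \<le> V" if t: "exp (b * x) \<le> t" "t \<le> exp x / 2" for t
      proof -
        have t0: "0 < t" using t(1) exp_gt_zero[of "b * x"] by linarith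
        have "(\<Sum>n. a (Suc n) * cos (t * ln (real (Suc n)))) \<le> C1 * real J * sqrt v * Sp + C1 * real J * v ^ (m + 2) * (1 + \<bar>t\<bar>) / (exp (b * x) / 2) ^ m + C1 * v ^ 2 * real J * exp (2 * real J) / (1 + \<bar>t\<bar>)"
          unfolding a_def
        proof (rule C1(2)[OF v1, where U="exp (b * x) / 2" and ?y1.0="exp (\<beta> * x)" and ?y2.0="exp x"])
          have "\<beta> * x + ln 2 \<le> b * x" using x(4) by (simp add: gap_def algebra_simps)
          then have "exp (\<beta> * x + ln 2) \<le> exp (b * x)" by simp
          then have "exp (\<beta> * x) \<le> exp (b * x) / 2" by (simp add: exp_add)
          then show "exp (\<beta> * x) + exp (b * x) / 2 \<le> t" using t by linarith
          have "exp (b * x) \<le> exp x" using b x by (simp add: mult_le_cancel_right1)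
          then show "t + exp (b * x) / 2 \<le> exp x" using t by linarith
          show "Re (zeta_crit l y) \<le> Sp" if "exp (\<beta> * x) \<le> y" "y \<le> exp x" for y
          proof -
            have "Re (zeta_crit l y) \<le> S" using S that by blast
            then show ?thesis by (simp add: Sp_def)
          qed
        qed (simp_all add: Sp_def)
        also have "C1 * real J * v ^ (m + 2) * (1 + \<bar>t\<bar>) / (exp (b * x) / 2) ^ m \<le> 1"
        proof -
          have "v ^ (m + 2) \<le> (vb x) ^ (m + 2)" using vle v1 by (intro power_mono) auto
          also have "\<dots> = exp (k * ln (vb x))"
          proof -
            have "exp (real (m + 2) * ln (vb x)) = exp (ln (vb x)) ^ (m + 2)" by (rule exp_of_nat_mult)
            then show ?thesis using vb0 by (simp add: k_def)
          qed
          also have "\<dots> \<le> exp (\<eta> * x)" using h1 by simp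
          finally have p1: "v ^ (m + 2) \<le> exp (\<eta> * x)" .
          have p2: "1 + \<bar>t\<bar> \<le> 2 * exp x"
          proof -
            have "1 \<le> exp x" using x by simp
            then show ?thesis using t t0 by linarith
          qed
          have p3: "1 / (exp (b * x) / 2) ^ m \<le> 2 ^ m * exp (- 2 * x)"
          proof -
            have "2 * x \<le> real m * (b * x)" using mult_right_mono[OF m, of x] x by (simp add: mult.assoc)
            then have "exp (- (real m * (b * x))) \<le> exp (- 2 * x)" by simp
            moreover have "1 / (exp (b * x) / 2) ^ m = 2 ^ m * exp (- (real m * (b * x)))"
              by (simp add: power_divide exp_minus exp_of_nat_mult[symmetric] field_simps)
            ultimately show ?thesis by simp
          qed
          have "C1 * real J * v ^ (m + 2) * (1 + \<bar>t\<bar>) / (exp (b * x) / 2) ^ m = (C1 * real J) * (v ^ (m + 2) * (1 + \<bar>t\<bar>) * (1 / (exp (b * x) / 2) ^ m))" by simp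
          also have "\<dots> \<le> (C1 * Jb x) * (exp (\<eta> * x) * (2 * exp x) * (2 ^ m * exp (- 2 * x)))"
            using C1(1) J v1 p1 p2 p3 by (intro mult_mono mult_nonneg_nonneg) auto
          also have "\<dots> = C1 * Jb x * (k2 * (exp (\<eta> * x) * exp x * exp (- 2 * x)))" by (simp add: k2_def)
          also have "exp (\<eta> * x) * exp x * exp (- 2 * x) = exp ((\<eta> - 1) * x)"
            unfolding mult_exp_exp by (simp add: algebra_simps)
          also note h2
          finally show ?thesis .
        qed
        also have "C1 * v ^ 2 * real J * exp (2 * real J) / (1 + \<bar>t\<bar>) \<le> 1"
        proof -
          have q1: "1 / (1 + \<bar>t\<bar>) \<le> exp (- (b * x))"
          proof -
            have "1 / (1 + \<bar>t\<bar>) \<le> 1 / exp (b * x)" using t t0 by (intro divide_left_mono) auto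
            then show ?thesis by (simp add: exp_minus inverse_eq_divide)
          qed
          have "C1 * v ^ 2 * real J * exp (2 * real J) / (1 + \<bar>t\<bar>) = C1 * v ^ 2 * real J * (exp (2 * real J) * (1 / (1 + \<bar>t\<bar>)))" by simp
          also have "\<dots> \<le> C1 * (vb x) ^ 2 * Jb x * ((exp (2 * \<eta> * x) * exp 2) * exp (- (b * x)))"
            using C1(1) J v1 vle eJ q1 by (intro mult_mono mult_nonneg_nonneg power_mono) auto
          also have "(exp (2 * \<eta> * x) * exp 2) * exp (- (b * x)) = exp 2 * (exp (2 * \<eta> * x) * exp (- (b * x)))" by simp
          also have "exp (2 * \<eta> * x) * exp (- (b * x)) = exp (- kap * x)"
            unfolding mult_exp_exp by (simp add: kap_def algebra_simps)
          also note h3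
          finally show ?thesis .
        qed
        finally show ?thesis by (simp add: V_def)
      qed
      obtain M f where M: "finite M" "0 \<notin> M" "\<And>m. f m \<ge> 0" "real (card M) \<le> 2 * exp (lam * x)" "(\<Sum>m\<in>M. (f m)\<^sup>2) \<le> (4::real)"
        "\<And>a c. (\<forall>k. a k \<ge> 0) \<Longrightarrow> (\<forall>k\<ge>2. ln (real k) \<le> \<eta> * x \<longrightarrow> a k \<ge> c * real k powr (-1/2)) \<Longrightarrow> c \<ge> 0 \<Longrightarrow>
         dvd_pair_sum M a f \<ge> c * exp (\<rho>1 * Psi)"
        using elim(2) unfolding Psi_def by blast
      have a0: "a k \<ge> 0" for k unfolding a_def using l J by (intro smooth_coeff_nonneg) (auto simp: v_def)
      have asum: "summable (\<lambda>n. a (Suc n))" using C2(2)[OF v1, of J] a0 by (simp add: a_def)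
      have A0: "(\<Sum>n. a (Suc n)) \<le> C2 * sqrt v * real J * exp (2 * real J)"
        using C2(3)[OF v1, of J] a0 by (simp add: a_def)
      define R where "R = dvd_pair_sum M a f"
      define c where "c = (ln 2 ^ l / 4) * sqrt v * exp (- v / 8)"
      have c0: "c \<ge> 0" using v1 by (simp add: c_def)
      have R1: "c * exp (\<rho>1 * Psi) \<le> R"
        unfolding R_def
      proof (rule M(6))
        show "\<forall>k\<ge>2. ln (real k) \<le> \<eta> * x \<longrightarrow> a k \<ge> c * real k powr (-1/2)"
          unfolding a_def c_def using J by (intro allI impI smooth_coeff_lower) (auto simp: v_def)
      qed (use a0 c0 in auto)
      \<comment> \<open>A little less than \<open>T = exp x\<close>, so that the Gaussian is negligible from \<open>T / 2\<close> on.\<close>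
      define \<tau> where "\<tau> = exp x / x"
      have \<tau>: "\<tau> > 0" using x by (simp add: \<tau>_def)
      define W where "W = (\<Sum>n. a (Suc n)) * real (card M) * (2 * exp (b * x) / \<tau> + 2 * exp (- (exp x / 2)\<^sup>2 / (4 * \<tau>\<^sup>2)))"
      have R2: "exp (-1/2) * R \<le> (6 * V + W) * (\<Sum>m\<in>M. (f m)\<^sup>2)"
        unfolding R_def W_def
        by (rule resonance[OF a0 asum M(1,2,3) \<tau> _ _ V0 bound]) auto
      have W1: "W \<le> 1"
      proof -
        have w1: "2 * exp (b * x) / \<tau> = 2 * x * exp ((b - 1) * x)"
          by (simp add: \<tau>_def left_diff_distrib exp_diff)
        have w2: "- (exp x / 2)\<^sup>2 / (4 * \<tau>\<^sup>2) = - x\<^sup>2 / 16"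
          using x by (simp add: \<tau>_def power_divide)
        have "W \<le> (C2 * sqrt v * real J * exp (2 * real J)) * (2 * exp (lam * x)) * (2 * x * exp ((b - 1) * x) + 2 * exp (- x\<^sup>2 / 16))"
          unfolding W_def w1 w2 using M(4) A0 x C2(1) v1 suminf_nonneg[OF asum a0]
          by (intro mult_mono mult_nonneg_nonneg) (auto intro!: add_nonneg_nonneg mult_nonneg_nonneg)
        also have "\<dots> \<le> (C2 * sqrt (vb x) * Jb x * (exp (2 * \<eta> * x) * exp 2)) * (2 * exp (lam * x)) * (2 * x * exp ((b - 1) * x) + 2 * exp (- x\<^sup>2 / 16))"
          using C2(1) v1 vle J eJ x by (intro mult_mono mult_nonneg_nonneg) (auto intro!: add_nonneg_nonneg mult_nonneg_nonneg)
        also have "\<dots> = C2 * sqrt (vb x) * Jb x * (2 * exp 2 * (2 * x * (exp (2 * \<eta> * x) * exp (lam * x) * exp ((b - 1) * x)) + 2 * (exp (2 * \<eta> * x) * exp (lam * x) * exp (- x\<^sup>2 / 16))))"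
          by (simp add: algebra_simps)
        also have "\<dots> \<le> C2 * sqrt (vb x) * Jb x * (2 * exp 2 * (2 * x * exp (- (2 * \<eta>) * x) + 2 * exp ((2 * \<eta> + lam) * x - x\<^sup>2 / 16)))"
        proof (intro mult_left_mono add_mono)
          have "(lam + b + 4 * \<eta>) * x \<le> 1 * x" using lam(2) x by (intro mult_right_mono) auto
          then show "exp (2 * \<eta> * x) * exp (lam * x) * exp ((b - 1) * x) \<le> exp (- (2 * \<eta>) * x)"
            unfolding mult_exp_exp by (simp add: algebra_simps)
          show "exp (2 * \<eta> * x) * exp (lam * x) * exp (- x\<^sup>2 / 16) \<le> exp ((2 * \<eta> + lam) * x - x\<^sup>2 / 16)"
            unfolding mult_exp_exp by (simp add: algebra_simps)
        qed (use C2(1) vb0 J x in auto)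
        also note h4
        finally show ?thesis .
      qed
      have "exp (-1/2) * (c * exp (\<rho>1 * Psi)) \<le> exp (-1/2) * R" by (rule mult_left_mono[OF R1]) simp
      also note R2
      also have "(6 * V + W) * (\<Sum>m\<in>M. (f m)\<^sup>2) \<le> (6 * V + 1) * 4"
        using W1 V0 M(5) by (intro mult_mono) (auto intro: sum_nonneg)
      also have "\<dots> = 24 * C1 * real J * sqrt v * Sp + 52" by (simp add: V_def)
      finally have main: "exp (-1/2) * (c * exp (\<rho>1 * Psi)) \<le> 24 * C1 * real J * sqrt v * Sp + 52" .
      have low: "K * (4 * Jb x) powr (-3/4) * exp (d * Psi) * exp (\<rho>0 * Psi) \<le> exp (-1/2) * (c * exp (\<rho>1 * Psi))"
      proof -
        have e1: "exp (\<rho>1 * Psi) = exp (d * Psi) * exp (\<rho>0 * Psi)"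
          unfolding mult_exp_exp by (simp add: d_def algebra_simps)
        have "(4 * Jb x) powr (-3/4) \<le> (4 * real J) powr (-3/4)"
          using J by (intro powr_mono2') auto
        then have "1 * (4 * Jb x) powr (-3/4) \<le> sqrt v * (4 * real J) powr (-3/4)"
          using v1 by (intro mult_mono) auto
        then have "K * (1 * (4 * Jb x) powr (-3/4)) \<le> K * (sqrt v * (4 * real J) powr (-3/4))"
          using K by (intro mult_left_mono) auto
        then have "K * (4 * Jb x) powr (-3/4) \<le> exp (-1/2) * c"
          unfolding c_def K_def ev8 by (simp add: mult_ac)
        then have "K * (4 * Jb x) powr (-3/4) * (exp (d * Psi) * exp (\<rho>0 * Psi)) \<le> exp (-1/2) * c * (exp (d * Psi) * exp (\<rho>0 * Psi))"
          by (rule mult_right_mono) simp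
        then show ?thesis unfolding e1 by (simp only: mult.assoc)
      qed
      show "exp (\<rho>0 * sqrt (x * ln (ln x) / ln x)) \<le> S"
      proof (rule ccontr)
        assume "\<not> ?thesis"
        then have "S < exp (\<rho>0 * Psi)" by (simp add: Psi_def)
        then have Sp: "Sp \<le> exp (\<rho>0 * Psi)" by (simp add: Sp_def)
        have ge1: "1 \<le> exp (\<rho>0 * Psi)" using \<rho> Psi by simp
        have "24 * C1 * real J * sqrt v * Sp + 52 \<le> 24 * C1 * Jb x * sqrt (vb x) * exp (\<rho>0 * Psi) + 52 * exp (\<rho>0 * Psi)"
          using C1(1) J vle v1 Sp ge1 by (intro add_mono mult_mono mult_nonneg_nonneg) (auto simp: Sp_def)
        also have "\<dots> = (24 * C1 * Jb x * sqrt (vb x) + 52) * exp (\<rho>0 * Psi)" by (simp add: distrib_right)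
        also have "\<dots> < (K * (4 * Jb x) powr (-3/4) * exp (d * Psi)) * exp (\<rho>0 * Psi)"
          by (rule mult_strict_right_mono[OF h5]) simp
        finally show False using low main by linarith
      qed
    qed
  qed
qed

lemma zeta_deriv_large:
  assumes l: "l > 0" and \<beta>: "0 \<le> \<beta>" "\<beta> < 1" and \<rho>: "0 < \<rho>" "\<rho> < sqrt (1 - \<beta>)"
  shows "\<forall>\<^sub>F T in at_top. \<forall>S. (\<forall>t\<in>{T powr \<beta>..T}. Re ((deriv ^^ l) zeta (1 / 2 + \<i> * complex_of_real t)) \<le> S) \<longrightarrow>
     exp (\<rho> * sqrt (ln T * ln (ln (ln T)) / ln (ln T))) \<le> S"
proof -
  \<comment> \<open>Any \<open>lam\<close> strictly between \<open>\<rho>\<^sup>2\<close> and \<open>1 - \<beta>\<close> would do. The remaining gap \<open>g\<close> is shared by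
    \<open>b - \<beta>\<close>, which also makes \<open>b\<close> positive when \<open>\<beta> = 0\<close>, and the losses \<open>4 * \<eta>\<close>.\<close>
  define lam where "lam = (\<rho>\<^sup>2 + (1 - \<beta>)) / 2"
  have "\<rho>\<^sup>2 < (sqrt (1 - \<beta>))\<^sup>2" using \<rho> by (intro power_strict_mono) auto
  then have \<rho>2: "\<rho>\<^sup>2 < 1 - \<beta>" using \<beta> by simp
  have lam: "\<rho>\<^sup>2 < lam" "lam < 1 - \<beta>" using \<rho>2 by (auto simp: lam_def)
  have lam0: "lam > 0" using lam(1) by (smt (verit) zero_le_power2)
  have "\<rho> < sqrt lam" using lam(1) \<rho> by (intro real_less_rsqrt) auto
  define g where "g = 1 - \<beta> - lam"
  have lg: "lam + \<beta> + g = 1" by (simp add: g_def)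
  have g: "g > 0" "g \<le> 1" using lam lam0 \<beta> by (auto simp: g_def)
  have "\<forall>\<^sub>F x in at_top. \<forall>S. (\<forall>y. exp (\<beta> * x) \<le> y \<and> y \<le> exp x \<longrightarrow> Re (zeta_crit l y) \<le> S) \<longrightarrow>
     exp (\<rho> * sqrt (x * ln (ln x) / ln x)) \<le> S"
  proof (rule zeta_deriv_large_exponents[OF l \<beta>(1), where b="\<beta> + g / 2" and \<eta>="g / 8" and lam=lam and ?\<rho>1.0="(\<rho> + sqrt lam) / 2"])
    show "lam + (\<beta> + g / 2) + 4 * (g / 8) \<le> 1" using lg by linarith
    show "\<beta> + g / 2 < 1" using g lam0 lg by linarith
  qed (use g lam0 \<beta> \<rho> \<open>\<rho> < sqrt lam\<close> in auto)
  from eventually_compose_filterlim[OF this ln_at_top]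
  show ?thesis
    using eventually_gt_at_top[of 0]
  proof eventually_elim
    case (elim T)
    show ?case
    proof (intro allI impI)
      fix S assume S: "\<forall>t\<in>{T powr \<beta>..T}. Re ((deriv ^^ l) zeta (1 / 2 + \<i> * complex_of_real t)) \<le> S"
      have eq: "Complex (1/2) y = 1 / 2 + \<i> * complex_of_real y" for y by (simp add: complex_eq_iff)
      have "\<forall>y. exp (\<beta> * ln T) \<le> y \<and> y \<le> exp (ln T) \<longrightarrow> Re (zeta_crit l y) \<le> S"
        using S elim(2) by (auto simp: powr_def eq)
      then show "exp (\<rho> * sqrt (ln T * ln (ln (ln T)) / ln (ln T))) \<le> S" using elim(1) by blast
    qed
  qed
qed

lemma continuous_zeta_deriv_critical_line:
  "continuous_on UNIV (\<lambda>t. Re ((deriv ^^ l) zeta (1 / 2 + \<i> * complex_of_real t)))"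
proof -
  obtain g C where g: "g holomorphic_on UNIV" "C > 0"
    "\<And>s. s \<noteq> 1 \<Longrightarrow> (deriv ^^ l) zeta s = (-1)^l * fact l / (s-1)^(Suc l) + g s"
    "\<And>s. Re s \<ge> 1/2 \<Longrightarrow> norm (g s) \<le> C * (1 + norm s)"
    by (rule zeta_deriv_decomp[of l]) blast
  have ne: "1 / 2 + \<i> * complex_of_real t \<noteq> 1" for t by (simp add: complex_eq_iff)
  have ne': "((1 / 2 + \<i> * complex_of_real t) - 1) ^ Suc l \<noteq> 0" for t unfolding power_eq_0_iff right_minus_eq using ne[of t] by blast
  have "continuous_on UNIV (\<lambda>t. Re ((-1)^l * fact l / ((1 / 2 + \<i> * complex_of_real t)-1)^(Suc l) + g (1 / 2 + \<i> * complex_of_real t)))"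
    by (intro continuous_intros ballI ne' continuous_on_compose2[OF holomorphic_on_imp_continuous_on[OF g(1)]] subset_UNIV)
  then show ?thesis using g(3)[OF ne] by simp
qed

theorem corollary1:
  fixes l :: nat and \<beta> :: real
  assumes "0 < l" and "0 \<le> \<beta>" and "\<beta> < 1"
  shows "\<exists>\<epsilon> :: real \<Rightarrow> real. (\<epsilon> \<longlongrightarrow> 0) at_top \<and>
    (\<forall>\<^sub>F T in at_top. \<exists>t.
       is_arg_max (\<lambda>t. Re ((deriv ^^ l) zeta (1 / 2 + \<i> * complex_of_real t)))
         (\<lambda>t. t \<in> {T powr \<beta>..T}) t \<and>
       Re ((deriv ^^ l) zeta (1 / 2 + \<i> * complex_of_real t))
         \<ge> exp ((sqrt (1 - \<beta>) + \<epsilon> T) * sqrt (ln T * ln (ln (ln T)) / ln (ln T))))"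
proof -
  define F where "F = (\<lambda>t. Re ((deriv ^^ l) zeta (1 / 2 + \<i> * complex_of_real t)))"
  define Psi where "Psi = (\<lambda>T::real. sqrt (ln T * ln (ln (ln T)) / ln (ln T)))"
  define t where "t = (\<lambda>T. SOME t. is_arg_max F (\<lambda>t. t \<in> {T powr \<beta>..T}) t)"
  have t: "is_arg_max F (\<lambda>t. t \<in> {T powr \<beta>..T}) (t T)" if "T \<ge> 1" for T
  proof -
    have "T powr \<beta> \<le> T powr 1" using that assms by (intro powr_mono) auto
    then have "{T powr \<beta>..T} \<noteq> {}" using that by simp
    then obtain s where "s \<in> {T powr \<beta>..T}" "\<And>y. y \<in> {T powr \<beta>..T} \<Longrightarrow> F y \<le> F s"
      using continuous_attains_sup[OF compact_Icc _ continuous_on_subset[OF continuous_zeta_deriv_critical_line[of l] subset_UNIV]]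
      unfolding F_def by metis
    then have "is_arg_max F (\<lambda>t. t \<in> {T powr \<beta>..T}) s" by (force simp: is_arg_max_def)
    then show ?thesis unfolding t_def by (rule someI)
  qed
  define r where "r = sqrt (1 - \<beta>)"
  have r: "r > 0" using assms by (simp add: r_def)
  have large: "\<forall>\<^sub>F T in at_top. exp (\<rho> * Psi T) \<le> F (t T)" if "0 < \<rho>" "\<rho> < r" for \<rho>
    using zeta_deriv_large[OF assms that(1) that(2)[unfolded r_def]] eventually_ge_at_top[of 1]
  proof eventually_elim
    case (elim T)
    have "\<forall>s\<in>{T powr \<beta>..T}. F s \<le> F (t T)" using t[OF elim(2)] by (auto simp: is_arg_max_def not_less)
    then show ?case using elim(1) unfolding F_def Psi_def by blast
  qed
  have Psi: "\<forall>\<^sub>F T in at_top. Psi T > 0" unfolding Psi_def by real_asymp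
  have r2: "0 < r / 2" "r / 2 < r" using r by auto
  \<comment> \<open>The exponent attained at the maximum, in units of \<open>Psi T\<close> and relative to \<open>r\<close>. It is capped at 0
    because it is bounded from below only.\<close>
  define \<epsilon> where "\<epsilon> = (\<lambda>T. min 0 (ln (F (t T)) / Psi T - r))"
  have "(\<epsilon> \<longlongrightarrow> 0) at_top"
  proof (rule tendstoI)
    fix d :: real assume d: "d > 0"
    define \<rho> where "\<rho> = max (r - d / 2) (r / 2)"
    have \<rho>: "0 < \<rho>" "\<rho> < r" "r - \<rho> < d" using d r by (auto simp: \<rho>_def max_def)
    show "\<forall>\<^sub>F T in at_top. dist (\<epsilon> T) 0 < d"
      using large[OF \<rho>(1,2)] Psi
    proof eventually_elim
      case (elim T)
      have "\<rho> * Psi T \<le> ln (F (t T))" using elim(1) by (subst ln_ge_iff) (auto intro: less_le_trans[OF exp_gt_zero])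
      then have "\<rho> \<le> ln (F (t T)) / Psi T" using elim(2) by (simp add: pos_le_divide_eq)
      then show ?case using \<rho> d by (auto simp: \<epsilon>_def dist_real_def min_def)
    qed
  qed
  moreover have "\<forall>\<^sub>F T in at_top. is_arg_max F (\<lambda>t. t \<in> {T powr \<beta>..T}) (t T) \<and> F (t T) \<ge> exp ((r + \<epsilon> T) * Psi T)"
    using large[OF r2] Psi eventually_ge_at_top[of 1]
  proof eventually_elim
    case (elim T)
    have pos: "F (t T) > 0" using elim(1) r by (auto intro: less_le_trans[OF exp_gt_zero])
    have "r + \<epsilon> T \<le> ln (F (t T)) / Psi T" by (simp add: \<epsilon>_def)
    then have "(r + \<epsilon> T) * Psi T \<le> ln (F (t T))" using elim(2) by (simp add: pos_le_divide_eq)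
    then have "exp ((r + \<epsilon> T) * Psi T) \<le> F (t T)" using pos by (simp add: ln_ge_iff)
    then show ?case using t[OF elim(3)] by simp
  qed
  then have "\<forall>\<^sub>F T in at_top. \<exists>t. is_arg_max F (\<lambda>t. t \<in> {T powr \<beta>..T}) t \<and> F t \<ge> exp ((r + \<epsilon> T) * Psi T)"
    by eventually_elim blast
  ultimately show ?thesis unfolding F_def Psi_def r_def by blast
qed

end
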